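(* Let $M$ be a W$^*$-algebra with a faithful normal trace state $\tau$. Let $1 \in B \subset M$ be a W$^*$-subalgebra, and let $U,V \in M$ be unitaries such that $B\langle U,U^* \rangle$ is $B$-freely independent from $B \langle V,V^* \rangle$ in $(M,E_B)$. Then there is a holomorphic map $F:\mathbb{D}(B) \to \mathbb{D}(B)$ such that $$E_{B \langle U,U^* \rangle}\left( UVb(1-UVb)^{-1}\right) = UF(b)(1-UF(b))^{-1}$$ and $\|F(b)\| \leq \|b\|$ for all $b \in \mathbb{D}(B)$.
   Context: $B\langle U,U^*\rangle$ denotes the algebra generated (algebraically) by $B$, $U$, $U^*$. For a $*$-subalgebra $1\in N\subset M$, $E_N$ denotes the canonical $\tau$-preserving conditional expectation of $M$ onto $W^*(N)$, the von Neumann algebra generated by $N$. $B$-freely independent in $(M,E_B)$ means free with amalgamation over $B$ with respect to $E_B$. $\mathbb{D}(B)=\{b\in B:\|b\|<1\}$ is the open unit ball of $B$. *)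

theory Defs
  imports "HOL-Analysis.Analysis" "HOL-Library.Nonpos_Ints"
begin

class cstar_algebra = real_normed_algebra_1 + banach +
  fixes scaleC :: "complex \<Rightarrow> 'a \<Rightarrow> 'a"  (infixr "*\<^sub>C" 75)
    and adj :: "'a \<Rightarrow> 'a"
  assumes scaleR_eq_scaleC: "scaleR r x = complex_of_real r *\<^sub>C x"
    and scaleC_add_right: "a *\<^sub>C (x + y) = a *\<^sub>C x + a *\<^sub>C y"
    and scaleC_add_left: "(a + b) *\<^sub>C x = a *\<^sub>C x + b *\<^sub>C x"
    and scaleC_scaleC: "a *\<^sub>C b *\<^sub>C x = (a * b) *\<^sub>C x"
    and mult_scaleC_left: "(a *\<^sub>C x) * y = a *\<^sub>C (x * y)"
    and mult_scaleC_right: "x * (a *\<^sub>C y) = a *\<^sub>C (x * y)"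
    and norm_scaleC: "norm (a *\<^sub>C x) = cmod a * norm x"
    and adj_adj: "adj (adj x) = x"
    and adj_add: "adj (x + y) = adj x + adj y"
    and adj_scaleC: "adj (a *\<^sub>C x) = cnj a *\<^sub>C adj x"
    and adj_mult: "adj (x * y) = adj y * adj x"
    and norm_adj_mult_self: "norm (adj x * x) = (norm x)\<^sup>2"

definition unitary :: "'a::cstar_algebra \<Rightarrow> bool" where
  "unitary u \<longleftrightarrow> adj u * u = 1 \<and> u * adj u = 1"

text \<open>The two-sided inverse; only meaningful for invertible elements.\<close>
definition alg_inv :: "'a::monoid_mult \<Rightarrow> 'a" where
  "alg_inv x = (THE y. x * y = 1 \<and> y * x = 1)"

definition clinear_functional :: "('a::cstar_algebra \<Rightarrow> complex) \<Rightarrow> bool" where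
  "clinear_functional f \<longleftrightarrow>
     (\<forall>x y. f (x + y) = f x + f y) \<and> (\<forall>c x. f (c *\<^sub>C x) = c * f x)"

text \<open>
  A W*-algebra is a C*-algebra that is isometrically the dual of a Banach space. A predual is
  realised, through its canonical embedding, as a norm-closed complex subspace \<open>P\<close> of the dual of
  the algebra: evaluation is an isometry of the algebra onto the dual of \<open>P\<close>. The elements
  of \<open>P\<close> are the normal functionals; by Sakai's theorem there is at most one predual.
\<close>
definition wstar_predual :: "('a::cstar_algebra \<Rightarrow>\<^sub>L complex) set \<Rightarrow> bool" where
  "wstar_predual P \<longleftrightarrow>
     0 \<in> P \<and> (\<forall>\<phi>\<in>P. \<forall>\<psi>\<in>P. \<phi> + \<psi> \<in> P) \<and> (\<forall>c. \<forall>\<phi>\<in>P. blinfun_mult_right c o\<^sub>L \<phi> \<in> P) \<and>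
     closed P \<and>
     (\<forall>\<phi>\<in>P. clinear_functional (blinfun_apply \<phi>)) \<and>
     (\<forall>x. norm x = (SUP \<phi>\<in>{\<phi>\<in>P. norm \<phi> \<le> 1}. cmod (blinfun_apply \<phi> x))) \<and>
     (\<forall>\<Lambda> :: ('a \<Rightarrow>\<^sub>L complex) \<Rightarrow> complex.
        (\<forall>\<phi>\<in>P. \<forall>\<psi>\<in>P. \<Lambda> (\<phi> + \<psi>) = \<Lambda> \<phi> + \<Lambda> \<psi>) \<longrightarrow>
        (\<forall>c. \<forall>\<phi>\<in>P. \<Lambda> (blinfun_mult_right c o\<^sub>L \<phi>) = c * \<Lambda> \<phi>) \<longrightarrow>
        (\<exists>K. \<forall>\<phi>\<in>P. cmod (\<Lambda> \<phi>) \<le> K * norm \<phi>) \<longrightarrow>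
        (\<exists>x. \<forall>\<phi>\<in>P. \<Lambda> \<phi> = blinfun_apply \<phi> x))"

text \<open>The weak* topology, i.e. the coarsest topology making every element of \<open>P\<close> continuous.\<close>
definition weak_star_topology :: "('a::cstar_algebra \<Rightarrow>\<^sub>L complex) set \<Rightarrow> 'a topology" where
  "weak_star_topology P =
     topology_generated_by {blinfun_apply \<phi> -` G | \<phi> G. \<phi> \<in> P \<and> open G}"

text \<open>All subalgebras contain the unit of the ambient algebra.\<close>
definition subalgebra :: "'a::cstar_algebra set \<Rightarrow> bool" where
  "subalgebra A \<longleftrightarrow> 1 \<in> A \<and> (\<forall>x\<in>A. \<forall>y\<in>A. x + y \<in> A) \<and> (\<forall>c. \<forall>x\<in>A. c *\<^sub>C x \<in> A) \<and>
     (\<forall>x\<in>A. \<forall>y\<in>A. x * y \<in> A)"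

definition wstar_subalgebra :: "('a::cstar_algebra \<Rightarrow>\<^sub>L complex) set \<Rightarrow> 'a set \<Rightarrow> bool" where
  "wstar_subalgebra P A \<longleftrightarrow>
     subalgebra A \<and> (\<forall>x\<in>A. adj x \<in> A) \<and> closedin (weak_star_topology P) A"

definition generated_algebra :: "'a::cstar_algebra set \<Rightarrow> 'a set" where
  "generated_algebra S = \<Inter>{A. subalgebra A \<and> S \<subseteq> A}"

definition generated_wstar_algebra ::
  "('a::cstar_algebra \<Rightarrow>\<^sub>L complex) set \<Rightarrow> 'a set \<Rightarrow> 'a set" where
  "generated_wstar_algebra P S = \<Inter>{A. wstar_subalgebra P A \<and> S \<subseteq> A}"

definition faithful_normal_trace_state ::
  "('a::cstar_algebra \<Rightarrow>\<^sub>L complex) set \<Rightarrow> ('a \<Rightarrow> complex) \<Rightarrow> bool" where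
  "faithful_normal_trace_state P \<tau> \<longleftrightarrow>
     clinear_functional \<tau> \<and> \<tau> 1 = 1 \<and> (\<forall>x. \<tau> (adj x * x) \<in> \<real>\<^sub>\<ge>\<^sub>0) \<and>
     (\<forall>x y. \<tau> (x * y) = \<tau> (y * x)) \<and>
     (\<forall>x. \<tau> (adj x * x) = 0 \<longrightarrow> x = 0) \<and>
     \<tau> \<in> blinfun_apply ` P"

text \<open>
  \<open>E\<close> is the \<open>\<tau>\<close>-preserving conditional expectation onto the W*-subalgebra \<open>A\<close>. For a faithful
  trace state \<open>\<tau>\<close> such an \<open>E\<close> is unique.
\<close>
definition trace_cond_exp ::
  "('a::cstar_algebra \<Rightarrow> complex) \<Rightarrow> 'a set \<Rightarrow> ('a \<Rightarrow> 'a) \<Rightarrow> bool" where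
  "trace_cond_exp \<tau> A E \<longleftrightarrow>
     (\<forall>x y. E (x + y) = E x + E y) \<and> (\<forall>c x. E (c *\<^sub>C x) = c *\<^sub>C E x) \<and>
     (\<forall>x. E x \<in> A) \<and> (\<forall>a\<in>A. E a = a) \<and>
     (\<forall>a\<in>A. \<forall>b\<in>A. \<forall>x. E (a * x * b) = a * E x * b) \<and>
     (\<forall>x. norm (E x) \<le> norm x) \<and>
     (\<forall>x. \<exists>y. E (adj x * x) = adj y * y) \<and>
     (\<forall>x. \<tau> (E x) = \<tau> x)"

text \<open>
  Freeness with amalgamation over \<open>B\<close> with respect to \<open>E\<close> of a family of subalgebras
  \<open>A i\<close> containing \<open>B\<close>: alternating products of \<open>E\<close>-centred elements are \<open>E\<close>-centred.
\<close>
definition free_with_amalgamation ::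
  "'a::cstar_algebra set \<Rightarrow> ('a \<Rightarrow> 'a) \<Rightarrow> ('i \<Rightarrow> 'a set) \<Rightarrow> bool" where
  "free_with_amalgamation B E A \<longleftrightarrow>
     (\<forall>i. subalgebra (A i) \<and> B \<subseteq> A i) \<and>
     (\<forall>n \<iota> x. 1 \<le> n \<longrightarrow>
        (\<forall>j<n. x j \<in> A (\<iota> j) \<and> E (x j) = 0) \<longrightarrow>
        (\<forall>j. Suc j < n \<longrightarrow> \<iota> j \<noteq> \<iota> (Suc j)) \<longrightarrow>
        E (prod_list (map x [0..<n])) = 0)"

definition unit_ball_of :: "'a::cstar_algebra set \<Rightarrow> 'a set" where
  "unit_ball_of B = {b\<in>B. norm b < 1}"

text \<open>
  Holomorphy, as complex Frechet differentiability, of a \<open>B\<close>-valued map on a relatively open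
  subset \<open>S\<close> of the complex Banach space \<open>B\<close>. The constant \<open>has_derivative\<close> is not used
  because the derivative is an operator on \<open>B\<close> only.
\<close>
definition holomorphic_map_on ::
  "'a::cstar_algebra set \<Rightarrow> 'a set \<Rightarrow> ('a \<Rightarrow> 'a) \<Rightarrow> bool" where
  "holomorphic_map_on B S F \<longleftrightarrow>
     (\<forall>b\<in>S. F b \<in> B \<and>
       (\<exists>D. (\<forall>h\<in>B. D h \<in> B) \<and>
            (\<forall>h\<in>B. \<forall>k\<in>B. D (h + k) = D h + D k) \<and>
            (\<forall>c. \<forall>h\<in>B. D (c *\<^sub>C h) = c *\<^sub>C D h) \<and>
            (\<exists>K. \<forall>h\<in>B. norm (D h) \<le> K * norm h) \<and>
            ((\<lambda>x. norm (F x - F b - D (x - b)) / norm (x - b)) \<longlongrightarrow> 0) (at b within S)))"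

end

theory Submission
  imports Defs
begin

text \<open>
  Let \<open>Q = 1 - E\<^sub>B\<close> and consider in \<open>L\<^sup>2(M, \<tau>)\<close> the vector \<open>\<xi> = \<Sum>n. (U Q V b)\<^sup>n 1\<close>, which satisfies
  \<open>\<xi> = 1 + U Q V b \<xi>\<close>. With \<open>F(b) = E\<^sub>B (V b \<xi>)\<close> this reads \<open>(1 - U V b) \<xi> = 1 - U F(b)\<close>, so that
  \<open>\<xi> = (1 - U V b)\<^sup>-\<^sup>1 (1 - U F(b))\<close>. By freeness all terms of \<open>\<xi>\<close> but the first are orthogonal to
  \<open>B\<langle>U, U\<^sup>*\<rangle>\<close>; hence \<open>E\<^sub>U \<xi> = 1\<close>, which is the assertion. The estimate \<open>\<parallel>F(b)\<parallel> \<le> \<parallel>b\<parallel>\<close> and the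
  convergence of the power series of \<open>F\<close> hold for the operator norm on \<open>L\<^sup>2(B)\<close>, which equals the
  norm of \<open>B\<close> because \<open>\<tau>\<close> is faithful.

  The argument only shows orthogonality to the algebra \<open>B\<langle>U, U\<^sup>*\<rangle>\<close>; to pass to the W*-algebra it generates,
  one needs that \<open>L\<^sup>2\<close>-closures are weak* closed, i.e. that all functionals \<open>x \<mapsto> \<tau>(y x)\<close> are normal.
  It suffices to treat projections \<open>y = e\<close>, since dyadic expansions along spectral projections
  reach every positive \<open>y\<close>. By the Krein--Smulian theorem only the unit ball matters, and there
  the Peirce components of \<open>e\<close> are cut out by norm inequalities, which survive weak* limits.
\<close>

section \<open>C*-algebras\<close>

text \<open>The assertion amounts to \<open>E\<^sub>U\<close> mapping (1 - U V b)^-1 to (1 - U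
  F(b))^-1, so one looks for F(b) in B such that (1 - U V b)^-1 (1 - U F(b)) has expectation 1. This
  element is \<open>\<xi>\<close>; applying Q at each step of its series keeps the later terms free
  of a component in the algebra of U. L^2 is the right setting for the estimates: Q is a contraction
  there, whereas in operator norm it is only bounded by 2, which would control the series for small
  b only. The space is never completed: vectors such as \<open>\<xi>\<close> occur as partial sums,
  and operator norms on L^2 as inequalities between L^2 norms of elements of the algebra. The
  definition of a predual says nothing about products, so multiplication is not known to be weak*
  continuous, and of the functionals \<open>x \<mapsto> \<tau>(y x)\<close> only the one for y = 1
  is normal by hypothesis. Positivity is defined through the trace, and the functional calculus is
  the square root series alone; positive parts and spectral projections come from it and from limits
  of powers.\<close>

lemma scaleC_one [simp]: "1 *\<^sub>C x = (x::'a::cstar_algebra)"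
  using scaleR_eq_scaleC[of 1 x] by simp

lemma scaleC_zero_left [simp]: "0 *\<^sub>C x = (0::'a::cstar_algebra)"
  using scaleR_eq_scaleC[of 0 x] by simp

lemma scaleC_zero_right [simp]: "c *\<^sub>C (0::'a::cstar_algebra) = 0"
  using scaleC_add_right[of c 0 "0::'a"] by simp

lemma scaleC_minus_one: "(-1) *\<^sub>C x = - (x::'a::cstar_algebra)"
  using scaleR_eq_scaleC[of "-1" x] by simp

lemma scaleC_minus_right [simp]: "c *\<^sub>C (- x) = - (c *\<^sub>C (x::'a::cstar_algebra))"
  using scaleC_add_right[of c x "-x"] by (simp add: eq_neg_iff_add_eq_0 add.commute)

lemma scaleC_minus_left [simp]: "(- c) *\<^sub>C x = - (c *\<^sub>C (x::'a::cstar_algebra))"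
  using scaleC_scaleC[of "-1" c x] by (simp add: scaleC_minus_one)

lemma scaleC_diff_right: "c *\<^sub>C (x - y) = c *\<^sub>C x - c *\<^sub>C (y::'a::cstar_algebra)"
  using scaleC_add_right[of c x "-y"] by simp

lemma adj_0 [simp]: "adj 0 = (0::'a::cstar_algebra)"
  using adj_add[of 0 "0::'a"] by simp

lemma adj_minus [simp]: "adj (- x) = - adj (x::'a::cstar_algebra)"
  using adj_add[of x "-x"] by (simp add: eq_neg_iff_add_eq_0 add.commute)

lemma adj_diff: "adj (x - y) = adj x - adj (y::'a::cstar_algebra)"
  using adj_add[of x "-y"] by simp

lemma adj_1 [simp]: "adj 1 = (1::'a::cstar_algebra)"
  by (metis adj_adj adj_mult mult.left_neutral mult.right_neutral)

lemma adj_scaleR: "adj (r *\<^sub>R x) = r *\<^sub>R adj (x::'a::cstar_algebra)"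
  by (simp add: scaleR_eq_scaleC adj_scaleC)

lemma adj_power: "adj (x ^ n) = adj (x::'a::cstar_algebra) ^ n"
  by (induction n) (simp_all add: adj_mult power_commutes)

lemma norm_adj [simp]: "norm (adj x) = norm (x::'a::cstar_algebra)"
proof -
  have *: "norm y \<le> norm (adj y)" for y :: 'a
  proof (cases "y = 0")
    case False
    have "norm y * norm y \<le> norm (adj y) * norm y"
      using norm_mult_ineq[of "adj y" y] by (simp add: norm_adj_mult_self power2_eq_square)
    then show ?thesis using False by simp
  qed simp
  from *[of x] *[of "adj x"] show ?thesis by (simp add: adj_adj)
qed

lemma bounded_linear_adj: "bounded_linear (adj :: 'a::cstar_algebra \<Rightarrow> 'a)"
  by (rule bounded_linear_intro[where K=1]) (simp_all add: adj_add adj_scaleR)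

lemma unitary_mult_self [simp]:
  assumes "unitary u" shows "adj u * u = 1" "u * adj u = 1"
  using assms by (auto simp: unitary_def)

lemma norm_unitary:
  assumes "unitary u" shows "norm u = 1"
proof -
  have "(norm u)\<^sup>2 = 1" using norm_adj_mult_self[of u] assms by simp
  then show ?thesis by (simp add: power2_eq_1_iff) (smt (verit) norm_ge_zero)
qed

section \<open>Self-adjoint elements\<close>

definition self_adjoint :: "'a::cstar_algebra \<Rightarrow> bool" where
  "self_adjoint x \<longleftrightarrow> adj x = x"

lemma self_adjointD: "self_adjoint x \<Longrightarrow> adj x = x"
  by (simp add: self_adjoint_def)

lemma self_adjoint_simps [simp]:
  "self_adjoint 0" "self_adjoint 1" "self_adjoint (adj x * x)" "self_adjoint (x * adj x)"
  by (simp_all add: self_adjoint_def adj_mult adj_adj)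

lemma self_adjoint_add: "self_adjoint x \<Longrightarrow> self_adjoint y \<Longrightarrow> self_adjoint (x + y)"
  and self_adjoint_diff: "self_adjoint x \<Longrightarrow> self_adjoint y \<Longrightarrow> self_adjoint (x - y)"
  and self_adjoint_minus: "self_adjoint x \<Longrightarrow> self_adjoint (- x)"
  and self_adjoint_scaleR: "self_adjoint x \<Longrightarrow> self_adjoint (r *\<^sub>R x)"
  and self_adjoint_power: "self_adjoint x \<Longrightarrow> self_adjoint (x ^ n)"
  and self_adjoint_mult: "self_adjoint x \<Longrightarrow> self_adjoint y \<Longrightarrow> x * y = y * x \<Longrightarrow> self_adjoint (x * y)"
  by (simp_all add: self_adjoint_def adj_add adj_diff adj_scaleR adj_power adj_mult)

lemma norm_square_self_adjoint:
  assumes "self_adjoint x" shows "norm (x * x) = (norm x)\<^sup>2"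
  using norm_adj_mult_self[of x] assms by (simp add: self_adjoint_def)

subsection \<open>Square roots\<close>

definition sqrt_coeff :: "nat \<Rightarrow> real" where
  "sqrt_coeff n = (-1) ^ n * ((1/2) gchoose n)"

lemma sqrt_coeff_0 [simp]: "sqrt_coeff 0 = 1"
  by (simp add: sqrt_coeff_def)

lemma sqrt_coeff_Suc: "real (Suc n) * sqrt_coeff (Suc n) = (real n - 1/2) * sqrt_coeff n"
proof -
  have "((1/2::real) gchoose Suc n) * real (Suc n) = (1/2 - real n) * ((1/2) gchoose n)"
    using gbinomial_mult_1[of "1/2::real" n] by (simp add: algebra_simps)
  from arg_cong[OF this, of "\<lambda>t. (-1) ^ n * t"] show ?thesis
    by (simp add: sqrt_coeff_def algebra_simps)
qed

lemma sqrt_coeff_nonpos: "sqrt_coeff (Suc n) \<le> 0"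
proof (induction n)
  case 0
  show ?case using sqrt_coeff_Suc[of 0] by simp
next
  case (Suc n)
  have "real (Suc (Suc n)) * sqrt_coeff (Suc (Suc n)) \<le> 0"
    unfolding sqrt_coeff_Suc[of "Suc n"] using Suc by (intro mult_nonneg_nonpos) auto
  then show ?case by (simp add: mult_le_0_iff)
qed

text \<open>The closed form makes the partial sums nonnegative, because the next coefficient is not
  positive. This gives absolute convergence on the boundary of the unit disc without asymptotics of
  the coefficients.\<close>

lemma sum_sqrt_coeff: "(\<Sum>k\<le>m. sqrt_coeff k) = - 2 * real (Suc m) * sqrt_coeff (Suc m)"
proof (induction m)
  case 0
  show ?case using sqrt_coeff_Suc[of 0] by simp
next
  case (Suc m)
  show ?case using Suc sqrt_coeff_Suc[of "Suc m"] by (simp add: algebra_simps)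
qed

lemma sum_abs_sqrt_coeff: "(\<Sum>k<m. \<bar>sqrt_coeff (Suc k)\<bar>) \<le> 1"
proof -
  have "(\<Sum>k<m. \<bar>sqrt_coeff (Suc k)\<bar>) = - (\<Sum>k<m. sqrt_coeff (Suc k))"
    using sqrt_coeff_nonpos by (simp add: sum_negf abs_of_nonpos)
  also have "\<dots> = 1 - (\<Sum>k\<le>m. sqrt_coeff k)"
    unfolding sum.atMost_shift by simp
  also have "\<dots> \<le> 1"
    unfolding sum_sqrt_coeff using sqrt_coeff_nonpos[of m] mult_nonpos_nonpos[of "- 2 - 2 * real m" "sqrt_coeff (Suc m)"]
    by (simp add: algebra_simps)
  finally show ?thesis .
qed

lemma summable_sqrt_coeff_Suc: "summable (\<lambda>n. \<bar>sqrt_coeff (Suc n)\<bar>)"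
  by (rule summableI_nonneg_bounded[where x=1]) (auto intro: sum_abs_sqrt_coeff)

lemma suminf_sqrt_coeff_Suc: "(\<Sum>n. \<bar>sqrt_coeff (Suc n)\<bar>) \<le> 1"
  by (rule suminf_le_const[OF summable_sqrt_coeff_Suc]) (rule sum_abs_sqrt_coeff)

lemma summable_sqrt_coeff: "summable (\<lambda>n. \<bar>sqrt_coeff n\<bar>)"
  using summable_sqrt_coeff_Suc summable_Suc_iff[of "\<lambda>n. \<bar>sqrt_coeff n\<bar>"] by simp

text \<open>The principal square root of \<open>1 - x\<close>; the binomial series converges for \<open>\<parallel>x\<parallel> \<le> 1\<close>.\<close>
definition sqrt_one_minus :: "'a::{real_normed_algebra_1,banach} \<Rightarrow> 'a" where
  "sqrt_one_minus x = (\<Sum>n. sqrt_coeff n *\<^sub>R x ^ n)"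

lemma norm_power_le_1: "norm (x::'a::real_normed_algebra_1) \<le> 1 \<Longrightarrow> norm (x ^ n) \<le> 1"
  by (metis norm_ge_zero norm_power_ineq order_trans power_le_one)

context
  fixes x :: "'a::{real_normed_algebra_1,banach}"
  assumes x: "norm x \<le> 1"
begin

lemma norm_sqrt_term_le: "norm (sqrt_coeff n *\<^sub>R x ^ n) \<le> \<bar>sqrt_coeff n\<bar>"
  using norm_power_le_1[OF x, of n] by (simp add: mult_left_le)

lemma summable_norm_sqrt_one_minus: "summable (\<lambda>n. norm (sqrt_coeff n *\<^sub>R x ^ n))"
  by (rule summable_comparison_test'[OF summable_sqrt_coeff, of 0]) (simp add: norm_sqrt_term_le[simplified])

lemma sqrt_one_minus_sums: "(\<lambda>n. sqrt_coeff n *\<^sub>R x ^ n) sums sqrt_one_minus x"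
  unfolding sqrt_one_minus_def
  by (rule summable_sums[OF summable_norm_cancel[OF summable_norm_sqrt_one_minus]])

text \<open>The convolved coefficients are given by Vandermonde's identity for 1/2 + 1/2 = 1, so the
  Cauchy product is the binomial series of exponent 1, which stops after two terms.\<close>

lemma sqrt_one_minus_square: "sqrt_one_minus x * sqrt_one_minus x = 1 - x"
proof -
  have c: "(\<Sum>i\<le>k. sqrt_coeff i * sqrt_coeff (k - i)) = (if k = 0 then 1 else if k = 1 then -1 else 0)" for k
  proof -
    have "(\<Sum>i\<le>k. sqrt_coeff i * sqrt_coeff (k - i))
        = (\<Sum>i\<le>k. (-1)^k * (((1/2) gchoose i) * ((1/2) gchoose (k - i))))"
      unfolding sqrt_coeff_def
      by (rule sum.cong) (auto simp: power_add[symmetric] algebra_simps intro!: arg_cong2[where f="(*)"])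
    also have "\<dots> = (-1)^k * (1 gchoose k)"
      using gbinomial_Vandermonde[of "1/2::real" "1/2" k] by (simp flip: sum_distrib_left add: atMost_atLeast0)
    also have "(1 gchoose k) = (of_nat (1 choose k) :: real)"
      using binomial_gbinomial[of 1 k, where 'a=real] by simp
    finally show ?thesis by (cases k; cases "k - 1") auto
  qed
  have "sqrt_one_minus x * sqrt_one_minus x
      = (\<Sum>k. \<Sum>i\<le>k. (sqrt_coeff i *\<^sub>R x ^ i) * (sqrt_coeff (k - i) *\<^sub>R x ^ (k - i)))"
    unfolding sqrt_one_minus_def
    by (rule Cauchy_product) (rule summable_norm_sqrt_one_minus)+
  also have "\<dots> = (\<Sum>k. (\<Sum>i\<le>k. sqrt_coeff i * sqrt_coeff (k - i)) *\<^sub>R x ^ k)"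
    by (auto intro!: suminf_cong sum.cong simp: scaleR_sum_left power_add[symmetric])
  also have "\<dots> = (\<Sum>k\<in>{0,1}. (if k = 0 then 1 else if k = 1 then -1 else 0::real) *\<^sub>R x ^ k)"
    unfolding c by (rule suminf_finite) auto
  also have "\<dots> = 1 - x" by simp
  finally show ?thesis .
qed

text \<open>The absolute values of the coefficients after the first sum to at most 1. Hence the root
  is again of the form 1 - y with y in the unit ball, and a further root can be taken.\<close>

lemma norm_one_minus_sqrt: "norm (1 - sqrt_one_minus x) \<le> 1"
proof -
  have "(\<lambda>n. sqrt_coeff (Suc n) *\<^sub>R x ^ Suc n) sums (sqrt_one_minus x - 1)"
    using sqrt_one_minus_sums sums_Suc_iff[of "\<lambda>n. sqrt_coeff n *\<^sub>R x ^ n"] by simp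
  then have "sqrt_one_minus x - 1 = (\<Sum>n. sqrt_coeff (Suc n) *\<^sub>R x ^ Suc n)"
    by (simp add: sums_iff)
  also have "norm \<dots> \<le> (\<Sum>n. \<bar>sqrt_coeff (Suc n)\<bar>)"
    by (rule norm_suminf_le[OF _ summable_sqrt_coeff_Suc]) (rule norm_sqrt_term_le)
  also have "\<dots> \<le> 1" by (rule suminf_sqrt_coeff_Suc)
  finally show ?thesis by (simp add: norm_minus_commute)
qed

lemma sqrt_one_minus_commute:
  assumes "x * y = y * x" shows "sqrt_one_minus x * y = y * sqrt_one_minus x"
proof -
  have p: "x ^ n * y = y * x ^ n" for n
    using assms by (metis power_commuting_commutes)
  have "(\<lambda>n. (sqrt_coeff n *\<^sub>R x ^ n) * y) sums (sqrt_one_minus x * y)"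
    by (rule sums_mult2[OF sqrt_one_minus_sums])
  moreover have "(\<lambda>n. y * (sqrt_coeff n *\<^sub>R x ^ n)) sums (y * sqrt_one_minus x)"
    by (rule sums_mult[OF sqrt_one_minus_sums])
  ultimately show ?thesis by (simp add: p sums_unique2)
qed

end

lemma self_adjoint_sqrt_one_minus:
  assumes "norm x \<le> 1" "self_adjoint x" shows "self_adjoint (sqrt_one_minus x)"
proof -
  have "(\<lambda>n. adj (sqrt_coeff n *\<^sub>R x ^ n)) sums adj (sqrt_one_minus x)"
    using bounded_linear.sums[OF bounded_linear_adj sqrt_one_minus_sums[OF assms(1)]] .
  then have "(\<lambda>n. sqrt_coeff n *\<^sub>R x ^ n) sums adj (sqrt_one_minus x)"
    using assms(2) by (simp add: adj_scaleR adj_power self_adjoint_def)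
  then show ?thesis
    using sqrt_one_minus_sums[OF assms(1)] by (simp add: self_adjoint_def sums_unique2)
qed

text \<open>Norm closedness is all that square roots need. The definition covers the whole algebra
  as well as W*-subalgebras, so that the same lemmas yield estimates inside B.\<close>

definition closed_star_subalgebra :: "'a::cstar_algebra set \<Rightarrow> bool" where
  "closed_star_subalgebra A \<longleftrightarrow> subalgebra A \<and> (\<forall>x\<in>A. adj x \<in> A) \<and> closed A"

lemma subalgebraD:
  assumes "subalgebra A"
  shows subalgebra_one: "1 \<in> A" and subalgebra_add: "x \<in> A \<Longrightarrow> y \<in> A \<Longrightarrow> x + y \<in> A"
    and subalgebra_scaleC: "x \<in> A \<Longrightarrow> c *\<^sub>C x \<in> A" and subalgebra_mult: "x \<in> A \<Longrightarrow> y \<in> A \<Longrightarrow> x * y \<in> A"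
    and subalgebra_zero: "0 \<in> A" and subalgebra_minus: "x \<in> A \<Longrightarrow> - x \<in> A"
    and subalgebra_diff: "x \<in> A \<Longrightarrow> y \<in> A \<Longrightarrow> x - y \<in> A"
    and subalgebra_scaleR: "x \<in> A \<Longrightarrow> r *\<^sub>R x \<in> A"
    and subalgebra_power: "x \<in> A \<Longrightarrow> x ^ n \<in> A"
proof -
  show 1: "1 \<in> A" and a: "\<And>x y. x \<in> A \<Longrightarrow> y \<in> A \<Longrightarrow> x + y \<in> A"
    and s: "\<And>x c. x \<in> A \<Longrightarrow> c *\<^sub>C x \<in> A" and m: "\<And>x y. x \<in> A \<Longrightarrow> y \<in> A \<Longrightarrow> x * y \<in> A"
    using assms by (auto simp: subalgebra_def)
  show "0 \<in> A" using s[OF 1, of 0] by simp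
  show mi: "\<And>x. x \<in> A \<Longrightarrow> - x \<in> A" using s[of _ "-1"] by simp
  show "\<And>x y. x \<in> A \<Longrightarrow> y \<in> A \<Longrightarrow> x - y \<in> A" using a mi by fastforce
  show "\<And>x. x \<in> A \<Longrightarrow> r *\<^sub>R x \<in> A" by (simp add: scaleR_eq_scaleC s)
  show "x \<in> A \<Longrightarrow> x ^ n \<in> A" by (induction n) (auto intro: 1 m)
qed

lemma subalgebra_sum:
  assumes "subalgebra A" "\<And>i. i \<in> I \<Longrightarrow> f i \<in> A" shows "sum f I \<in> A"
  using assms(2) by (induction I rule: infinite_finite_induct) (auto intro: subalgebraD[OF assms(1)])

lemma closed_star_subalgebra_UNIV: "closed_star_subalgebra UNIV"
  by (simp add: closed_star_subalgebra_def subalgebra_def)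

lemma closed_sums_mem:
  assumes "closed A" "\<And>n. (\<Sum>k<n. f k) \<in> A" "f sums s" shows "s \<in> A"
  using assms by (metis closed_sequentially sums_def)

lemma sqrt_one_minus_mem:
  assumes "closed_star_subalgebra A" "x \<in> A" "norm x \<le> 1" shows "sqrt_one_minus x \<in> A"
proof (rule closed_sums_mem[OF _ _ sqrt_one_minus_sums[OF assms(3)]])
  have A: "subalgebra A" "closed A" using assms(1) by (auto simp: closed_star_subalgebra_def)
  then show "closed A" by blast
  show "(\<Sum>k<n. sqrt_coeff k *\<^sub>R x ^ k) \<in> A" for n
    using A assms(2) by (intro subalgebra_sum subalgebra_scaleR subalgebra_power) auto
qed

text \<open>\<open>h + i l\<close> is normal, and \<open>h\<close> is its real part.\<close>
lemma norm_sum_squares: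
  assumes h: "self_adjoint h" and l: "self_adjoint l" and hl: "h * l = l * h"
    and sq: "h * h + l * l = c *\<^sub>R 1" and c: "0 \<le> c"
  shows "norm (h * h - l * l) \<le> c" "(norm h)\<^sup>2 \<le> c"
proof -
  define w where "w = h + \<i> *\<^sub>C l"
  have aw: "adj w = h - \<i> *\<^sub>C l"
    using h l by (simp add: w_def adj_add adj_scaleC self_adjoint_def)
  have "adj w * w = h * h + l * l"
    unfolding aw by (simp add: w_def algebra_simps mult_scaleC_left mult_scaleC_right scaleC_add_right scaleC_scaleC hl scaleC_diff_right scaleC_minus_one)
  then have n: "(norm w)\<^sup>2 = c"
    using norm_adj_mult_self[of w] sq c by simp
  have ww: "w * w = h * h - l * l + 2 *\<^sub>R (\<i> *\<^sub>C (h * l))"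
    by (simp add: w_def algebra_simps mult_scaleC_left mult_scaleC_right scaleC_add_right scaleC_scaleC hl scaleR_2 scaleC_minus_one)
  have aww: "adj (w * w) = h * h - l * l - 2 *\<^sub>R (\<i> *\<^sub>C (h * l))"
    unfolding ww using h l hl by (simp add: adj_add adj_diff adj_mult adj_scaleR adj_scaleC self_adjoint_def)
  \<comment> \<open>Passing to real parts does not increase the norm, and
    \<open>norm (w * w)\<close> is at most \<open>(norm w)\<^sup>2 = c\<close>.\<close>
  have "2 *\<^sub>R (h * h - l * l) = w * w + adj (w * w)"
    unfolding aww unfolding ww by (simp add: scaleR_2)
  then have "2 * norm (h * h - l * l) \<le> norm (w * w) + norm (adj (w * w))"
    by (metis norm_scaleR norm_triangle_ineq abs_numeral)
  also have "\<dots> \<le> 2 * c"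
    using norm_mult_ineq[of w w] n by (simp add: power2_eq_square)
  finally show "norm (h * h - l * l) \<le> c" by simp
  have "2 *\<^sub>R h = w + adj w" unfolding aw by (simp add: w_def scaleR_2)
  then have "2 * norm h \<le> norm w + norm (adj w)"
    by (metis norm_scaleR norm_triangle_ineq abs_numeral)
  then have "norm h \<le> norm w" by simp
  then show "(norm h)\<^sup>2 \<le> c" using n power_mono[of "norm h" "norm w" 2] by simp
qed

section \<open>Faithful trace states\<close>

locale trace_state =
  fixes \<tau> :: "'a::cstar_algebra \<Rightarrow> complex"
  assumes clinear: "clinear_functional \<tau>"
    and tau_1 [simp]: "\<tau> 1 = 1"
    and tau_nonneg: "\<tau> (adj x * x) \<in> \<real>\<^sub>\<ge>\<^sub>0"
    and tau_commute: "\<tau> (x * y) = \<tau> (y * x)"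
    and faithful: "\<tau> (adj x * x) = 0 \<Longrightarrow> x = 0"
begin

lemma tau_add: "\<tau> (x + y) = \<tau> x + \<tau> y"
  and tau_scaleC: "\<tau> (c *\<^sub>C x) = c * \<tau> x"
  using clinear by (auto simp: clinear_functional_def)

lemma tau_scaleR: "\<tau> (r *\<^sub>R x) = of_real r * \<tau> x"
  by (simp add: scaleR_eq_scaleC tau_scaleC)

lemma tau_0 [simp]: "\<tau> 0 = 0"
  using tau_scaleC[of 0 0] by simp

lemma tau_minus: "\<tau> (- x) = - \<tau> x"
  using tau_scaleC[of "-1" x] by simp

lemma tau_diff: "\<tau> (x - y) = \<tau> x - \<tau> y"
  using tau_add[of x "-y"] by (simp add: tau_minus)

lemmas tau_simps = tau_add tau_diff tau_minus tau_scaleC tau_scaleR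

text \<open>Polarisation: \<tau> is real on \<open>adj y * y\<close> for y = 1 + x, which fixes the
  imaginary part, and for y = 1 + i x, which fixes the real part.\<close>

lemma tau_adj: "\<tau> (adj x) = cnj (\<tau> x)"
proof -
  have r: "Im (\<tau> (adj y * y)) = 0" for y
    using tau_nonneg[of y] by (auto simp: nonneg_Reals_def)
  have "Im (\<tau> x) + Im (\<tau> (adj x)) = 0"
    using r[of "1 + x"] r[of x] by (simp add: adj_add algebra_simps tau_simps)
  moreover have "Re (\<tau> x) - Re (\<tau> (adj x)) = 0"
    using r[of "1 + \<i> *\<^sub>C x"] r[of x]
    by (simp add: adj_add adj_scaleC algebra_simps tau_simps mult_scaleC_left mult_scaleC_right scaleC_scaleC scaleC_add_right)
  ultimately show ?thesis by (simp add: complex_eq_iff)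
qed

definition norm2 :: "'a \<Rightarrow> real" where
  "norm2 x = sqrt (Re (\<tau> (adj x * x)))"

lemma Re_tau_nonneg: "0 \<le> Re (\<tau> (adj x * x))"
  using tau_nonneg[of x] by (auto simp: nonneg_Reals_def)

lemma norm2_nonneg [simp]: "0 \<le> norm2 x"
  by (simp add: norm2_def Re_tau_nonneg)

lemma norm2_square: "(norm2 x)\<^sup>2 = Re (\<tau> (adj x * x))"
  by (simp add: norm2_def Re_tau_nonneg)

lemma tau_adj_mult_self: "\<tau> (adj x * x) = of_real ((norm2 x)\<^sup>2)"
  using tau_nonneg[of x] by (auto simp: norm2_square nonneg_Reals_def complex_eq_iff)

lemma norm2_eq_0_iff [simp]: "norm2 x = 0 \<longleftrightarrow> x = 0"
  using tau_adj_mult_self[of x] faithful[of x] by (auto simp: norm2_def)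

lemma norm2_0 [simp]: "norm2 0 = 0" by simp

lemma norm2_1 [simp]: "norm2 1 = 1" by (simp add: norm2_def)

lemma norm2_adj [simp]: "norm2 (adj x) = norm2 x"
  by (simp add: norm2_def adj_adj tau_commute)

lemma norm2_scaleC: "norm2 (c *\<^sub>C x) = cmod c * norm2 x"
proof -
  have "\<tau> (adj (c *\<^sub>C x) * (c *\<^sub>C x)) = of_real ((cmod c)\<^sup>2 * (norm2 x)\<^sup>2)"
    using complex_norm_square[of c]
    by (simp add: adj_scaleC mult_scaleC_left mult_scaleC_right scaleC_scaleC tau_scaleC tau_adj_mult_self)
  then show ?thesis
    by (simp add: norm2_def[of "c *\<^sub>C x"] real_sqrt_mult)
qed

lemma norm2_scaleR: "norm2 (r *\<^sub>R x) = \<bar>r\<bar> * norm2 x"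
  by (simp add: scaleR_eq_scaleC norm2_scaleC)

lemma norm2_minus [simp]: "norm2 (- x) = norm2 x"
  using norm2_scaleR[of "-1" x] by simp

lemma norm2_minus_commute: "norm2 (x - y) = norm2 (y - x)"
  using norm2_minus[of "x - y"] by simp

lemma tau_adj_mult: "\<tau> (adj y * x) = cnj (\<tau> (adj x * y))"
  using tau_adj[of "adj x * y"] by (simp add: adj_mult adj_adj)

lemma Cauchy_Schwarz: "cmod (\<tau> (adj x * y)) \<le> norm2 x * norm2 y"
proof (cases "x = 0")
  case False
  define c where "c = \<tau> (adj x * y)"
  define n where "n = (norm2 x)\<^sup>2"
  have n: "n > 0" using False by (simp add: n_def)
  \<comment> \<open>This is n times the component of y orthogonal to x; the factor n avoids a
    division.\<close>
  define z where "z = n *\<^sub>R y - c *\<^sub>C x"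
  have "\<tau> (adj z * z) = of_real (n * n * (norm2 y)\<^sup>2 - n * (cmod c)\<^sup>2)"
    using complex_norm_square[of c]
    by (simp add: z_def adj_diff adj_scaleR adj_scaleC algebra_simps mult_scaleC_left mult_scaleC_right
        scaleC_scaleC tau_simps tau_adj_mult_self tau_adj_mult[of y x] c_def[symmetric] n_def)
  then have "0 \<le> n * n * (norm2 y)\<^sup>2 - n * (cmod c)\<^sup>2"
    using Re_tau_nonneg[of z] by simp
  then have "n * (cmod c)\<^sup>2 \<le> n * (n * (norm2 y)\<^sup>2)" by (simp add: algebra_simps)
  then have "(cmod c)\<^sup>2 \<le> (norm2 x * norm2 y)\<^sup>2"
    using n by (simp only: mult_le_cancel_left_pos) (simp add: n_def power_mult_distrib)
  then show ?thesis unfolding c_def by (rule power2_le_imp_le) simp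
qed simp

lemma norm2_add_square: "(norm2 (x + y))\<^sup>2 = (norm2 x)\<^sup>2 + (norm2 y)\<^sup>2 + 2 * Re (\<tau> (adj x * y))"
  unfolding norm2_square by (simp add: adj_add algebra_simps tau_simps tau_adj_mult[of y x])

lemma norm2_triangle: "norm2 (x + y) \<le> norm2 x + norm2 y"
proof (rule power2_le_imp_le)
  have "Re (\<tau> (adj x * y)) \<le> norm2 x * norm2 y"
    by (rule order_trans[OF complex_Re_le_cmod Cauchy_Schwarz])
  then show "(norm2 (x + y))\<^sup>2 \<le> (norm2 x + norm2 y)\<^sup>2"
    unfolding norm2_add_square by (simp add: power2_sum)
qed simp

lemma norm2_diff_le: "norm2 (x - y) \<le> norm2 x + norm2 y"
  using norm2_triangle[of x "- y"] by simp

lemma norm2_diff_abs: "\<bar>norm2 x - norm2 y\<bar> \<le> norm2 (x - y)"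
  using norm2_triangle[of "x - y" y] norm2_triangle[of "y - x" x] norm2_minus_commute[of x y] by simp

lemma norm2_pythagoras: "\<tau> (adj x * y) = 0 \<Longrightarrow> (norm2 (x + y))\<^sup>2 = (norm2 x)\<^sup>2 + (norm2 y)\<^sup>2"
  by (simp add: norm2_add_square)

lemma norm2_unitary_mult:
  assumes "unitary u" shows "norm2 (u * x) = norm2 x"
  using assms by (simp add: norm2_def adj_mult mult.assoc[symmetric]) (simp add: mult.assoc)

text \<open>For a contraction x' the element \<open>1 - adj x' * x'\<close> has a self-adjoint root
  s, and the defect in the inequality is the square of \<open>norm2 (s * y)\<close>. After
  normalisation \<open>adj x' * x'\<close> has norm exactly 1, so the boundary case of the root
  series is needed.\<close>

lemma norm2_mult_left: "norm2 (x * y) \<le> norm x * norm2 y"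
proof (cases "x = 0")
  case False
  define x' where "x' = (1 / norm x) *\<^sub>R x"
  have "norm x' = 1" using False by (simp add: x'_def)
  then have n: "norm (adj x' * x') \<le> 1" by (simp add: norm_adj_mult_self)
  define s where "s = sqrt_one_minus (adj x' * x')"
  have s: "adj s = s" "s * s = 1 - adj x' * x'"
    unfolding s_def by (rule self_adjointD, rule self_adjoint_sqrt_one_minus[OF n], simp)
      (rule sqrt_one_minus_square[OF n])
  have "adj (s * y) * (s * y) = adj y * (s * s) * y" by (simp add: adj_mult s(1) mult.assoc)
  also have "\<dots> = adj y * y - adj (x' * y) * (x' * y)" by (simp add: s(2) adj_mult algebra_simps)
  finally have "(norm2 (s * y))\<^sup>2 = (norm2 y)\<^sup>2 - (norm2 (x' * y))\<^sup>2"
    by (simp add: norm2_square tau_diff)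
  then have "(norm2 (x' * y))\<^sup>2 \<le> (norm2 y)\<^sup>2" by (metis diff_ge_0_iff_ge zero_le_power2)
  then have "norm2 (x' * y) \<le> norm2 y" by (rule power2_le_imp_le) simp
  moreover have "norm2 (x' * y) = norm2 (x * y) / norm x"
    by (simp add: x'_def norm2_scaleR)
  ultimately show ?thesis using False by (simp add: field_simps)
qed simp

text \<open>Traciality makes the adjoint isometric for \<open>norm2\<close>, which exchanges the two
  sides.\<close>

lemma norm2_mult_right: "norm2 (x * y) \<le> norm2 x * norm y"
  using norm2_mult_left[of "adj y" "adj x"] norm2_adj[of "x * y"] by (simp add: adj_mult mult.commute)

lemma norm2_le_norm: "norm2 x \<le> norm x"
  using norm2_mult_left[of x 1] by simp

lemma tau_mult_le: "cmod (\<tau> (x * y)) \<le> norm2 x * norm2 y"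
  using Cauchy_Schwarz[of "adj x" y] by (simp add: adj_adj)

subsection \<open>The order\<close>

text \<open>The test vectors y are restricted to A so that an element of B can be shown to be
  positive, and its norm bounded, with vectors from B only.\<close>

definition positive_on :: "'a set \<Rightarrow> 'a \<Rightarrow> bool" where
  "positive_on A a \<longleftrightarrow> self_adjoint a \<and> (\<forall>y\<in>A. 0 \<le> Re (\<tau> (adj y * a * y)))"

lemma positive_on_add: "positive_on A a \<Longrightarrow> positive_on A b \<Longrightarrow> positive_on A (a + b)"
  by (auto simp: positive_on_def self_adjoint_add algebra_simps tau_simps)

lemma positive_on_scaleR: "positive_on A a \<Longrightarrow> 0 \<le> r \<Longrightarrow> positive_on A (r *\<^sub>R a)"
  by (auto simp: positive_on_def self_adjoint_scaleR tau_simps)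

lemma positive_on_adj_mult_self: "positive_on A (adj x * x)"
  using Re_tau_nonneg by (auto simp: positive_on_def) (metis adj_mult mult.assoc)

lemma positive_on_conj: "positive_on UNIV a \<Longrightarrow> positive_on UNIV (adj x * a * x)"
proof (unfold positive_on_def, safe)
  fix y assume "self_adjoint a" "\<forall>y\<in>UNIV. 0 \<le> Re (\<tau> (adj y * a * y))"
  then have "0 \<le> Re (\<tau> (adj (x * y) * a * (x * y)))" by blast
  then show "0 \<le> Re (\<tau> (adj y * (adj x * a * x) * y))" by (simp add: adj_mult mult.assoc)
qed (simp add: self_adjoint_def adj_mult adj_adj mult.assoc)

text \<open>The root of the absolute value: |a| is the root of 1 - (1 - a^2), and t the root of 1 -
  (1 - |a|). That 1 - a^2 lies in the unit ball follows from \<open>norm_sum_squares\<close> for a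
  and a root l of 1 - a^2; that 1 - |a| does is the bound for the remainder of the series.\<close>

lemma abs_square_root:
  assumes A: "closed_star_subalgebra A" and a: "a \<in> A" "self_adjoint a" "norm a \<le> 1"
  obtains t where "t \<in> A" "self_adjoint t" "t * t * (t * t) = a * a" "norm (1 - t * t) \<le> 1"
    "\<And>y. a * y = y * a \<Longrightarrow> t * y = y * t"
proof -
  have A': "subalgebra A" using A by (simp add: closed_star_subalgebra_def)
  have n1: "norm (a * a) \<le> 1" using a norm_square_self_adjoint[of a] by (simp add: power_le_one)
  define l where "l = sqrt_one_minus (a * a)"
  have saa: "self_adjoint (a * a)" using a by (simp add: self_adjoint_mult)
  have l: "self_adjoint l" "l * l = 1 - a * a"
    unfolding l_def by (rule self_adjoint_sqrt_one_minus[OF n1 saa], rule sqrt_one_minus_square[OF n1])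
  have la: "l * a = a * l" unfolding l_def
    by (rule sqrt_one_minus_commute[OF n1]) (simp add: mult.assoc)
  have "(norm l)\<^sup>2 \<le> 1"
    using norm_sum_squares(2)[of l a 1] l a la by simp
  then have n2: "norm (1 - a * a) \<le> 1"
    using norm_square_self_adjoint[OF l(1)] l(2) by simp
  define b where "b = sqrt_one_minus (1 - a * a)"
  have sb: "self_adjoint b" "norm (1 - b) \<le> 1" "b \<in> A"
    unfolding b_def using a saa
    by (intro self_adjoint_sqrt_one_minus n2 self_adjoint_diff norm_one_minus_sqrt
        sqrt_one_minus_mem[OF A] subalgebraD[OF A']; simp)+
  have bb: "b * b = a * a" unfolding b_def using sqrt_one_minus_square[OF n2] by simp
  have bc: "b * y = y * b" if "a * y = y * a" for y unfolding b_def
    by (rule sqrt_one_minus_commute[OF n2]) (use that in \<open>simp add: algebra_simps, metis mult.assoc\<close>)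
  define t where "t = sqrt_one_minus (1 - b)"
  have t: "self_adjoint t" "t \<in> A"
    unfolding t_def using sb
    by (intro self_adjoint_sqrt_one_minus self_adjoint_diff sqrt_one_minus_mem[OF A] subalgebraD[OF A']; simp)+
  have tt: "t * t = b" unfolding t_def using sqrt_one_minus_square[OF sb(2)] by simp
  have tc: "t * y = y * t" if "a * y = y * a" for y unfolding t_def
    by (rule sqrt_one_minus_commute[OF sb(2)]) (simp add: algebra_simps bc[OF that])
  show ?thesis by (rule that[of t, OF t(2,1) _ _ tc]) (simp_all add: tt bb sb)
qed

text \<open>\<open>m\<close> is twice the negative part of \<open>a\<close>.\<close>
lemma eq_abs_if_negative_part:
  assumes a: "self_adjoint a" and t: "self_adjoint t" "t * t * (t * t) = a * a" and ta: "t * a = a * t"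
    and m: "m = t * t - a" and nn: "0 \<le> Re (\<tau> (m * a * m))"
  shows "a = t * t"
proof -
  have tta: "t * t * a = a * (t * t)" using ta by (metis mult.assoc)
  \<comment> \<open>This is (|a| - a) (|a| + a) = 0.\<close>
  have mt: "m * (t * t) = - (m * a)"
    unfolding m using t(2) tta by (simp add: algebra_simps)
  have sm: "self_adjoint m" unfolding m
    using a t by (simp add: self_adjoint_diff self_adjoint_mult)
  have "adj (t * m) * (t * m) = m * (t * t) * m"
    using sm t by (simp add: adj_mult self_adjoint_def mult.assoc)
  also have "\<dots> = - (m * a * m)" by (simp add: mt)
  finally have "(norm2 (t * m))\<^sup>2 \<le> 0" using nn by (simp add: norm2_square tau_minus)
  then have "t * m = 0" by simp
  then have "t * t * m = 0" by (simp add: mult.assoc)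
  moreover have "m * (t * t) = t * t * m" unfolding m using tta by (simp add: algebra_simps)
  ultimately have "m * m = 0" using mt unfolding m by (simp add: algebra_simps)
  then have "m = 0" using norm_square_self_adjoint[OF sm] by simp
  then show ?thesis by (simp add: m)
qed

text \<open>Positivity is tested at the single vector m = |b| - b, which lies in A together with b.
  This is why test vectors from A are enough.\<close>

lemma positive_square_root:
  assumes A: "closed_star_subalgebra A" and a: "a \<in> A" and pos: "positive_on A a"
  obtains s where "s \<in> A" "self_adjoint s" "s * s = a" "\<And>y. a * y = y * a \<Longrightarrow> s * y = y * s"
proof (cases "a = 0")
  case True
  show ?thesis by (rule that[of 0]) (use True A in \<open>auto simp: closed_star_subalgebra_def subalgebra_zero\<close>)
next
  case False
  have A': "subalgebra A" using A by (simp add: closed_star_subalgebra_def)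
  define b where "b = (1 / norm a) *\<^sub>R a"
  have b: "b \<in> A" "positive_on A b" "self_adjoint b" "norm b \<le> 1" "a = norm a *\<^sub>R b"
    using a pos False positive_on_scaleR[OF pos, of "1 / norm a"]
    by (auto simp: b_def positive_on_def self_adjoint_scaleR intro!: subalgebraD[OF A'])
  obtain t where t: "t \<in> A" "self_adjoint t" "t * t * (t * t) = b * b"
    "\<And>y. b * y = y * b \<Longrightarrow> t * y = y * t"
    using abs_square_root[OF A b(1,3,4)] by metis
  define m where "m = t * t - b"
  have "m \<in> A" "adj m = m"
    using t(1-3) b by (auto simp: m_def adj_diff adj_mult self_adjoint_def intro!: subalgebraD[OF A'])
  then have nn: "0 \<le> Re (\<tau> (m * b * m))" using b(2) unfolding positive_on_def by metis
  have "t * b = b * t" by (rule t(4)) simp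
  then have bt: "b = t * t" by (rule eq_abs_if_negative_part[OF b(3) t(2,3) _ m_def nn])
  show ?thesis
  proof (rule that[of "sqrt (norm a) *\<^sub>R t"])
    show "sqrt (norm a) *\<^sub>R t * sqrt (norm a) *\<^sub>R t = a" using b(5) bt by simp
    show "sqrt (norm a) *\<^sub>R t * y = y * sqrt (norm a) *\<^sub>R t" if "a * y = y * a" for y
      using t(4)[of y] that by (simp add: b_def)
  qed (use t(1-3) in \<open>auto intro!: subalgebraD[OF A'] self_adjoint_scaleR\<close>)
qed

text \<open>With commuting roots l of c - a and k of c + a, the element k + i l is normal, k^2 + l^2
  is the scalar 2 c, and k^2 - l^2 = 2 a.\<close>

lemma norm_le_if_positive:
  assumes A: "closed_star_subalgebra A" and a: "a \<in> A" and c: "0 \<le> c"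
    and pos: "positive_on A (c *\<^sub>R 1 - a)" "positive_on A (c *\<^sub>R 1 + a)"
  shows "norm a \<le> c"
proof -
  have A': "subalgebra A" using A by (simp add: closed_star_subalgebra_def)
  have mem: "c *\<^sub>R 1 - a \<in> A" "c *\<^sub>R 1 + a \<in> A" using a by (auto intro!: subalgebraD[OF A'])
  obtain l where l: "self_adjoint l" "l * l = c *\<^sub>R 1 - a"
    and lc: "\<And>y. (c *\<^sub>R 1 - a) * y = y * (c *\<^sub>R 1 - a) \<Longrightarrow> l * y = y * l"
    using positive_square_root[OF A mem(1) pos(1)] by metis
  obtain k where k: "self_adjoint k" "k * k = c *\<^sub>R 1 + a"
    and kc: "\<And>y. (c *\<^sub>R 1 + a) * y = y * (c *\<^sub>R 1 + a) \<Longrightarrow> k * y = y * k"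
    using positive_square_root[OF A mem(2) pos(2)] by metis
  have "l * a = a * l" by (rule lc) (simp add: algebra_simps)
  then have "k * l = l * k" by (intro kc) (simp add: algebra_simps)
  then have "norm (k * k - l * l) \<le> 2 * c"
    using k l c by (intro norm_sum_squares(1)) (auto simp: scaleR_add_left[symmetric])
  moreover have "k * k - l * l = 2 *\<^sub>R a" using k l by (simp add: scaleR_2)
  ultimately show ?thesis by simp
qed

text \<open>A faithful representation of a C*-algebra is isometric, here for A acting on its own L^2
  space. The assumption says that c^2 - f* f is positive on A; c^2 + f* f always is, and the
  C*-identity concludes.\<close>

lemma norm_le_if_norm2_le:
  assumes A: "closed_star_subalgebra A" and f: "f \<in> A" and c: "0 \<le> c"
    and le: "\<And>y. y \<in> A \<Longrightarrow> norm2 (f * y) \<le> c * norm2 y"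
  shows "norm f \<le> c"
proof -
  have "norm (adj f * f) \<le> c\<^sup>2"
  proof (rule norm_le_if_positive[OF A])
    show "adj f * f \<in> A" using A f by (auto simp: closed_star_subalgebra_def intro: subalgebra_mult)
    have q: "Re (\<tau> (adj y * (adj f * f) * y)) = (norm2 (f * y))\<^sup>2" for y
      by (simp add: norm2_square adj_mult mult.assoc)
    have "Re (\<tau> (adj y * (c\<^sup>2 *\<^sub>R 1 - adj f * f) * y)) \<ge> 0" if "y \<in> A" for y
      using power_mono[OF le[OF that], of 2] q[of y]
      by (simp add: right_diff_distrib left_diff_distrib tau_simps norm2_square power_mult_distrib)
    then show "positive_on A (c\<^sup>2 *\<^sub>R 1 - adj f * f)"
      by (simp add: positive_on_def self_adjoint_diff self_adjoint_scaleR)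
    have "positive_on A (c\<^sup>2 *\<^sub>R 1)"
      using positive_on_scaleR[OF positive_on_adj_mult_self[of A 1], of "c\<^sup>2"] by simp
    then show "positive_on A (c\<^sup>2 *\<^sub>R 1 + adj f * f)"
      by (rule positive_on_add) (rule positive_on_adj_mult_self)
  qed simp
  then have "(norm f)\<^sup>2 \<le> c\<^sup>2" by (simp add: norm_adj_mult_self)
  then show ?thesis using c by (rule power2_le_imp_le)
qed

end

section \<open>Ultrafilter limits\<close>

text \<open>Maximality is encoded as deciding every predicate. Along such a filter all bounded
  scalar functions converge at once, which stands in for weak* compactness of balls.\<close>

definition ultrafilter :: "'i filter \<Rightarrow> bool" where
  "ultrafilter G \<longleftrightarrow> G \<noteq> bot \<and> (\<forall>Q. eventually Q G \<or> eventually (\<lambda>i. \<not> Q i) G)"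

lemma ultrafilter_exists:
  fixes F :: "'i filter"
  assumes "F \<noteq> bot"
  obtains G where "ultrafilter G" "G \<le> F"
proof -
  define A where "A = {G. G \<le> F \<and> G \<noteq> bot}"
  \<comment> \<open>The order is reversed: a maximal element for Zorn's lemma is a finest proper
    filter below F.\<close>
  let ?R = "\<lambda>G H :: 'i filter. H \<le> G"
  have "\<exists>m\<in>A. \<forall>a\<in>A. a \<le> m \<longrightarrow> a = m"
  proof (rule predicate_Zorn)
    show "partial_order_on A (relation_of ?R A)"
      by (rule partial_order_on_relation_ofI) auto
    fix C assume C: "C \<in> Chains (relation_of ?R A)"
    show "\<exists>u\<in>A. \<forall>a\<in>C. u \<le> a"
    proof (cases "C = {}")
      case True
      then show ?thesis using assms by (auto simp: A_def)
    next
      case False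
      have CA: "C \<subseteq> A" and ch: "\<And>G H. G \<in> C \<Longrightarrow> H \<in> C \<Longrightarrow> G \<le> H \<or> H \<le> G"
        using C by (auto simp: Chains_def relation_of_def)
      have ev: "eventually Q (Inf C) \<longleftrightarrow> (\<exists>b\<in>C. eventually Q b)" for Q
        by (rule eventually_Inf_base[OF False]) (use ch in \<open>metis inf.absorb1 inf.absorb2 order_refl\<close>)
      have "Inf C \<noteq> bot"
        unfolding trivial_limit_def ev using CA by (auto simp: A_def trivial_limit_def)
      moreover have "Inf C \<le> F" using False CA by (auto simp: A_def intro: Inf_lower2)
      ultimately show ?thesis by (intro bexI[of _ "Inf C"]) (auto simp: A_def intro: Inf_lower)
    qed
  qed
  then obtain G where G: "G \<le> F" "G \<noteq> bot" and max: "\<And>H. H \<le> G \<Longrightarrow> H \<noteq> bot \<Longrightarrow> H = G"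
    by (auto simp: A_def dest: order_trans)
  have "eventually Q G \<or> eventually (\<lambda>i. \<not> Q i) G" for Q
  proof (cases "inf G (principal {i. Q i}) = bot")
    case True
    then show ?thesis
      by (auto simp: trivial_limit_def eventually_inf_principal)
  next
    case False
    then have "inf G (principal {i. Q i}) = G" by (intro max) auto
    then have "G \<le> principal {i. Q i}" by (simp add: inf.absorb_iff1)
    then show ?thesis by (auto simp: le_principal)
  qed
  then show ?thesis using G that by (auto simp: ultrafilter_def)
qed

lemma ultrafilter_not_bot: "ultrafilter G \<Longrightarrow> G \<noteq> bot"
  by (simp add: ultrafilter_def)

text \<open>Compactness of the ball provides a cluster point. An ultrafilter decides each
  neighbourhood of it, and cannot decide against one.\<close>

lemma ultrafilter_bounded_convergent:
  fixes f :: "'i \<Rightarrow> 'b::heine_borel"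
  assumes G: "ultrafilter G" and K: "eventually (\<lambda>i. f i \<in> cball a K) G"
  shows "\<exists>l. (f \<longlongrightarrow> l) G"
proof -
  have "filtermap f G \<noteq> bot" using G by (simp add: ultrafilter_def filtermap_bot_iff)
  moreover have "eventually (\<lambda>x. x \<in> cball a K) (filtermap f G)"
    using K by (simp add: eventually_filtermap)
  ultimately obtain l where l: "inf (nhds l) (filtermap f G) \<noteq> bot"
    using compact_cball[of a K] unfolding compact_filter by blast
  have "(f \<longlongrightarrow> l) G"
  proof (rule topological_tendstoI, rule ccontr)
    fix S assume S: "open S" "l \<in> S" and "\<not> eventually (\<lambda>i. f i \<in> S) G"
    then have "eventually (\<lambda>i. f i \<notin> S) G" using G by (auto simp: ultrafilter_def)
    then have "eventually (\<lambda>x. x \<notin> S) (filtermap f G)" by (simp add: eventually_filtermap)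
    moreover have "eventually (\<lambda>x. x \<in> S) (nhds l)" using S by (auto simp: eventually_nhds)
    ultimately have "eventually (\<lambda>x. False) (inf (nhds l) (filtermap f G))"
      unfolding eventually_inf by blast
    then show False using l by (simp add: trivial_limit_def)
  qed
  then show ?thesis by blast
qed

section \<open>Preduals\<close>

locale predual =
  fixes P :: "('a::cstar_algebra \<Rightarrow>\<^sub>L complex) set"
  assumes P: "wstar_predual P"
begin

lemma P_zero: "0 \<in> P"
  and P_add: "\<phi> \<in> P \<Longrightarrow> \<psi> \<in> P \<Longrightarrow> \<phi> + \<psi> \<in> P"
  and P_mult: "\<phi> \<in> P \<Longrightarrow> blinfun_mult_right c o\<^sub>L \<phi> \<in> P"
  and P_closed: "closed P"
  and P_clinear: "\<phi> \<in> P \<Longrightarrow> clinear_functional (blinfun_apply \<phi>)"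
  and P_norm: "norm x = (SUP \<phi>\<in>{\<phi>\<in>P. norm \<phi> \<le> 1}. cmod (blinfun_apply \<phi> x))"
  using P unfolding wstar_predual_def by blast+

lemma P_scaleR:
  assumes "\<phi> \<in> P" shows "r *\<^sub>R \<phi> \<in> P"
proof -
  have "blinfun_mult_right (of_real r) o\<^sub>L \<phi> = r *\<^sub>R \<phi>"
    by (rule blinfun_eqI) (simp add: scaleR_conv_of_real blinfun.scaleR_left)
  then show ?thesis using P_mult[OF assms, of "of_real r"] by simp
qed

lemma P_sum: "(\<And>i. i \<in> I \<Longrightarrow> f i \<in> P) \<Longrightarrow> sum f I \<in> P"
  by (induction I rule: infinite_finite_induct) (auto intro: P_zero P_add)

lemma P_representation:
  assumes "\<And>\<phi> \<psi>. \<phi> \<in> P \<Longrightarrow> \<psi> \<in> P \<Longrightarrow> \<Lambda> (\<phi> + \<psi>) = \<Lambda> \<phi> + \<Lambda> \<psi>"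
    and "\<And>c \<phi>. \<phi> \<in> P \<Longrightarrow> \<Lambda> (blinfun_mult_right c o\<^sub>L \<phi>) = c * \<Lambda> \<phi>"
    and "\<And>\<phi>. \<phi> \<in> P \<Longrightarrow> cmod (\<Lambda> \<phi>) \<le> K * norm \<phi>"
  obtains x where "\<And>\<phi>. \<phi> \<in> P \<Longrightarrow> \<Lambda> \<phi> = blinfun_apply \<phi> x"
proof -
  have "(\<forall>\<phi>\<in>P. \<forall>\<psi>\<in>P. \<Lambda> (\<phi> + \<psi>) = \<Lambda> \<phi> + \<Lambda> \<psi>) \<longrightarrow>
        (\<forall>c. \<forall>\<phi>\<in>P. \<Lambda> (blinfun_mult_right c o\<^sub>L \<phi>) = c * \<Lambda> \<phi>) \<longrightarrow>
        (\<exists>K. \<forall>\<phi>\<in>P. cmod (\<Lambda> \<phi>) \<le> K * norm \<phi>) \<longrightarrow>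
        (\<exists>x. \<forall>\<phi>\<in>P. \<Lambda> \<phi> = blinfun_apply \<phi> x)"
    using P unfolding wstar_predual_def by blast
  then have "\<exists>x. \<forall>\<phi>\<in>P. \<Lambda> \<phi> = blinfun_apply \<phi> x" using assms by blast
  then show ?thesis using that by blast
qed

text \<open>The pointwise limits form a bounded complex linear functional on P, and the algebra is
  the dual of P.\<close>

lemma weak_star_ultralimit:
  assumes G: "ultrafilter G" and bd: "eventually (\<lambda>i. norm (x i) \<le> R) G"
  obtains x0 where "\<And>\<phi>. \<phi> \<in> P \<Longrightarrow> ((\<lambda>i. blinfun_apply \<phi> (x i)) \<longlongrightarrow> blinfun_apply \<phi> x0) G"
proof -
  have bd': "eventually (\<lambda>i. cmod (blinfun_apply \<phi> (x i)) \<le> R * norm \<phi>) G" for \<phi> :: "'a \<Rightarrow>\<^sub>L complex"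
    using bd
  proof eventually_elim
    case (elim i)
    have "cmod (blinfun_apply \<phi> (x i)) \<le> norm \<phi> * norm (x i)" by (rule norm_blinfun)
    also have "\<dots> \<le> norm \<phi> * R" using elim by (rule mult_left_mono) simp
    finally show ?case by (simp add: mult.commute)
  qed
  have "\<exists>l. ((\<lambda>i. blinfun_apply \<phi> (x i)) \<longlongrightarrow> l) G" for \<phi> :: "'a \<Rightarrow>\<^sub>L complex"
    by (rule ultrafilter_bounded_convergent[OF G, of _ 0 "R * norm \<phi>"]) (use bd'[of \<phi>] in simp)
  then obtain \<Lambda> where \<Lambda>: "\<And>\<phi> :: 'a \<Rightarrow>\<^sub>L complex. ((\<lambda>i. blinfun_apply \<phi> (x i)) \<longlongrightarrow> \<Lambda> \<phi>) G" by metis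
  have nb: "G \<noteq> bot" using G by (rule ultrafilter_not_bot)
  obtain x0 where "\<And>\<phi>. \<phi> \<in> P \<Longrightarrow> \<Lambda> \<phi> = blinfun_apply \<phi> x0"
  proof (rule P_representation[of \<Lambda> R])
    show "\<Lambda> (\<phi> + \<psi>) = \<Lambda> \<phi> + \<Lambda> \<psi>" for \<phi> \<psi>
      using tendsto_unique[OF nb \<Lambda>[of "\<phi> + \<psi>"]] tendsto_add[OF \<Lambda>[of \<phi>] \<Lambda>[of \<psi>]]
      by (simp add: blinfun.add_left)
    show "\<Lambda> (blinfun_mult_right c o\<^sub>L \<phi>) = c * \<Lambda> \<phi>" for c \<phi>
      using tendsto_unique[OF nb \<Lambda>[of "blinfun_mult_right c o\<^sub>L \<phi>"]] tendsto_mult_left[OF \<Lambda>[of \<phi>], of c]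
      by simp
    show "cmod (\<Lambda> \<phi>) \<le> R * norm \<phi>" for \<phi>
      by (rule tendsto_upperbound[OF tendsto_norm[OF \<Lambda>] bd' nb])
  qed blast
  with \<Lambda> that show ?thesis by metis
qed

text \<open>The norm is a supremum over the unit ball of P, hence lower semicontinuous. The summand
  m stays fixed along the filter; in the applications it is a multiple of a projection or a fixed
  power of an element with a shift.\<close>

lemma norm_weak_star_limit_le:
  assumes G: "G \<noteq> bot" and lim: "\<And>\<phi>. \<phi> \<in> P \<Longrightarrow> ((\<lambda>i. blinfun_apply \<phi> (x i)) \<longlongrightarrow> blinfun_apply \<phi> x0) G"
    and K: "eventually (\<lambda>i. norm (x i + m) \<le> K) G"
  shows "norm (x0 + m) \<le> K"
  unfolding P_norm[of "x0 + m"]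
proof (rule cSUP_least)
  show "{\<phi> \<in> P. norm \<phi> \<le> 1} \<noteq> {}" using P_zero by force
  fix \<phi> assume "\<phi> \<in> {\<phi> \<in> P. norm \<phi> \<le> 1}"
  then have \<phi>: "\<phi> \<in> P" "norm \<phi> \<le> 1" by auto
  have "((\<lambda>i. blinfun_apply \<phi> (x i + m)) \<longlongrightarrow> blinfun_apply \<phi> (x0 + m)) G"
    unfolding blinfun.add_right by (intro tendsto_add lim \<phi> tendsto_const)
  then have "((\<lambda>i. cmod (blinfun_apply \<phi> (x i + m))) \<longlongrightarrow> cmod (blinfun_apply \<phi> (x0 + m))) G"
    by (rule tendsto_norm)
  moreover have "eventually (\<lambda>i. cmod (blinfun_apply \<phi> (x i + m)) \<le> K) G"
    using K
  proof eventually_elim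
    case (elim i)
    have "cmod (blinfun_apply \<phi> (x i + m)) \<le> norm \<phi> * norm (x i + m)" by (rule norm_blinfun)
    also have "\<dots> \<le> norm (x i + m)" using \<phi>(2) by (simp add: mult_left_le_one_le)
    finally show ?case using elim by simp
  qed
  ultimately show "cmod (blinfun_apply \<phi> (x0 + m)) \<le> K" by (rule tendsto_upperbound[OF _ _ G])
qed

end

text \<open>One step of the Hahn--Banach extension, for the seminorm \<open>c * norm\<close>.\<close>
lemma dominated_modulo_functional:
  fixes f q :: "'a::real_normed_vector \<Rightarrow> real"
  assumes Y: "subspace Y" and f: "linear f" and q: "linear q" and c: "0 \<le> c"
    and le: "\<And>x. x \<in> Y \<Longrightarrow> q x = 0 \<Longrightarrow> f x \<le> c * norm x"
  shows "\<exists>a. \<forall>x\<in>Y. f x - a * q x \<le> c * norm x"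
proof (cases "\<forall>x\<in>Y. q x = 0")
  case True
  then show ?thesis using le by (intro exI[of _ 0]) auto
next
  case False
  then obtain z where z: "z \<in> Y" "q z \<noteq> 0" by blast
  define S where "S = {x \<in> Y. q x = 1}"
  have "(1 / q z) *\<^sub>R z \<in> S"
    using z Y by (simp add: S_def linear_scale[OF q] subspace_scale)
  then obtain z' where z': "z' \<in> S" by blast
  then have ne: "S \<noteq> {}" by blast
  have le2: "f x - c * norm x \<le> f y + c * norm y" if "x \<in> S" "y \<in> S" for x y
  proof -
    have "f (x - y) \<le> c * norm (x - y)"
      using that Y by (intro le) (auto simp: S_def linear_diff[OF q] subspace_diff)
    also have "\<dots> \<le> c * (norm x + norm y)" using c by (intro mult_left_mono norm_triangle_ineq4)
    finally show ?thesis by (simp add: linear_diff[OF f] algebra_simps)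
  qed
  \<comment> \<open>For x with q x = 1 the requirements at x and at - x read f x - c |x| \<le> a
    \<le> f x + c |x|; so any number between the supremum of the left sides and the infimum of the
    right sides will do.\<close>
  define a where "a = (SUP x\<in>S. f x - c * norm x)"
  have up: "f x - c * norm x \<le> a" if "x \<in> S" for x
    unfolding a_def using le2[OF _ z'] that
    by (intro cSUP_upper bdd_aboveI2[where M = "f z' + c * norm z'"])
  have lo: "a \<le> f x + c * norm x" if "x \<in> S" for x
    unfolding a_def using ne le2 that by (intro cSUP_least) auto
  have "f x - a * q x \<le> c * norm x" if x: "x \<in> Y" for x
  proof (cases "q x = 0")
    case False
    define y where "y = (1 / q x) *\<^sub>R x"
    have y: "y \<in> S" "f y = f x / q x" "norm y = norm x / \<bar>q x\<bar>"
      using x Y False by (auto simp: S_def y_def linear_scale[OF q] linear_scale[OF f] subspace_scale)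
    show ?thesis
    proof (cases "q x > 0")
      case True
      then have "f x / q x - c * (norm x / q x) \<le> a" using up[OF y(1)] y by simp
      then show ?thesis using True by (simp add: field_simps)
    next
      case neg: False
      then have "a \<le> f x / q x - c * (norm x / q x)" using lo[OF y(1)] y by simp
      then show ?thesis using neg False by (simp add: field_simps)
    qed
  qed (use le x in auto)
  then show ?thesis by blast
qed

text \<open>The functionals are eliminated one at a time: on the common kernel of the others,
  correcting f by a multiple of \<open>q j\<close> restores the hypothesis for the smaller index
  set.\<close>

lemma dominated_modulo_functionals:
  fixes f :: "'a::real_normed_vector \<Rightarrow> real" and q :: "'i \<Rightarrow> 'a \<Rightarrow> real"
  assumes "finite J" and f: "linear f" and q: "\<And>i. linear (q i)" and c: "0 \<le> c"
    and le: "\<And>x. (\<And>i. i \<in> J \<Longrightarrow> q i x = 0) \<Longrightarrow> f x \<le> c * norm x"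
  shows "\<exists>a. \<forall>x. f x - (\<Sum>i\<in>J. a i * q i x) \<le> c * norm x"
  using \<open>finite J\<close> f le
proof (induction J arbitrary: f rule: finite_induct)
  case empty
  then show ?case by simp
next
  case (insert j J)
  have "subspace {x. \<forall>i\<in>J. q i x = 0}"
    by (rule subspaceI) (auto simp: linear_0[OF q] linear_add[OF q] linear_scale[OF q])
  then have "\<exists>b. \<forall>x\<in>{x. \<forall>i\<in>J. q i x = 0}. f x - b * q j x \<le> c * norm x"
    by (rule dominated_modulo_functional[OF _ insert.prems(1) q c]) (auto intro: insert.prems(2))
  then obtain b where b: "\<And>x. (\<And>i. i \<in> J \<Longrightarrow> q i x = 0) \<Longrightarrow> f x - b * q j x \<le> c * norm x"
    by blast
  have "linear (\<lambda>x. f x - b * q j x)"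
    using insert.prems(1) q[of j]
    by (intro linearI) (simp_all add: linear_add linear_scale algebra_simps)
  from insert.IH[OF this b] obtain a where
    a: "\<And>x. f x - b * q j x - (\<Sum>i\<in>J. a i * q i x) \<le> c * norm x" by blast
  have "f x - (\<Sum>i\<in>insert j J. (a(j := b)) i * q i x) \<le> c * norm x" for x
  proof -
    have "(\<Sum>i\<in>J. (a(j := b)) i * q i x) = (\<Sum>i\<in>J. a i * q i x)"
      using insert.hyps by (intro sum.cong) auto
    then show ?thesis using a[of x] insert.hyps by simp
  qed
  then show ?case by blast
qed

context predual
begin

text \<open>A quantitative form of the fact that a functional vanishing on the common kernel of
  finitely many others lies in their span. Hahn-Banach is applied to real parts; a rotation by a
  phase then recovers the modulus.\<close>

lemma near_predual_if_dominated_on_kernel: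
  assumes \<phi>: "clinear_functional (blinfun_apply \<phi>)" and J: "finite J" "J \<subseteq> P" and c: "0 \<le> c"
    and le: "\<And>x. (\<And>\<psi>. \<psi> \<in> J \<Longrightarrow> blinfun_apply \<psi> x = 0) \<Longrightarrow> cmod (blinfun_apply \<phi> x) \<le> c * norm x"
  shows "\<exists>\<psi>\<in>P. norm (\<phi> - \<psi>) \<le> c"
proof -
  \<comment> \<open>The real part of - i \<psi> is the imaginary part of \<psi>, so vanishing of the
    real parts over K means vanishing of all \<psi> in J.\<close>
  let ?m = "\<lambda>\<psi> :: 'a \<Rightarrow>\<^sub>L complex. blinfun_mult_right (-\<i>) o\<^sub>L \<psi>"
  define K where "K = J \<union> ?m ` J"
  have K: "finite K" "K \<subseteq> P" using J P_mult by (auto simp: K_def)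
  have lin: "linear (\<lambda>x. Re (blinfun_apply \<psi> x))" for \<psi> :: "'a \<Rightarrow>\<^sub>L complex"
    by (rule linearI) (simp_all add: blinfun.add_right blinfun.scaleR_right)
  have "\<exists>a. \<forall>x. Re (blinfun_apply \<phi> x) - (\<Sum>\<psi>\<in>K. a \<psi> * Re (blinfun_apply \<psi> x)) \<le> c * norm x"
  proof (rule dominated_modulo_functionals[OF K(1) lin lin c])
    fix x assume x: "\<And>\<psi>. \<psi> \<in> K \<Longrightarrow> Re (blinfun_apply \<psi> x) = 0"
    have "blinfun_apply \<psi> x = 0" if "\<psi> \<in> J" for \<psi>
      using x[of \<psi>] x[of "?m \<psi>"] that by (auto simp: K_def complex_eq_iff)
    then have "cmod (blinfun_apply \<phi> x) \<le> c * norm x" by (rule le)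
    then show "Re (blinfun_apply \<phi> x) \<le> c * norm x" using complex_Re_le_cmod order_trans by blast
  qed
  then obtain a where a: "\<And>x. Re (blinfun_apply \<phi> x) - (\<Sum>\<psi>\<in>K. a \<psi> * Re (blinfun_apply \<psi> x)) \<le> c * norm x"
    by blast
  define \<eta> where "\<eta> = (\<Sum>\<psi>\<in>K. a \<psi> *\<^sub>R \<psi>)"
  have \<eta>: "\<eta> \<in> P" unfolding \<eta>_def using K by (intro P_sum P_scaleR) auto
  have \<eta>x: "Re (blinfun_apply \<eta> x) = (\<Sum>\<psi>\<in>K. a \<psi> * Re (blinfun_apply \<psi> x))" for x
    by (simp add: \<eta>_def blinfun.sum_left blinfun.scaleR_left)
  have re: "Re (blinfun_apply (\<phi> - \<eta>) x) \<le> c * norm x" for x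
    using a[of x] \<eta>x[of x] by (simp add: blinfun.diff_left)
  have cl: "blinfun_apply (\<phi> - \<eta>) (d *\<^sub>C x) = d * blinfun_apply (\<phi> - \<eta>) x" for d x
    using \<phi> P_clinear[OF \<eta>] by (simp add: clinear_functional_def blinfun.diff_left algebra_simps)
  have "norm (\<phi> - \<eta>) \<le> c"
  proof (rule norm_blinfun_bound[OF c])
    fix x
    define z where "z = blinfun_apply (\<phi> - \<eta>) x"
    show "cmod (blinfun_apply (\<phi> - \<eta>) x) \<le> c * norm x"
    proof (cases "z = 0")
      case False
      define d where "d = cnj z / cmod z"
      have "d * z = cmod z" using False
        by (simp add: d_def field_simps complex_norm_square[symmetric] power2_eq_square[symmetric])
      moreover have "cmod d = 1" using False by (simp add: d_def norm_divide)
      ultimately show ?thesis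
        using re[of "d *\<^sub>C x"] by (simp add: cl z_def[symmetric] norm_scaleC)
    qed (use c in \<open>simp add: z_def\<close>)
  qed
  then show ?thesis using \<eta> by blast
qed

text \<open>The Krein--Smulian theorem for functionals.\<close>
lemma mem_predual_if_continuous_on_ball:
  assumes \<phi>: "clinear_functional (blinfun_apply \<phi>)"
    and lim: "\<And>G. ultrafilter G \<Longrightarrow> eventually (\<lambda>x. norm x \<le> 1) G \<Longrightarrow>
      (\<And>\<psi>. \<psi> \<in> P \<Longrightarrow> (blinfun_apply \<psi> \<longlongrightarrow> 0) G) \<Longrightarrow> (blinfun_apply \<phi> \<longlongrightarrow> 0) G"
  shows "\<phi> \<in> P"
proof -
  have "\<exists>\<psi>\<in>P. dist \<psi> \<phi> < \<epsilon>" if \<epsilon>: "\<epsilon> > 0" for \<epsilon>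
  proof -
    define B where "B = {x. norm x \<le> 1 \<and> cmod (blinfun_apply \<phi> x) > \<epsilon> / 2}"
    define Z where "Z = (\<lambda>\<psi> :: 'a \<Rightarrow>\<^sub>L complex. {x. blinfun_apply \<psi> x = 0})"
    \<comment> \<open>Otherwise the kernels of the elements of P and B generate a proper filter. An
      ultrafilter finer than it sends every \<psi> in P to 0, but keeps \<phi> away from 0, contrary
      to \<open>lim\<close>.\<close>
    have "\<exists>J\<subseteq>P. finite J \<and> (\<Inter>\<psi>\<in>J. Z \<psi>) \<inter> B = {}"
    proof (rule ccontr)
      assume *: "\<not> ?thesis"
      define F where "F = inf (INF \<psi>\<in>P. principal (Z \<psi>)) (principal B)"
      have "F \<noteq> bot"
      proof
        assume "F = bot"
        then have "eventually (\<lambda>x. x \<notin> B) (INF \<psi>\<in>P. principal (Z \<psi>))"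
          by (simp add: F_def trivial_limit_def eventually_inf_principal)
        from eventually_INF[THEN iffD1, OF this] obtain J where J: "J \<subseteq> P" "finite J" "eventually (\<lambda>x. x \<notin> B) (INF \<psi>\<in>J. principal (Z \<psi>))"
          by blast
        then have "eventually (\<lambda>x. x \<notin> B) (principal (\<Inter>\<psi>\<in>J. Z \<psi>))"
          using INF_principal_finite[of J Z] by simp
        then show False using * J unfolding eventually_principal by blast
      qed
      then obtain G where G: "ultrafilter G" "G \<le> F" by (rule ultrafilter_exists)
      have "eventually (\<lambda>x. x \<in> B) F" by (simp add: F_def eventually_inf_principal)
      then have evB: "eventually (\<lambda>x. x \<in> B) G" using G(2) by (rule filter_leD[rotated])
      have "(blinfun_apply \<phi> \<longlongrightarrow> 0) G"
      proof (rule lim[OF G(1)])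
        show "eventually (\<lambda>x. norm x \<le> 1) G" using evB by eventually_elim (simp add: B_def)
        fix \<psi> assume "\<psi> \<in> P"
        then have "F \<le> principal (Z \<psi>)" unfolding F_def by (meson INF_lower inf.coboundedI1)
        then have "G \<le> principal (Z \<psi>)" using G(2) by (rule order_trans[rotated])
        then have "eventually (\<lambda>x. x \<in> Z \<psi>) G" by (simp add: le_principal)
        then show "(blinfun_apply \<psi> \<longlongrightarrow> 0) G"
          by (intro tendsto_eventually) (simp add: Z_def)
      qed
      then have "eventually (\<lambda>x. cmod (blinfun_apply \<phi> x) < \<epsilon> / 2) G"
        using \<epsilon> by (auto dest!: tendstoD[of _ _ _ "\<epsilon> / 2"] simp: dist_norm)
      with evB have "eventually (\<lambda>x. False) G" by eventually_elim (simp add: B_def)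
      then show False using ultrafilter_not_bot[OF G(1)] by simp
    qed
    then obtain J where J: "J \<subseteq> P" "finite J" and sub: "(\<Inter>\<psi>\<in>J. Z \<psi>) \<inter> B = {}" by blast
    have "cmod (blinfun_apply \<phi> x) \<le> \<epsilon> / 2 * norm x" if x: "\<And>\<psi>. \<psi> \<in> J \<Longrightarrow> blinfun_apply \<psi> x = 0" for x
    proof (cases "x = 0")
      case False
      define y where "y = (1 / norm x) *\<^sub>R x"
      have "y \<in> (\<Inter>\<psi>\<in>J. Z \<psi>)" using x by (auto simp: Z_def y_def blinfun.scaleR_right)
      then have "y \<notin> B" using sub by blast
      moreover have "norm y \<le> 1" using False by (simp add: y_def)
      ultimately have "cmod (blinfun_apply \<phi> y) \<le> \<epsilon> / 2" by (simp add: B_def)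
      then show ?thesis using False by (simp add: y_def blinfun.scaleR_right field_simps)
    qed simp
    then obtain \<psi> where "\<psi> \<in> P" "norm (\<phi> - \<psi>) \<le> \<epsilon> / 2"
      using near_predual_if_dominated_on_kernel[OF \<phi> J(2,1), of "\<epsilon> / 2"] \<epsilon> by auto
    then show ?thesis using \<epsilon> by (intro bexI[of _ \<psi>]) (auto simp: dist_norm norm_minus_commute)
  qed
  then show ?thesis by (subst closed_approachable[OF P_closed, symmetric]) blast
qed

end

section \<open>Normality of the functionals \<open>x \<mapsto> \<tau>(y x)\<close>\<close>

text \<open>For \<mu> of modulus s in the direction of z the left side is |z| + s t, while the right
  side exceeds s t by at most t C / (2 s), which tends to 0 as s grows. In this way a family of norm
  inequalities yields an exact equation.\<close>

lemma eq_0_if_disc_bound: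
  fixes z :: complex
  assumes t: "0 \<le> t" and C: "0 \<le> C"
    and le: "\<And>\<mu>. 1 \<le> cmod \<mu> \<Longrightarrow> cmod (z + \<mu> * of_real t) \<le> t * sqrt ((cmod \<mu>)\<^sup>2 + C)"
  shows "z = 0"
proof (rule ccontr)
  assume z: "z \<noteq> 0"
  \<comment> \<open>Large enough for t C / (2 s) to be at most half of |z|, and admissible for the
    bound, which is assumed for modulus at least 1 only.\<close>
  define s where "s = max 1 (t * C / cmod z)"
  have s: "1 \<le> s" "t * C \<le> s * cmod z" using z by (auto simp: s_def field_simps max_def)
  define \<mu> where "\<mu> = of_real (s / cmod z) * z"
  have c\<mu>: "cmod \<mu> = s" using s z by (simp add: \<mu>_def norm_mult norm_divide)
  have "z + \<mu> * of_real t = of_real (1 + s * t / cmod z) * z"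
    by (simp add: \<mu>_def algebra_simps)
  then have "cmod (z + \<mu> * of_real t) = (1 + s * t / cmod z) * cmod z"
    using s t by (simp only: norm_mult norm_of_real) simp
  also have "\<dots> = cmod z + s * t" using z by (simp add: field_simps)
  finally have 1: "cmod z + s * t \<le> t * sqrt (s\<^sup>2 + C)"
    using le[of \<mu>] s by (simp add: c\<mu>)
  have "sqrt (s\<^sup>2 + C) \<le> s + C / (2 * s)"
  proof (rule real_le_lsqrt)
    show "0 \<le> s + C / (2 * s)" using s C by simp
    have "(s + C / (2 * s))\<^sup>2 = s\<^sup>2 + C + (C / (2 * s))\<^sup>2" using s by (simp add: power2_sum)
    then show "s\<^sup>2 + C \<le> (s + C / (2 * s))\<^sup>2" by simp
  qed
  then have "t * sqrt (s\<^sup>2 + C) \<le> t * (s + C / (2 * s))" using t by (rule mult_left_mono)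
  with 1 have "cmod z \<le> t * C / (2 * s)" by (simp add: algebra_simps)
  then have "2 * (s * cmod z) \<le> t * C" using s by (simp add: field_simps)
  moreover have "0 < s * cmod z" using s z by simp
  ultimately show False using s(2) by linarith
qed

context trace_state
begin

text \<open>The trace allows a second factor e to be placed on the right, so both Cauchy-Schwarz
  factors are small. For a projection \<open>(norm2 e)\<^sup>2\<close> is \<tau>(e), the very factor
  that accompanies \<mu> in the disc bounds.\<close>

lemma tau_projection_le:
  assumes "e * e = e"
  shows "cmod (\<tau> (e * w)) \<le> (norm2 e)\<^sup>2 * norm w"
proof -
  have "\<tau> (e * w) = \<tau> (e * (w * e))"
    using assms tau_commute[of "e * w" e] by (simp add: mult.assoc[symmetric])
  also have "cmod \<dots> \<le> norm2 e * norm2 (w * e)" by (rule tau_mult_le)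
  also have "\<dots> \<le> norm2 e * (norm w * norm2 e)" by (intro mult_left_mono norm2_mult_left) simp
  finally show ?thesis by (simp add: power2_eq_square algebra_simps)
qed

lemma norm_projection_le_1:
  assumes "self_adjoint e" "e * e = e" shows "norm e \<le> 1"
proof -
  have "norm e * norm e = norm e * 1"
    using norm_square_self_adjoint[OF assms(1)] assms(2) by (simp add: power2_eq_square)
  then have "norm e = 0 \<or> norm e = 1" by (simp only: mult_cancel_left)
  then show ?thesis by auto
qed

section \<open>Peirce components for a projection e and its complement f\<close>

context
  fixes e f :: 'a
  assumes e: "self_adjoint e" "e * e = e" and f: "f = 1 - e"
begin

lemma complement_projection: "self_adjoint f" "f * f = f" "e * f = 0" "f * e = 0"
  using e by (auto simp: f self_adjoint_diff algebra_simps)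

lemma tau_projections_orthogonal: "\<tau> (adj (e * u) * (f * v)) = 0"
proof -
  have "adj (e * u) * (f * v) = adj u * (e * f) * v"
    using e(1) by (simp add: adj_mult self_adjoint_def mult.assoc)
  then show ?thesis by (simp add: complement_projection)
qed

lemma norm2_projections: "(norm2 (e * u + f * v))\<^sup>2 = (norm2 (e * u))\<^sup>2 + (norm2 (f * v))\<^sup>2"
  by (rule norm2_pythagoras) (rule tau_projections_orthogonal)

lemma norm2_split: "(norm2 y)\<^sup>2 = (norm2 (e * y))\<^sup>2 + (norm2 (f * y))\<^sup>2"
proof -
  have "y = e * y + f * y" by (simp add: f algebra_simps)
  then show ?thesis using norm2_projections[of y y] by simp
qed

lemma norm2_e_le: "norm2 (e * y) \<le> norm2 y"
  and norm2_f_le: "norm2 (f * y) \<le> norm2 y"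
  by (rule power2_le_imp_le; simp add: norm2_split[of y])+

text \<open>The element is block diagonal with blocks e x e and \<mu>, both bounded by |\<mu>|.
  Conversely, the inequality for all such \<mu> leaves no room for an f-block of nonzero
  trace.\<close>

lemma norm_compression_add_complement:
  assumes x: "norm x \<le> 1" and \<mu>: "1 \<le> cmod \<mu>"
  shows "norm (e * x * e + \<mu> *\<^sub>C f) \<le> cmod \<mu>"
proof (rule norm_le_if_norm2_le[OF closed_star_subalgebra_UNIV])
  fix y
  have eq: "(e * x * e + \<mu> *\<^sub>C f) * y = e * (x * (e * y)) + f * (\<mu> *\<^sub>C y)"
    by (simp add: algebra_simps mult_scaleC_left mult_scaleC_right)
  have "norm2 (e * (x * (e * y))) \<le> norm x * norm2 (e * y)"
    using norm2_e_le norm2_mult_left order_trans by blast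
  also have "\<dots> \<le> cmod \<mu> * norm2 (e * y)" using x \<mu> by (intro mult_right_mono) auto
  finally have 1: "(norm2 (e * (x * (e * y))))\<^sup>2 \<le> (cmod \<mu>)\<^sup>2 * (norm2 (e * y))\<^sup>2"
    using power_mono[of _ _ 2] by (fastforce simp: power_mult_distrib)
  have 2: "(norm2 (f * (\<mu> *\<^sub>C y)))\<^sup>2 = (cmod \<mu>)\<^sup>2 * (norm2 (f * y))\<^sup>2"
    by (simp add: mult_scaleC_right norm2_scaleC power_mult_distrib)
  have "(norm2 ((e * x * e + \<mu> *\<^sub>C f) * y))\<^sup>2 \<le> (cmod \<mu> * norm2 y)\<^sup>2"
    unfolding eq norm2_projections using 1 2 norm2_split[of y]
    by (simp add: power_mult_distrib algebra_simps)
  then show "norm2 ((e * x * e + \<mu> *\<^sub>C f) * y) \<le> cmod \<mu> * norm2 y"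
    by (rule power2_le_imp_le) simp
qed auto

text \<open>The (e, e) block of x - e x e vanishes. With \<mu> e added, the first row is (\<mu>, e x
  f), of norm at most sqrt(|\<mu>|^2 + 1), and the second row is a contraction; hence the 2. The
  excess over |\<mu>| is of order 1/|\<mu>|, which rules out an (e, e) block of nonzero trace in a
  limit.\<close>

lemma norm_defect_add_projection:
  assumes x: "norm x \<le> 1"
  shows "norm (x - e * x * e + \<mu> *\<^sub>C e) \<le> sqrt ((cmod \<mu>)\<^sup>2 + 2)"
proof (rule norm_le_if_norm2_le[OF closed_star_subalgebra_UNIV])
  fix y
  define \<alpha> where "\<alpha> = norm2 (e * y)"
  define \<beta> where "\<beta> = norm2 (f * y)"
  have y: "(norm2 y)\<^sup>2 = \<alpha>\<^sup>2 + \<beta>\<^sup>2" unfolding \<alpha>_def \<beta>_def by (rule norm2_split)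
  have eq: "(x - e * x * e + \<mu> *\<^sub>C e) * y = e * (\<mu> *\<^sub>C y + x * (f * y)) + f * (x * y)"
    by (simp add: f algebra_simps mult_scaleC_left mult_scaleC_right)
  have "norm2 (e * (\<mu> *\<^sub>C y + x * (f * y))) \<le> norm2 (e * (\<mu> *\<^sub>C y)) + norm2 (e * (x * (f * y)))"
    using norm2_triangle by (simp add: distrib_left)
  also have "norm2 (e * (\<mu> *\<^sub>C y)) = cmod \<mu> * \<alpha>" by (simp add: mult_scaleC_right norm2_scaleC \<alpha>_def)
  also have "norm2 (e * (x * (f * y))) \<le> norm x * \<beta>"
    unfolding \<beta>_def using norm2_e_le norm2_mult_left order_trans by blast
  also have "norm x * \<beta> \<le> 1 * \<beta>" using x by (intro mult_right_mono) (auto simp: \<beta>_def)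
  finally have "(norm2 (e * (\<mu> *\<^sub>C y + x * (f * y))))\<^sup>2 \<le> (cmod \<mu> * \<alpha> + \<beta>)\<^sup>2"
    by (intro power_mono) auto
  moreover have "norm2 (f * (x * y)) \<le> norm2 y"
    using norm2_f_le[of "x * y"] norm2_mult_left[of x y] mult_right_mono[OF x, of "norm2 y"] by simp
  then have "(norm2 (f * (x * y)))\<^sup>2 \<le> (norm2 y)\<^sup>2" by (intro power_mono) auto
  moreover have "(cmod \<mu> * \<alpha> + \<beta>)\<^sup>2 \<le> ((cmod \<mu>)\<^sup>2 + 1) * (\<alpha>\<^sup>2 + \<beta>\<^sup>2)"
    using zero_le_power2[of "cmod \<mu> * \<beta> - \<alpha>"] by (simp add: power2_eq_square algebra_simps)
  ultimately have "(norm2 ((x - e * x * e + \<mu> *\<^sub>C e) * y))\<^sup>2 \<le> (sqrt ((cmod \<mu>)\<^sup>2 + 2) * norm2 y)\<^sup>2"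
    unfolding eq norm2_projections by (simp add: power_mult_distrib y algebra_simps)
  then show "norm2 ((x - e * x * e + \<mu> *\<^sub>C e) * y) \<le> sqrt ((cmod \<mu>)\<^sup>2 + 2) * norm2 y"
    by (rule power2_le_imp_le) simp
qed auto

end

section \<open>The order on the whole algebra and the Jordan decomposition\<close>

lemma positive_if_norm_le:
  assumes "self_adjoint a" "norm a \<le> c" shows "positive_on A (c *\<^sub>R 1 - a)"
  unfolding positive_on_def
proof safe
  show "self_adjoint (c *\<^sub>R 1 - a)" using assms by (simp add: self_adjoint_diff self_adjoint_scaleR)
  fix y
  have "Re (\<tau> (adj y * (a * y))) \<le> norm2 y * norm2 (a * y)"
    by (rule order_trans[OF complex_Re_le_cmod Cauchy_Schwarz])
  also have "\<dots> \<le> norm2 y * (c * norm2 y)"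
    using norm2_mult_left[of a y] mult_right_mono[OF assms(2), of "norm2 y"]
    by (intro mult_left_mono) auto
  also have "\<dots> = c * Re (\<tau> (adj y * y))" by (simp add: norm2_square[symmetric] power2_eq_square)
  finally show "0 \<le> Re (\<tau> (adj y * (c *\<^sub>R 1 - a) * y))"
    by (simp add: right_diff_distrib left_diff_distrib tau_simps mult.assoc)
qed

abbreviation positive :: "'a \<Rightarrow> bool" where "positive \<equiv> positive_on UNIV"

lemma norm_le_if_positive_UNIV: "0 \<le> c \<Longrightarrow> positive (c *\<^sub>R 1 - a) \<Longrightarrow> positive (c *\<^sub>R 1 + a) \<Longrightarrow> norm a \<le> c"
  by (rule norm_le_if_positive[OF closed_star_subalgebra_UNIV]) auto

lemma positive_self_adjoint: "positive_on A a \<Longrightarrow> self_adjoint a"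
  by (simp add: positive_on_def)

lemma positive_1: "positive_on A 1"
  using positive_on_adj_mult_self[of A 1] by simp

lemma Re_tau_positive: "positive a \<Longrightarrow> 0 \<le> Re (\<tau> a)"
  unfolding positive_on_def by (metis UNIV_I adj_1 mult.left_neutral mult.right_neutral)

lemma positive_mult:
  assumes a: "positive a" and b: "positive b" and ab: "a * b = b * a"
  shows "positive (a * b)"
proof -
  obtain s where s: "self_adjoint s" "s * s = a" "\<And>y. a * y = y * a \<Longrightarrow> s * y = y * s"
    using positive_square_root[OF closed_star_subalgebra_UNIV _ a] by (metis UNIV_I)
  have "a * b = s * (s * b)" by (simp add: s(2)[symmetric] mult.assoc)
  also have "\<dots> = s * (b * s)" by (simp only: s(3)[OF ab])
  also have "\<dots> = adj s * b * s" using s(1) by (simp add: self_adjoint_def mult.assoc)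
  finally have "a * b = adj s * b * s" .
  then show ?thesis using positive_on_conj[OF b, of s] by simp
qed

text \<open>If \<open>a c = a\<^sup>2\<close> with \<open>c \<ge> 0\<close>, the negative part \<open>m\<close> of \<open>a\<close> satisfies \<open>m a m = m c m\<close>.\<close>
lemma positive_if_mult_eq_square:
  assumes a: "self_adjoint a" "norm a \<le> 1" and c: "positive c" and ac: "a * c = a * a" "c * a = a * a"
  shows "positive a"
proof -
  obtain t where t: "self_adjoint t" "t * t * (t * t) = a * a" "\<And>y. a * y = y * a \<Longrightarrow> t * y = y * t"
    using abs_square_root[OF closed_star_subalgebra_UNIV UNIV_I a] by metis
  have ta: "t * a = a * t" by (rule t(3)) simp
  have tc: "t * c = c * t" by (rule t(3)) (simp add: ac)
  define m where "m = t * t - a"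
  have tta: "t * t * a = a * (t * t)" using ta by (metis mult.assoc)
  have mm: "m * m = - 2 *\<^sub>R (m * a)" "m * a = a * m"
    unfolding m_def using t(2) tta by (simp_all add: algebra_simps scaleR_2)
  have mc: "m * c = c * m" unfolding m_def using ac tc by (simp add: algebra_simps) (metis mult.assoc)
  have sm: "adj m = m" unfolding m_def using t(1) a(1) by (simp add: adj_diff adj_mult self_adjoint_def)
  \<comment> \<open>Since m m is a multiple of m a, the equation a c = a a lets c be replaced by
    a.\<close>
  have "m * (m * c) = m * (m * a)"
    using mm ac by (metis mult.assoc mult_scaleR_left)
  then have "m * (c * m) = m * (a * m)" by (simp only: mc mm(2))
  then have "m * a * m = adj m * c * m" by (simp add: sm mult.assoc)
  then have "0 \<le> Re (\<tau> (m * a * m))" using c by (simp add: positive_on_def)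
  then have "a = t * t" by (rule eq_abs_if_negative_part[OF a(1) t(1,2) ta m_def])
  then show ?thesis using positive_on_adj_mult_self[of UNIV t] t(1) by (simp add: self_adjoint_def)
qed

text \<open>k and m are (|h| + h)/2 and (|h| - h)/2. Both satisfy k |h| = k^2, so their positivity
  follows from that of |h|.\<close>

lemma positive_decomposition:
  assumes h: "self_adjoint h" "norm h \<le> 1"
  obtains k m where "positive k" "positive m" "h = k - m" "k * m = 0" "m * k = 0" "norm k \<le> norm h" "norm m \<le> norm h"
proof -
  obtain t where t: "self_adjoint t" "t * t * (t * t) = h * h" "\<And>y. h * y = y * h \<Longrightarrow> t * y = y * t"
    using abs_square_root[OF closed_star_subalgebra_UNIV UNIV_I h] by metis
  define c where "c = t * t"
  have c: "positive c" using positive_on_adj_mult_self[of UNIV t] t(1) by (simp add: c_def self_adjoint_def)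
  have cs: "self_adjoint c" using c by (rule positive_self_adjoint)
  have cc: "c * c = h * h" using t(2) by (simp add: c_def)
  have "t * h = h * t" by (rule t(3)) simp
  then have ch: "c * h = h * c" unfolding c_def by (metis mult.assoc)
  have nc: "norm c = norm h"
    using norm_square_self_adjoint[OF cs] norm_square_self_adjoint[OF h(1)] cc by simp
  define k where "k = (1/2) *\<^sub>R (c + h)"
  define m where "m = (1/2) *\<^sub>R (c - h)"
  have nk: "norm k \<le> norm h" using norm_triangle_ineq[of c h] by (simp add: k_def nc)
  have nm: "norm m \<le> norm h" using norm_triangle_ineq4[of c h] by (simp add: m_def nc)
  have sk: "self_adjoint k" "self_adjoint m" using cs h(1)
    by (auto simp: k_def m_def self_adjoint_scaleR self_adjoint_add self_adjoint_diff)
  have 4: "4 *\<^sub>R (k * k) = 2 *\<^sub>R (h * h + h * c)" "4 *\<^sub>R (m * m) = 2 *\<^sub>R (h * h - h * c)"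
    unfolding k_def m_def using ch cc by (simp_all add: algebra_simps scaleR_2)
  have "positive k"
  proof (rule positive_if_mult_eq_square[OF sk(1) order_trans[OF nk h(2)] c])
    have "2 *\<^sub>R (k * c) = h * h + h * c" "2 *\<^sub>R (c * k) = h * h + h * c"
      unfolding k_def using ch cc by (simp_all add: algebra_simps)
    then have "4 *\<^sub>R (k * c) = 4 *\<^sub>R (k * k)" "4 *\<^sub>R (c * k) = 4 *\<^sub>R (k * k)"
      unfolding 4 by (metis scaleR_scaleR mult_numeral_1_right numeral_Bit0_eq_double)+
    then show "k * c = k * k" "c * k = k * k" by simp_all
  qed
  moreover have "positive m"
  proof (rule positive_if_mult_eq_square[OF sk(2) order_trans[OF nm h(2)] c])
    have "2 *\<^sub>R (m * c) = h * h - h * c" "2 *\<^sub>R (c * m) = h * h - h * c"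
      unfolding m_def using ch cc by (simp_all add: algebra_simps)
    then have "4 *\<^sub>R (m * c) = 4 *\<^sub>R (m * m)" "4 *\<^sub>R (c * m) = 4 *\<^sub>R (m * m)"
      unfolding 4 by (metis scaleR_scaleR mult_numeral_1_right numeral_Bit0_eq_double)+
    then show "m * c = m * m" "c * m = m * m" by simp_all
  qed
  moreover have "h = k - m" by (simp add: k_def m_def algebra_simps flip: scaleR_add_left)
  moreover have "k * m = 0" "m * k = 0"
    unfolding k_def m_def using ch cc by (simp_all add: algebra_simps)
  ultimately show ?thesis using that nk nm by blast
qed

end

section \<open>Limits in the L^2 norm\<close>

context trace_state
begin

lemma norm2_tendsto_unique:
  assumes "(\<lambda>n. norm2 (x n - a)) \<longlonglongrightarrow> 0" "(\<lambda>n. norm2 (x n - b)) \<longlonglongrightarrow> 0"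
  shows "a = b"
proof -
  have "(\<lambda>n. norm2 (x n - a) + norm2 (x n - b)) \<longlonglongrightarrow> 0"
    using tendsto_add[OF assms] by simp
  moreover have "norm2 (a - b) \<le> norm2 (x n - a) + norm2 (x n - b)" for n
    using norm2_diff_le[of "x n - b" "x n - a"] by simp
  ultimately have "norm2 (a - b) \<le> 0"
    by (intro LIMSEQ_le_const) auto
  then have "norm2 (a - b) = 0" using norm2_nonneg[of "a - b"] by (rule antisym)
  then show ?thesis by simp
qed

lemma norm2_tendsto_mult_right:
  assumes "(\<lambda>n. norm2 (x n - a)) \<longlonglongrightarrow> 0" shows "(\<lambda>n. norm2 (x n * y - a * y)) \<longlonglongrightarrow> 0"
proof (rule tendsto_0_le[OF assms, of _ "norm y"])
  show "eventually (\<lambda>n. norm (norm2 (x n * y - a * y)) \<le> norm (norm2 (x n - a)) * norm y) sequentially"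
    using norm2_mult_right[of "x _ - a" y] by (simp add: left_diff_distrib)
qed

lemma norm2_tendsto_mult_left:
  assumes "(\<lambda>n. norm2 (x n - a)) \<longlonglongrightarrow> 0" shows "(\<lambda>n. norm2 (y * x n - y * a)) \<longlonglongrightarrow> 0"
proof (rule tendsto_0_le[OF assms, of _ "norm y"])
  show "eventually (\<lambda>n. norm (norm2 (y * x n - y * a)) \<le> norm (norm2 (x n - a)) * norm y) sequentially"
    using norm2_mult_left[of y "x _ - a"] by (simp add: right_diff_distrib mult.commute)
qed

lemma norm2_tendsto_adj:
  assumes "(\<lambda>n. norm2 (x n - a)) \<longlonglongrightarrow> 0" shows "(\<lambda>n. norm2 (adj (x n) - adj a)) \<longlonglongrightarrow> 0"
  using assms by (simp flip: adj_diff)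

end

locale wstar_trace = predual P + trace_state \<tau>
  for P :: "('a::cstar_algebra \<Rightarrow>\<^sub>L complex) set" and \<tau> :: "'a \<Rightarrow> complex" +
  assumes normal: "\<tau> \<in> blinfun_apply ` P"
begin

text \<open>The projection \<open>1 - q\<close> is the support of \<open>k\<close>.\<close>
lemma kernel_projection:
  assumes k: "positive k" "positive (1 - k)"
  obtains q where "self_adjoint q" "q * q = q" "q * k = 0" "k * q = 0"
    "\<And>m. k * m = 0 \<Longrightarrow> q * m = m"
proof -
  define g where "g = 1 - k"
  have g: "positive g" "positive (1 - g)" using k by (simp_all add: g_def)
  have sg: "self_adjoint g" using g(1) by (rule positive_self_adjoint)
  have pg: "positive (g ^ n)" for n
  proof (induction n)
    case (Suc n)
    show ?case using positive_mult[OF g(1) Suc] by (simp add: power_commutes)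
  qed (simp add: positive_1)
  have step: "positive (g ^ n - g ^ Suc n)" for n
    using positive_mult[OF pg[of n] g(2)] by (simp add: algebra_simps power_commutes)
  have dec: "positive (g ^ n - g ^ m)" if "n \<le> m" for n m
    using that
  proof (induction m rule: dec_induct)
    case base
    show ?case using positive_on_scaleR[OF positive_1, of 0 UNIV] by simp
  next
    case (step m)
    show ?case using positive_on_add[OF step(3) \<open>\<And>n. positive (g ^ n - g ^ Suc n)\<close>[of m]] by simp
  qed
  \<comment> \<open>The relation 0 \<le> g^n - g^m \<le> 1 is put as a norm inequality about the
    midpoint 1/2, the form that passes to weak* limits.\<close>
  have tri: "norm (g ^ n - g ^ m - (1/2) *\<^sub>R 1) \<le> 1/2" if "n \<le> m" for n m
  proof (rule norm_le_if_positive_UNIV)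
    have "positive ((1 - g ^ n) + g ^ m)"
      using dec[of 0 n] pg[of m] by (intro positive_on_add) auto
    then show "positive ((1/2) *\<^sub>R 1 - (g ^ n - g ^ m - (1/2) *\<^sub>R 1))"
      by (simp add: algebra_simps flip: scaleR_add_left)
    show "positive ((1/2) *\<^sub>R 1 + (g ^ n - g ^ m - (1/2) *\<^sub>R 1))"
      using dec[OF that] by simp
  qed simp
  have ng: "norm g \<le> 1"
    by (rule norm_le_if_positive_UNIV) (use g positive_on_add[OF positive_1 g(1)] in auto)
  obtain G :: "nat filter" where G: "ultrafilter G" "G \<le> sequentially"
    using ultrafilter_exists[of sequentially] by auto
  have nb: "G \<noteq> bot" using G(1) by (rule ultrafilter_not_bot)
  have "eventually (\<lambda>n. norm (g ^ n) \<le> 1) G" by (simp add: norm_power_le_1[OF ng])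
  then obtain q where q: "\<And>\<phi>. \<phi> \<in> P \<Longrightarrow> ((\<lambda>n. blinfun_apply \<phi> (g ^ n)) \<longlongrightarrow> blinfun_apply \<phi> q) G"
    by (rule weak_star_ultralimit[OF G(1)]) blast
  have w: "norm (g ^ n - q - (1/2) *\<^sub>R 1) \<le> 1/2" for n
  proof -
    have "norm (- q + (g ^ n - (1/2) *\<^sub>R 1)) \<le> 1/2"
    proof (rule norm_weak_star_limit_le[OF nb])
      show "((\<lambda>m. blinfun_apply \<phi> (- (g ^ m))) \<longlongrightarrow> blinfun_apply \<phi> (- q)) G" if "\<phi> \<in> P" for \<phi>
        using tendsto_minus[OF q[OF that]] by (simp add: blinfun.minus_right)
      have "eventually (\<lambda>m. n \<le> m) G" using G(2) by (meson eventually_ge_at_top filter_leD)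
      then show "eventually (\<lambda>m. norm (- (g ^ m) + (g ^ n - (1/2) *\<^sub>R 1)) \<le> 1/2) G"
      proof eventually_elim
        case (elim m)
        then show ?case using tri[OF elim] by (simp add: algebra_simps)
      qed
    qed
    then show ?thesis by (simp add: algebra_simps)
  qed
  \<comment> \<open>In L^2 a distance of at most 1/2 from 1/2 expands to the trace form of d^2 \<le>
    d. Convergence of traces therefore forces convergence in L^2.\<close>
  have sq: "(norm2 (g ^ n - q))\<^sup>2 \<le> Re (\<tau> (g ^ n)) - Re (\<tau> q)" for n
  proof -
    let ?d = "g ^ n - q"
    have "(norm2 (?d - (1/2) *\<^sub>R 1))\<^sup>2 \<le> (1/2)\<^sup>2"
      by (intro power_mono order_trans[OF norm2_le_norm w]) simp
    moreover have "(norm2 (?d - (1/2) *\<^sub>R 1))\<^sup>2 = (norm2 ?d)\<^sup>2 - Re (\<tau> ?d) + 1/4"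
      unfolding norm2_square
      by (simp add: adj_diff adj_scaleR adj_power right_diff_distrib left_diff_distrib tau_simps tau_adj[of q]
          tau_adj[of "g ^ n", unfolded adj_power])
    ultimately show ?thesis by (simp add: tau_diff power2_eq_square)
  qed
  define r where "r = (\<lambda>n. Re (\<tau> (g ^ n)))"
  have "decseq r"
    unfolding r_def decseq_Suc_iff using Re_tau_positive[OF step] by (simp add: tau_diff)
  moreover have "\<And>n. 0 \<le> r n" unfolding r_def by (rule Re_tau_positive[OF pg])
  ultimately obtain L where L: "r \<longlonglongrightarrow> L" using decseq_convergent by metis
  obtain \<psi> where \<psi>: "\<psi> \<in> P" "\<tau> = blinfun_apply \<psi>" using normal by auto
  \<comment> \<open>Normality of \<tau> gives the limit along G. As r is monotone, it converges as a
    sequence, to the same limit.\<close>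
  have "(r \<longlongrightarrow> Re (\<tau> q)) G" unfolding r_def using tendsto_Re[OF q[OF \<psi>(1)]] by (simp add: \<psi>(2))
  moreover have "(r \<longlongrightarrow> L) G" by (rule tendsto_mono[OF G(2) L])
  ultimately have "L = Re (\<tau> q)" using nb by (metis tendsto_unique)
  then have "(\<lambda>n. r n - Re (\<tau> q)) \<longlonglongrightarrow> 0" using tendsto_diff[OF L tendsto_const[of L]] by simp
  then have "(\<lambda>n. (norm2 (g ^ n - q))\<^sup>2) \<longlonglongrightarrow> 0"
    by (rule Lim_null_comparison[rotated]) (use sq in \<open>simp add: r_def\<close>)
  then have lim: "(\<lambda>n. norm2 (g ^ n - q)) \<longlonglongrightarrow> 0"
    using tendsto_real_sqrt by fastforce
  have limS: "(\<lambda>n. norm2 (g ^ Suc n - q)) \<longlonglongrightarrow> 0" using lim by (rule LIMSEQ_Suc)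
  have sq': "self_adjoint q"
    using norm2_tendsto_unique[OF norm2_tendsto_adj[OF lim] , of q] lim sg
    by (simp add: adj_power self_adjoint_def)
  have qg: "q * g = q"
    using norm2_tendsto_unique[OF norm2_tendsto_mult_right[OF lim, of g], of q] limS
    by (simp add: power_commutes)
  have "q * g ^ n = q" for n by (induction n) (simp_all add: qg mult.assoc[symmetric])
  then have "q * q = q"
    using norm2_tendsto_unique[OF norm2_tendsto_mult_left[OF lim, of q], of q] by simp
  moreover have "q * k = 0" using qg by (simp add: g_def algebra_simps)
  moreover from this have "k * q = 0"
    using sq' positive_self_adjoint[OF k(1)] by (metis adj_0 adj_mult self_adjointD)
  moreover have "q * m = m" if "k * m = 0" for m
  proof -
    have "g ^ n * m = m" for n
      by (induction n) (use that in \<open>simp_all add: g_def algebra_simps power_Suc2 del: power_Suc\<close>)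
    then show ?thesis using norm2_tendsto_unique[OF norm2_tendsto_mult_right[OF lim, of m], of m] by simp
  qed
  ultimately show ?thesis using that sq' by blast
qed

text \<open>\<open>e\<close> is the spectral projection of \<open>h\<close> for \<open>[1/2, 1]\<close>.\<close>
lemma dyadic_projection:
  assumes h: "positive h" "positive (1 - h)"
  obtains e where "self_adjoint e" "e * e = e"
    "positive (2 *\<^sub>R h - e)" "positive (1 - (2 *\<^sub>R h - e))"
proof -
  have sh: "self_adjoint h" using h(1) by (rule positive_self_adjoint)
  define h' where "h' = h - (1/2) *\<^sub>R 1"
  have sh': "self_adjoint h'" using sh by (simp add: h'_def self_adjoint_diff self_adjoint_scaleR)
  have nh': "norm h' \<le> 1/2"
  proof (rule norm_le_if_positive_UNIV)
    show "positive ((1/2) *\<^sub>R 1 - h')" using h(2) by (simp add: h'_def algebra_simps flip: scaleR_add_left)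
    show "positive ((1/2) *\<^sub>R 1 + h')" using h(1) by (simp add: h'_def)
  qed simp
  then have "norm h' \<le> 1" by simp
  from positive_decomposition[OF sh' this] obtain k m where km: "positive k" "positive m" "h' = k - m"
    "k * m = 0" "m * k = 0" "norm k \<le> norm h'" by metis
  have "positive (1 - k)"
    using positive_if_norm_le[of k 1 UNIV] positive_self_adjoint[OF km(1)] km(6) nh' by simp
  from kernel_projection[OF km(1) this] obtain q where q: "self_adjoint q" "q * q = q" "q * k = 0" "k * q = 0"
    "\<And>m. k * m = 0 \<Longrightarrow> q * m = m" by metis
  have qm: "q * m = m" using q(5)[OF km(4)] .
  then have mq: "m * q = m"
    using q(1) positive_self_adjoint[OF km(2)] by (metis adj_mult self_adjointD)
  define e where "e = 1 - q"
  have e: "self_adjoint e" "e * e = e" using q(1,2) by (auto simp: e_def self_adjoint_diff algebra_simps)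
  have hh: "h = k - m + (1/2) *\<^sub>R 1" using km(3) by (simp add: h'_def algebra_simps)
  have "q * h * q = (1/2) *\<^sub>R q - m"
    unfolding hh using q(2-4) qm mq by (simp add: distrib_left distrib_right left_diff_distrib right_diff_distrib mult.assoc)
  \<comment> \<open>Below q the element is twice the compression of h, below e it is 2 k; both are
    positive.\<close>
  moreover have "2 *\<^sub>R h - e = 2 *\<^sub>R (k + ((1/2) *\<^sub>R q - m))"
    unfolding hh e_def by (simp add: scaleR_diff_right scaleR_add_right)
  ultimately have "2 *\<^sub>R h - e = 2 *\<^sub>R (k + adj q * h * q)"
    using q(1) by (simp add: self_adjoint_def)
  then have p1: "positive (2 *\<^sub>R h - e)"
    using positive_on_add[OF km(1) positive_on_conj[OF h(1), of q]] positive_on_scaleR[of UNIV _ 2] by simp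
  have ek: "e * k = k" "k * e = k" "e * m = 0" "m * e = 0"
    using q(3,4) qm mq by (simp_all add: e_def algebra_simps)
  have "e * (1 - h) * e = e - e * h * e" using e(2) by (simp add: algebra_simps)
  also have "e * h * e = k + (1/2) *\<^sub>R e"
    unfolding hh using ek e(2) by (simp add: distrib_left distrib_right left_diff_distrib right_diff_distrib mult.assoc)
  finally have "e * (1 - h) * e = e - (k + (1/2) *\<^sub>R e)" .
  \<comment> \<open>The same splitting: 2 m below q, and twice the compression of 1 - h below
    e.\<close>
  moreover have "1 - (2 *\<^sub>R h - e) = 2 *\<^sub>R (m + (e - (k + (1/2) *\<^sub>R e)))"
    unfolding hh by (simp add: scaleR_diff_right scaleR_add_right scaleR_2)
  ultimately have "1 - (2 *\<^sub>R h - e) = 2 *\<^sub>R (m + adj e * (1 - h) * e)"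
    using e(1) by (simp add: self_adjoint_def)
  then have p2: "positive (1 - (2 *\<^sub>R h - e))"
    using positive_on_add[OF km(2) positive_on_conj[OF h(2), of e]] positive_on_scaleR[of UNIV _ 2] by simp
  show ?thesis using that e p1 p2 by blast
qed

section \<open>From normality for projections to normality for all densities\<close>

definition tau_blinfun :: "'a \<Rightarrow>\<^sub>L complex" where
  "tau_blinfun = (SOME \<psi>. \<psi> \<in> P \<and> \<tau> = blinfun_apply \<psi>)"

lemma tau_blinfun: "tau_blinfun \<in> P" "blinfun_apply tau_blinfun = \<tau>"
proof -
  have "\<exists>\<psi>. \<psi> \<in> P \<and> \<tau> = blinfun_apply \<psi>" using normal by auto
  from someI_ex[OF this] show "tau_blinfun \<in> P" "blinfun_apply tau_blinfun = \<tau>"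
    by (simp_all add: tau_blinfun_def)
qed

definition tau_left :: "'a \<Rightarrow> 'a \<Rightarrow>\<^sub>L complex" where
  "tau_left y = tau_blinfun o\<^sub>L blinfun_mult_right y"

lemma tau_left_apply [simp]: "blinfun_apply (tau_left y) x = \<tau> (y * x)"
  by (simp add: tau_left_def tau_blinfun)

lemma tau_left_clinear: "clinear_functional (blinfun_apply (tau_left y))"
  by (simp add: clinear_functional_def tau_simps algebra_simps mult_scaleC_right)

lemma tau_left_add: "tau_left (x + y) = tau_left x + tau_left y"
  by (rule blinfun_eqI) (simp add: blinfun.add_left algebra_simps tau_simps)

lemma tau_left_diff: "tau_left (x - y) = tau_left x - tau_left y"
  by (rule blinfun_eqI) (simp add: blinfun.diff_left algebra_simps tau_simps)

lemma tau_left_scaleC: "tau_left (c *\<^sub>C y) = blinfun_mult_right c o\<^sub>L tau_left y"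
  by (rule blinfun_eqI) (simp add: mult_scaleC_left tau_simps)

text \<open>The bound by the L^2 norm, not only by \<open>norm y\<close>, makes L^2-Cauchy sequences
  of densities converge in the closed space P.\<close>

lemma norm_tau_left_le: "norm (tau_left y) \<le> norm2 y"
proof (rule norm_blinfun_bound)
  show "cmod (blinfun_apply (tau_left y) x) \<le> norm2 y * norm x" for x
    using tau_mult_le[of y x] mult_left_mono[OF norm2_le_norm[of x], of "norm2 y"] by simp
qed simp

text \<open>If the x in the ball tend to 0 and e x e tends to y, both weak*, then x - e x e tends to
  - y. The inequality for compressions gives \<tau>(f y) = 0, that for the defects \<tau>(e y) = 0.
  So \<tau>(e x) = \<tau>(e x e) tends to \<tau>(y) = 0.\<close>

lemma tau_left_projection:
  assumes e: "self_adjoint e" "e * e = e"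
  shows "tau_left e \<in> P"
proof (rule mem_predual_if_continuous_on_ball[OF tau_left_clinear])
  fix G :: "'a filter"
  assume G: "ultrafilter G" and ball: "eventually (\<lambda>x. norm x \<le> 1) G"
    and lim0: "\<And>\<psi>. \<psi> \<in> P \<Longrightarrow> (blinfun_apply \<psi> \<longlongrightarrow> 0) G"
  have nb: "G \<noteq> bot" using G by (rule ultrafilter_not_bot)
  define f where "f = 1 - e"
  note f = complement_projection[OF e f_def]
  have tr: "of_real ((norm2 e)\<^sup>2) = \<tau> e" "of_real ((norm2 f)\<^sup>2) = \<tau> f"
    using tau_adj_mult_self[of e] tau_adj_mult_self[of f] e f by (simp_all add: self_adjoint_def)
  have "eventually (\<lambda>x. norm (e * x * e) \<le> 1) G"
    using ball
  proof eventually_elim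
    case (elim x)
    have "norm (e * x * e) \<le> norm e * norm x * norm e"
      by (meson norm_mult_ineq mult_right_mono norm_ge_zero order_trans)
    also have "\<dots> \<le> 1 * 1 * 1"
      using elim norm_projection_le_1[OF e] by (intro mult_mono) auto
    finally show ?case by simp
  qed
  then obtain y where y: "\<And>\<phi>. \<phi> \<in> P \<Longrightarrow> ((\<lambda>x. blinfun_apply \<phi> (e * x * e)) \<longlongrightarrow> blinfun_apply \<phi> y) G"
    by (rule weak_star_ultralimit[OF G]) blast
  have r: "((\<lambda>x. blinfun_apply \<phi> (x - e * x * e)) \<longlongrightarrow> blinfun_apply \<phi> (- y)) G" if "\<phi> \<in> P" for \<phi>
    using tendsto_diff[OF lim0[OF that] y[OF that]] by (simp add: blinfun.diff_right blinfun.minus_right)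
  have "\<tau> (f * y) = 0"
  proof (rule eq_0_if_disc_bound[of "(norm2 f)\<^sup>2" 0])
    fix \<mu> assume \<mu>: "1 \<le> cmod \<mu>"
    have "norm (y + \<mu> *\<^sub>C f) \<le> cmod \<mu>"
      by (rule norm_weak_star_limit_le[OF nb y])
        (use ball norm_compression_add_complement[OF e f_def _ \<mu>] in \<open>auto elim: eventually_mono\<close>)
    then have "cmod (\<tau> (f * (y + \<mu> *\<^sub>C f))) \<le> (norm2 f)\<^sup>2 * cmod \<mu>"
      using tau_projection_le[OF f(2), of "y + \<mu> *\<^sub>C f"] mult_left_mono[of _ _ "(norm2 f)\<^sup>2"]
      by (meson order_trans zero_le_power2)
    moreover have "\<tau> (f * (y + \<mu> *\<^sub>C f)) = \<tau> (f * y) + \<mu> * \<tau> f"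
      using f(2) by (simp add: algebra_simps mult_scaleC_right tau_simps)
    ultimately show "cmod (\<tau> (f * y) + \<mu> * of_real ((norm2 f)\<^sup>2)) \<le> (norm2 f)\<^sup>2 * sqrt ((cmod \<mu>)\<^sup>2 + 0)"
      unfolding tr by simp
  qed simp_all
  moreover have "\<tau> (e * - y) = 0"
  proof (rule eq_0_if_disc_bound[of "(norm2 e)\<^sup>2" 2])
    fix \<mu> :: complex
    have "norm (- y + \<mu> *\<^sub>C e) \<le> sqrt ((cmod \<mu>)\<^sup>2 + 2)"
      by (rule norm_weak_star_limit_le[OF nb r])
        (use ball norm_defect_add_projection[OF e f_def] in \<open>auto elim: eventually_mono\<close>)
    then have "cmod (\<tau> (e * (- y + \<mu> *\<^sub>C e))) \<le> (norm2 e)\<^sup>2 * sqrt ((cmod \<mu>)\<^sup>2 + 2)"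
      using tau_projection_le[OF e(2), of "- y + \<mu> *\<^sub>C e"] mult_left_mono[of _ _ "(norm2 e)\<^sup>2"]
      by (meson order_trans zero_le_power2)
    moreover have "\<tau> (e * (- y + \<mu> *\<^sub>C e)) = \<tau> (e * - y) + \<mu> * \<tau> e"
      using e(2) by (simp add: algebra_simps mult_scaleC_right tau_simps)
    ultimately show "cmod (\<tau> (e * - y) + \<mu> * of_real ((norm2 e)\<^sup>2)) \<le> (norm2 e)\<^sup>2 * sqrt ((cmod \<mu>)\<^sup>2 + 2)"
      unfolding tr by simp
  qed simp_all
  ultimately have "\<tau> y = 0" by (simp add: f_def left_diff_distrib tau_simps)
  moreover have "\<tau> (e * x * e) = \<tau> (e * x)" for x
    using tau_commute[of "e * x" e] e(2) by (simp add: mult.assoc[symmetric])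
  ultimately show "(blinfun_apply (tau_left e) \<longlongrightarrow> 0) G"
    using y[OF tau_blinfun(1)] by (simp add: tau_blinfun(2) tau_left_apply[abs_def])
qed

text \<open>One binary digit per step: h is the mean of the projection e and the remainder 2 h - e,
  which again lies between 0 and 1, so the error is halved.\<close>

lemma tau_left_approx:
  assumes "positive h" "positive (1 - h)"
  shows "\<exists>y. tau_left y \<in> P \<and> norm (h - y) \<le> (1/2) ^ n"
  using assms
proof (induction n arbitrary: h)
  case 0
  have "norm h \<le> 1"
    by (rule norm_le_if_positive_UNIV) (use 0 positive_on_add[OF positive_1 0(1)] in auto)
  moreover have "tau_left 0 = 0" by (rule blinfun_eqI) simp
  then have "tau_left 0 \<in> P" using P_zero by simp
  ultimately show ?case by (intro exI[of _ 0]) simp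
next
  case (Suc n)
  obtain e where e: "self_adjoint e" "e * e = e" "positive (2 *\<^sub>R h - e)" "positive (1 - (2 *\<^sub>R h - e))"
    using dyadic_projection[OF Suc.prems] by metis
  obtain y where y: "tau_left y \<in> P" "norm (2 *\<^sub>R h - e - y) \<le> (1/2) ^ n"
    using Suc.IH[OF e(3,4)] by blast
  have "tau_left ((1/2) *\<^sub>C (e + y)) \<in> P"
    unfolding tau_left_scaleC tau_left_add by (intro P_mult P_add tau_left_projection e y)
  moreover have "h - (1/2) *\<^sub>C (e + y) = (1/2) *\<^sub>R (2 *\<^sub>R h - e - y)"
    by (simp add: scaleR_eq_scaleC[of "1/2"] scaleC_diff_right scaleC_add_right)
      (simp add: scaleR_eq_scaleC scaleC_scaleC)
  ultimately show ?case using y(2) by (intro exI[of _ "(1/2) *\<^sub>C (e + y)"]) simp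
qed

lemma tau_left_mem: "tau_left y \<in> P"
proof -
  have pos: "tau_left h \<in> P" if h: "positive h" "positive (1 - h)" for h
  proof -
    have "\<exists>\<psi>\<in>P. dist \<psi> (tau_left h) < \<epsilon>" if "\<epsilon> > 0" for \<epsilon>
    proof -
      obtain n where n: "(1/2) ^ n < \<epsilon>" using real_arch_pow_inv[OF \<open>\<epsilon> > 0\<close>, of "1/2"] by auto
      obtain y where y: "tau_left y \<in> P" "norm (h - y) \<le> (1/2) ^ n" using tau_left_approx[OF h] by blast
      have "dist (tau_left y) (tau_left h) \<le> norm2 (h - y)"
        using norm_tau_left_le[of "h - y"] by (simp add: dist_norm tau_left_diff norm_minus_commute)
      then have "dist (tau_left y) (tau_left h) < \<epsilon>" using y(2) n norm2_le_norm[of "h - y"] by linarith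
      then show ?thesis using y(1) by blast
    qed
    then show ?thesis by (subst closed_approachable[OF P_closed, symmetric]) blast
  qed
  have one: "tau_left 1 \<in> P" by (rule tau_left_projection) simp_all
  have sa: "tau_left x \<in> P" if x: "self_adjoint x" for x
  proof -
    \<comment> \<open>As c exceeds 2 \<open>norm x\<close>, the element x / c + 1/2 lies between 0
      and 1; the summand 1 keeps c positive for x = 0.\<close>
    define c where "c = 2 * norm x + 1"
    define h where "h = (1 / c) *\<^sub>C x + (1/2) *\<^sub>C 1"
    have c: "c > 0" by (simp add: c_def add_nonneg_pos)
    have hx: "h = (1 / c) *\<^sub>R x + (1/2) *\<^sub>R 1" by (simp add: h_def scaleR_eq_scaleC)
    have s: "self_adjoint ((1 / c) *\<^sub>R x)" "norm ((1 / c) *\<^sub>R x) \<le> 1/2"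
      using x c by (simp_all add: self_adjoint_scaleR c_def field_simps)
    have "positive h" using positive_if_norm_le[of "- ((1 / c) *\<^sub>R x)" "1/2" UNIV] s
      by (simp add: hx self_adjoint_minus add.commute)
    moreover have "1 - h = (1/2) *\<^sub>R 1 - (1 / c) *\<^sub>R x"
      using scaleR_left_diff_distrib[of 1 "1/2" "1::'a"] by (simp add: hx)
    then have "positive (1 - h)" using positive_if_norm_le[OF s, of UNIV] by simp
    ultimately have h: "tau_left h \<in> P" by (rule pos)
    have "x = c *\<^sub>C (h + (- 1/2) *\<^sub>C 1)" using c by (simp add: h_def scaleC_add_right scaleC_scaleC)
    then have "tau_left x = tau_left (c *\<^sub>C (h + (- 1/2) *\<^sub>C 1))" by simp
    also have "\<dots> \<in> P" unfolding tau_left_scaleC tau_left_add by (intro P_mult P_add h one)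
    finally show ?thesis .
  qed
  define a where "a = (1/2) *\<^sub>C (y + adj y)"
  define b where "b = (- \<i>/2) *\<^sub>C (y - adj y)"
  have "self_adjoint a" "self_adjoint b"
    by (simp_all add: a_def b_def self_adjoint_def adj_scaleC adj_add adj_diff adj_adj scaleC_diff_right scaleC_add_right)
  then have ab: "tau_left a \<in> P" "tau_left b \<in> P" by (auto intro: sa)
  have "y = a + \<i> *\<^sub>C b"
    by (simp add: a_def b_def scaleC_scaleC scaleC_diff_right scaleC_add_right flip: scaleC_add_left)
  then have "tau_left y = tau_left (a + \<i> *\<^sub>C b)" by simp
  also have "\<dots> \<in> P" unfolding tau_left_scaleC tau_left_add by (intro P_mult P_add ab)
  finally show ?thesis .
qed

end

section \<open>Generated algebras\<close>

context predual
begin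

lemma topspace_weak_star [simp]: "topspace (weak_star_topology P) = UNIV"
proof -
  have "blinfun_apply 0 -` UNIV \<in> {blinfun_apply \<phi> -` G |\<phi> G. \<phi> \<in> P \<and> open G}"
    using P_zero by blast
  then show ?thesis
    unfolding weak_star_topology_def topology_generated_by_topspace by auto
qed

text \<open>The elements of P are norm continuous, so the norm topology is finer than the weak*
  topology.\<close>

lemma wstar_subalgebra_closed:
  assumes "wstar_subalgebra P A" shows "closed_star_subalgebra A"
proof -
  have "continuous_map euclidean (weak_star_topology P) (\<lambda>x. x)"
    unfolding weak_star_topology_def
  proof (rule continuous_on_generated_topo)
    fix U assume "U \<in> {blinfun_apply \<phi> -` G |\<phi> G. \<phi> \<in> P \<and> open G}"
    then obtain \<phi> :: "'a \<Rightarrow>\<^sub>L complex" and G where "U = blinfun_apply \<phi> -` G" "open G" by blast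
    then have "open U"
      by (simp add: open_vimage linear_continuous_on[OF blinfun.bounded_linear_right])
    then show "openin euclidean ((\<lambda>x. x) -` U \<inter> topspace euclidean)" by (simp add: vimage_def)
  next
    show "(\<lambda>x. x) ` topspace euclidean \<subseteq> \<Union> {blinfun_apply \<phi> -` G |\<phi> G. \<phi> \<in> P \<and> open G}"
      using topspace_weak_star by (simp add: weak_star_topology_def topology_generated_by_topspace)
  qed
  moreover have "closedin (weak_star_topology P) A" using assms by (simp add: wstar_subalgebra_def)
  ultimately have "closedin euclidean {x \<in> topspace euclidean. x \<in> A}"
    by (rule closedin_continuous_map_preimage)
  then have "closed A" by simp
  then show ?thesis using assms by (simp add: wstar_subalgebra_def closed_star_subalgebra_def)
qed

lemma closedin_weak_star_if_separated:
  assumes "\<And>x. x \<notin> A \<Longrightarrow> \<exists>\<phi>\<in>P. blinfun_apply \<phi> x \<noteq> 0 \<and> (\<forall>a\<in>A. blinfun_apply \<phi> a = 0)"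
  shows "closedin (weak_star_topology P) A"
proof -
  have "openin (weak_star_topology P) (- A)"
  proof (subst openin_subopen, intro ballI)
    fix x assume "x \<in> - A"
    then obtain \<phi> where \<phi>: "\<phi> \<in> P" "blinfun_apply \<phi> x \<noteq> 0" "\<forall>a\<in>A. blinfun_apply \<phi> a = 0"
      using assms by blast
    have "openin (weak_star_topology P) (blinfun_apply \<phi> -` (- {0}))"
      unfolding weak_star_topology_def using \<phi>(1) by (intro topology_generated_by_Basis) auto
    then show "\<exists>T. openin (weak_star_topology P) T \<and> x \<in> T \<and> T \<subseteq> - A"
      using \<phi>(2,3) by (intro exI[of _ "blinfun_apply \<phi> -` (- {0})"]) auto
  qed
  then show ?thesis by (simp add: closedin_def Compl_eq_Diff_UNIV)
qed

end

lemma generated_algebra_subalgebra: "subalgebra (generated_algebra S)"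
  by (auto simp: generated_algebra_def subalgebra_def)

lemma generated_algebra_superset: "S \<subseteq> generated_algebra S"
  by (auto simp: generated_algebra_def)

lemma generated_algebra_least: "subalgebra A \<Longrightarrow> S \<subseteq> A \<Longrightarrow> generated_algebra S \<subseteq> A"
  by (auto simp: generated_algebra_def)

lemma generated_algebra_adj:
  assumes S: "\<And>x. x \<in> S \<Longrightarrow> adj x \<in> S" and x: "x \<in> generated_algebra S"
  shows "adj x \<in> generated_algebra S"
proof -
  note A = subalgebraD[OF generated_algebra_subalgebra[of S]]
  have "subalgebra {x. adj x \<in> generated_algebra S}"
    by (auto simp: subalgebra_def adj_add adj_scaleC adj_mult intro: A)
  moreover have "S \<subseteq> {x. adj x \<in> generated_algebra S}" using S generated_algebra_superset by auto
  ultimately show ?thesis using generated_algebra_least x by blast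
qed

lemma generated_wstar_algebra_self: "wstar_subalgebra P A \<Longrightarrow> generated_wstar_algebra P A = A"
  by (auto simp: generated_wstar_algebra_def)

lemma generated_wstar_algebra_superset: "S \<subseteq> generated_wstar_algebra P S"
  by (auto simp: generated_wstar_algebra_def)

lemma generated_wstar_algebra_least: "wstar_subalgebra P A \<Longrightarrow> S \<subseteq> A \<Longrightarrow> generated_wstar_algebra P S \<subseteq> A"
  by (auto simp: generated_wstar_algebra_def)

lemma generated_wstar_algebra_subalgebra: "subalgebra (generated_wstar_algebra P S)"
  by (auto simp: generated_wstar_algebra_def wstar_subalgebra_def subalgebra_def)

lemma generated_wstar_algebra_adj:
  "x \<in> generated_wstar_algebra P S \<Longrightarrow> adj x \<in> generated_wstar_algebra P S"
  by (auto simp: generated_wstar_algebra_def wstar_subalgebra_def)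

section \<open>Approximate orthogonality and L^2-closures\<close>

context trace_state
begin

lemma inner_le_if_near_minimal:
  assumes "\<And>c. (norm2 u)\<^sup>2 \<le> (norm2 (u - c *\<^sub>C b))\<^sup>2 + \<epsilon>\<^sup>2" "0 \<le> \<epsilon>"
  shows "cmod (\<tau> (adj u * b)) \<le> \<epsilon> * norm2 b"
proof (cases "b = 0")
  case False
  define n where "n = (norm2 b)\<^sup>2"
  define z where "z = \<tau> (adj u * b)"
  have n: "n > 0" using False by (simp add: n_def)
  \<comment> \<open>The coefficient of the orthogonal projection of u to b, for which the hypothesis
    is sharpest.\<close>
  define c where "c = cnj z / of_real n"
  have "(norm2 (u - c *\<^sub>C b))\<^sup>2 = (norm2 u)\<^sup>2 + (cmod c)\<^sup>2 * n - 2 * Re (c * z)"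
    using norm2_add_square[of u "- (c *\<^sub>C b)"]
    by (simp add: norm2_scaleC power_mult_distrib n_def mult_scaleC_right tau_simps z_def)
  moreover have "Re (c * z) = (cmod z)\<^sup>2 / n"
    by (simp add: c_def complex_norm_square[symmetric] mult.commute)
  moreover have "(cmod c)\<^sup>2 * n = (cmod z)\<^sup>2 / n"
    using n by (simp add: c_def norm_divide power_divide power2_eq_square)
  ultimately have "(cmod z)\<^sup>2 / n \<le> \<epsilon>\<^sup>2" using assms(1)[of c] by simp
  then have "(cmod z)\<^sup>2 \<le> (\<epsilon> * norm2 b)\<^sup>2"
    using n by (simp add: field_simps n_def power_mult_distrib)
  moreover have "0 \<le> \<epsilon> * norm2 b" using assms(2) by simp
  ultimately show ?thesis unfolding z_def[symmetric] by (rule power2_le_imp_le)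
qed simp

text \<open>Only elements of the algebra itself are collected, and no bound is imposed on the
  operator norms of the approximants.\<close>

definition l2_closure :: "'a set \<Rightarrow> 'a set" where
  "l2_closure A = {a. \<forall>\<epsilon>>0. \<exists>b\<in>A. norm2 (a - b) < \<epsilon>}"

lemma l2_closureD: "x \<in> l2_closure A \<Longrightarrow> 0 < \<epsilon> \<Longrightarrow> \<exists>b\<in>A. norm2 (x - b) < \<epsilon>"
  by (simp add: l2_closure_def)

lemma l2_closure_superset: "A \<subseteq> l2_closure A"
  by (force simp: l2_closure_def)

lemma l2_closure_subalgebra:
  assumes A: "subalgebra A" shows "subalgebra (l2_closure A)"
  unfolding subalgebra_def
proof (intro conjI ballI allI)
  show "1 \<in> l2_closure A" using l2_closure_superset subalgebra_one[OF A] by blast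
next
  fix x y assume xy: "x \<in> l2_closure A" "y \<in> l2_closure A"
  show "x + y \<in> l2_closure A"
    unfolding l2_closure_def
  proof safe
    fix \<epsilon> :: real assume "\<epsilon> > 0"
    then obtain a b where ab: "a \<in> A" "b \<in> A" "norm2 (x - a) < \<epsilon> / 2" "norm2 (y - b) < \<epsilon> / 2"
      using l2_closureD[OF xy(1), of "\<epsilon> / 2"] l2_closureD[OF xy(2), of "\<epsilon> / 2"] by auto
    then have "norm2 (x + y - (a + b)) < \<epsilon>"
      using norm2_triangle[of "x - a" "y - b"] by (simp add: algebra_simps)
    then show "\<exists>b\<in>A. norm2 (x + y - b) < \<epsilon>" using ab subalgebra_add[OF A] by blast
  qed
  show "x * y \<in> l2_closure A"
    unfolding l2_closure_def
  proof safe
    fix \<epsilon> :: real assume \<epsilon>: "\<epsilon> > 0"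
    have pos: "0 < norm z + 1" for z :: 'a by (simp add: add_nonneg_pos)
    \<comment> \<open>The approximant b is chosen before a: the precision required of a depends on
      \<open>norm b\<close>, for which no bound is known in advance.\<close>
    obtain b where b: "b \<in> A" "norm2 (y - b) < \<epsilon> / 2 / (norm x + 1)"
      using l2_closureD[OF xy(2), of "\<epsilon> / 2 / (norm x + 1)"] \<epsilon> pos[of x] by auto
    obtain a where a: "a \<in> A" "norm2 (x - a) < \<epsilon> / 2 / (norm b + 1)"
      using l2_closureD[OF xy(1), of "\<epsilon> / 2 / (norm b + 1)"] \<epsilon> pos[of b] by auto
    have "x * y - a * b = x * (y - b) + (x - a) * b" by (simp add: algebra_simps)
    then have "norm2 (x * y - a * b) \<le> norm x * norm2 (y - b) + norm2 (x - a) * norm b"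
      using norm2_triangle[of "x * (y - b)" "(x - a) * b"] norm2_mult_left[of x "y - b"]
        norm2_mult_right[of "x - a" b] by simp
    also have "\<dots> \<le> (norm x + 1) * norm2 (y - b) + norm2 (x - a) * (norm b + 1)"
      by (intro add_mono mult_right_mono mult_left_mono) auto
    also have "\<dots> < \<epsilon> / 2 + \<epsilon> / 2"
      using a(2) b(2) pos[of x] pos[of b] by (intro add_strict_mono) (simp_all add: field_simps)
    finally show "\<exists>b\<in>A. norm2 (x * y - b) < \<epsilon>" using a b subalgebra_mult[OF A] by (auto intro!: bexI[of _ "a * b"])
  qed
next
  fix c x assume x: "x \<in> l2_closure A"
  show "c *\<^sub>C x \<in> l2_closure A"
    unfolding l2_closure_def
  proof safe
    fix \<epsilon> :: real assume \<epsilon>: "\<epsilon> > 0"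
    have pos: "0 < cmod c + 1" by (simp add: add_nonneg_pos)
    obtain a where a: "a \<in> A" "norm2 (x - a) < \<epsilon> / (cmod c + 1)"
      using x divide_pos_pos[OF \<epsilon> pos] unfolding l2_closure_def by blast
    have "norm2 (c *\<^sub>C x - c *\<^sub>C a) \<le> (cmod c + 1) * norm2 (x - a)"
      unfolding scaleC_diff_right[symmetric] norm2_scaleC by (simp add: mult_right_mono)
    also have "\<dots> < \<epsilon>" using a(2) pos by (simp add: field_simps)
    finally show "\<exists>b\<in>A. norm2 (c *\<^sub>C x - b) < \<epsilon>" using a subalgebra_scaleC[OF A] by blast
  qed
qed

lemma l2_closure_adj:
  assumes "\<And>a. a \<in> A \<Longrightarrow> adj a \<in> A" "x \<in> l2_closure A" shows "adj x \<in> l2_closure A"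
proof -
  have "\<exists>b\<in>A. norm2 (adj x - b) < \<epsilon>" if \<epsilon>: "0 < \<epsilon>" for \<epsilon>
  proof -
    obtain b where b: "b \<in> A" "norm2 (x - b) < \<epsilon>" using l2_closureD[OF assms(2) \<epsilon>] by blast
    have "norm2 (adj x - adj b) = norm2 (x - b)" by (simp flip: adj_diff)
    then show ?thesis using b assms(1) by (intro bexI[of _ "adj b"]) auto
  qed
  then show ?thesis by (simp add: l2_closure_def)
qed

lemma tau_eq_0_on_l2_closure:
  assumes "\<And>a. a \<in> A \<Longrightarrow> \<tau> (a * v) = 0" "x \<in> l2_closure A"
  shows "\<tau> (x * v) = 0"
proof (rule ccontr)
  assume n: "\<tau> (x * v) \<noteq> 0"
  then have v: "norm2 v > 0" by (metis less_le mult_zero_right norm2_eq_0_iff norm2_nonneg tau_0)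
  have "0 < cmod (\<tau> (x * v)) / norm2 v" using n v by simp
  then obtain a where a: "a \<in> A" "norm2 (x - a) < cmod (\<tau> (x * v)) / norm2 v"
    using assms(2) unfolding l2_closure_def by blast
  have "\<tau> (x * v) = \<tau> ((x - a) * v)" using assms(1)[OF a(1)] by (simp add: left_diff_distrib tau_diff)
  then have "cmod (\<tau> (x * v)) \<le> norm2 (x - a) * norm2 v" using tau_mult_le[of "x - a" v] by simp
  also have "\<dots> < cmod (\<tau> (x * v))" using a(2) v by (simp add: field_simps)
  finally show False by simp
qed

end

context wstar_trace
begin

text \<open>The component of x0 orthogonal to A may exist in the completion only. It is replaced by
  differences u n of x0 and near minimisers a n of the distance; the functionals with densities
  \<open>adj (u n)\<close> converge in norm, so their limit stays in the closed space P.\<close>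

lemma l2_closure_separated:
  assumes A: "subalgebra A" and x0: "x0 \<notin> l2_closure A"
  shows "\<exists>\<phi>\<in>P. blinfun_apply \<phi> x0 \<noteq> 0 \<and> (\<forall>a\<in>l2_closure A. blinfun_apply \<phi> a = 0)"
proof -
  obtain \<delta> where \<delta>: "\<delta> > 0" "\<And>b. b \<in> A \<Longrightarrow> \<delta> \<le> norm2 (x0 - b)"
    using x0 unfolding l2_closure_def by (auto simp: not_less)
  define D where "D = (INF b\<in>A. (norm2 (x0 - b))\<^sup>2)"
  have ne: "A \<noteq> {}" using subalgebra_one[OF A] by blast
  have bdd: "bdd_below ((\<lambda>b. (norm2 (x0 - b))\<^sup>2) ` A)" by (rule bdd_belowI2[of _ 0]) simp
  have D: "D \<le> (norm2 (x0 - b))\<^sup>2" if "b \<in> A" for b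
    unfolding D_def using bdd that by (rule cINF_lower)
  have "\<delta>\<^sup>2 \<le> D" unfolding D_def using \<delta> by (intro cINF_greatest[OF ne] power_mono) auto
  then have D0: "D > 0" using \<delta>(1) by (meson less_le_trans zero_less_power)
  define s where "s = (\<lambda>n. 1 / real (Suc n))"
  have s: "s n > 0" "s n \<le> 1" for n by (simp_all add: s_def)
  have s0: "s \<longlonglongrightarrow> 0" unfolding s_def using LIMSEQ_inverse_real_of_nat by (simp add: inverse_eq_divide)
  have "\<exists>b\<in>A. (norm2 (x0 - b))\<^sup>2 < D + (s n)\<^sup>2" for n
    using cINF_less_iff[OF ne bdd, of "D + (s n)\<^sup>2"] s[of n] by (auto simp: D_def)
  then obtain a where a: "\<And>n. a n \<in> A" "\<And>n. (norm2 (x0 - a n))\<^sup>2 < D + (s n)\<^sup>2" by metis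
  define u where "u = (\<lambda>n. x0 - a n)"
  have orth: "cmod (\<tau> (adj (u n) * b)) \<le> s n * norm2 b" if b: "b \<in> A" for n b
  proof (rule inner_le_if_near_minimal)
    fix c
    have "a n + c *\<^sub>C b \<in> A" using a b by (intro subalgebraD[OF A])
    then have "D \<le> (norm2 (u n - c *\<^sub>C b))\<^sup>2" using D[of "a n + c *\<^sub>C b"] by (simp add: u_def algebra_simps)
    then show "(norm2 (u n))\<^sup>2 \<le> (norm2 (u n - c *\<^sub>C b))\<^sup>2 + (s n)\<^sup>2" using a(2)[of n] by (simp add: u_def)
  qed (use s[of n] in simp)
  \<comment> \<open>The difference of two u n lies in A, so approximate orthogonality can be tested
    against that difference itself.\<close>
  have cau: "norm2 (u m - u n) \<le> s n + s m" for m n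
  proof (cases "u m = u n")
    case False
    let ?b = "a n - a m"
    have b: "?b \<in> A" using a by (intro subalgebraD[OF A])
    have ub: "u m - u n = ?b" by (simp add: u_def)
    have "of_real ((norm2 ?b)\<^sup>2) = \<tau> (adj (u m) * ?b) - \<tau> (adj (u n) * ?b)"
      by (simp add: tau_adj_mult_self[symmetric] ub[symmetric] adj_diff left_diff_distrib tau_diff del: of_real_power)
    then have "(norm2 ?b)\<^sup>2 \<le> cmod (\<tau> (adj (u m) * ?b)) + cmod (\<tau> (adj (u n) * ?b))"
      by (metis norm_of_real norm_triangle_ineq4 abs_of_nonneg zero_le_power2)
    also have "\<dots> \<le> s m * norm2 ?b + s n * norm2 ?b" by (intro add_mono orth b)
    finally have "norm2 ?b * norm2 ?b \<le> (s n + s m) * norm2 ?b" by (simp add: power2_eq_square algebra_simps)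
    moreover have "norm2 ?b > 0" using False ub norm2_eq_0_iff[of ?b] norm2_nonneg[of ?b] by (metis less_le right_minus_eq)
    ultimately show ?thesis by (simp add: ub)
  qed (use s[of n] s[of m] in simp)
  define \<phi> where "\<phi> = (\<lambda>n. tau_left (adj (u n)))"
  have "Cauchy \<phi>"
  proof (rule metric_CauchyI)
    fix \<epsilon> :: real assume "\<epsilon> > 0"
    then obtain N where N: "\<And>n. n \<ge> N \<Longrightarrow> s n < \<epsilon> / 2"
      using s0 s(1) by (auto simp: LIMSEQ_def dist_norm dest!: spec[of _ "\<epsilon> / 2"]) (metis abs_of_pos)
    have "dist (\<phi> m) (\<phi> n) < \<epsilon>" if "m \<ge> N" "n \<ge> N" for m n
    proof -
      have "dist (\<phi> m) (\<phi> n) \<le> norm2 (u m - u n)"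
        using norm_tau_left_le[of "adj (u m) - adj (u n)"]
        by (simp add: \<phi>_def dist_norm tau_left_diff[symmetric]) (simp flip: adj_diff)
      then show ?thesis using cau[of m n] N[OF that(1)] N[OF that(2)] by linarith
    qed
    then show "\<exists>M. \<forall>m\<ge>M. \<forall>n\<ge>M. dist (\<phi> m) (\<phi> n) < \<epsilon>" by blast
  qed
  then obtain \<psi> where \<psi>: "\<phi> \<longlonglongrightarrow> \<psi>" using Cauchy_convergent convergent_def by blast
  have "\<phi> n \<in> P" for n by (simp add: \<phi>_def tau_left_mem)
  then have \<psi>P: "\<psi> \<in> P" using P_closed \<psi> closed_sequentially by blast
  have \<psi>x: "(\<lambda>n. \<tau> (adj (u n) * x)) \<longlonglongrightarrow> blinfun_apply \<psi> x" for x
    using blinfun.tendsto[OF \<psi> tendsto_const[of x]] by (simp add: \<phi>_def)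
  define M where "M = sqrt (D + 1)"
  have M: "norm2 (u n) \<le> M" "M > 0" for n
  proof -
    have "(s n)\<^sup>2 \<le> 1" using s[of n] by (simp add: power_le_one)
    then have "(norm2 (u n))\<^sup>2 \<le> D + 1" using a(2)[of n] by (simp add: u_def)
    then show "norm2 (u n) \<le> M" unfolding M_def by (rule real_le_rsqrt)
    show "M > 0" using D0 by (simp add: M_def)
  qed
  have "blinfun_apply \<psi> x = 0" if x: "x \<in> l2_closure A" for x
  proof -
    have le: "cmod (blinfun_apply \<psi> x) \<le> M * norm2 (x - b)" if b: "b \<in> A" for b
    proof (rule LIMSEQ_le)
      show "(\<lambda>n. cmod (\<tau> (adj (u n) * x))) \<longlonglongrightarrow> cmod (blinfun_apply \<psi> x)"
        by (rule tendsto_norm[OF \<psi>x])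
      show "(\<lambda>n. M * norm2 (x - b) + s n * norm2 b) \<longlonglongrightarrow> M * norm2 (x - b)"
        using tendsto_add[OF tendsto_const tendsto_mult_left_zero[OF s0]] by simp
      have "cmod (\<tau> (adj (u n) * x)) \<le> M * norm2 (x - b) + s n * norm2 b" for n
      proof -
        have "\<tau> (adj (u n) * x) = \<tau> (adj (u n) * (x - b)) + \<tau> (adj (u n) * b)"
          by (simp add: right_diff_distrib tau_diff)
        then have "cmod (\<tau> (adj (u n) * x)) \<le> cmod (\<tau> (adj (u n) * (x - b))) + cmod (\<tau> (adj (u n) * b))"
          by (metis norm_triangle_ineq)
        also have "\<dots> \<le> norm2 (u n) * norm2 (x - b) + s n * norm2 b"
          by (intro add_mono Cauchy_Schwarz orth b)
        also have "\<dots> \<le> M * norm2 (x - b) + s n * norm2 b"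
          using M(1) by (intro add_mono mult_right_mono) auto
        finally show ?thesis .
      qed
      then show "\<exists>N. \<forall>n\<ge>N. cmod (\<tau> (adj (u n) * x)) \<le> M * norm2 (x - b) + s n * norm2 b" by blast
    qed
    show ?thesis
    proof (rule ccontr)
      assume "blinfun_apply \<psi> x \<noteq> 0"
      then have "0 < cmod (blinfun_apply \<psi> x) / M" using M(2) by simp
      then obtain b where "b \<in> A" "norm2 (x - b) < cmod (blinfun_apply \<psi> x) / M"
        using x unfolding l2_closure_def by blast
      then show False using le[of b] M(2) by (simp add: field_simps)
    qed
  qed
  moreover have "blinfun_apply \<psi> x0 \<noteq> 0"
  proof
    assume "blinfun_apply \<psi> x0 = 0"
    then have "(\<lambda>n. \<tau> (adj (u n) * x0)) \<longlonglongrightarrow> 0" using \<psi>x[of x0] by simp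
    \<comment> \<open>Here the L^2 bound for a n enters. Consequently \<psi> at x0 is the limit of
      \<tau>(\<open>adj (u n) * u n\<close>), which is at least the squared distance D.\<close>
    moreover have "(\<lambda>n. \<tau> (adj (u n) * a n)) \<longlonglongrightarrow> 0"
    proof (rule Lim_null_comparison)
      have "norm2 (a n) \<le> norm2 x0 + M" for n
        using norm2_diff_le[of x0 "u n"] M(1)[of n] by (simp add: u_def)
      then have "cmod (\<tau> (adj (u n) * a n)) \<le> s n * (norm2 x0 + M)" for n
        using orth[OF a(1)[of n], of n] mult_left_mono[of "norm2 (a n)" "norm2 x0 + M" "s n"] s[of n]
        by (meson less_imp_le order_trans)
      then show "eventually (\<lambda>n. norm (\<tau> (adj (u n) * a n)) \<le> s n * (norm2 x0 + M)) sequentially" by simp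
      show "(\<lambda>n. s n * (norm2 x0 + M)) \<longlonglongrightarrow> 0" using tendsto_mult_left_zero[OF s0] .
    qed
    ultimately have "(\<lambda>n. \<tau> (adj (u n) * x0) - \<tau> (adj (u n) * a n)) \<longlonglongrightarrow> 0 - 0" by (rule tendsto_diff)
    then have "(\<lambda>n. cmod (\<tau> (adj (u n) * u n))) \<longlonglongrightarrow> 0"
      using tendsto_norm_zero by (fastforce simp: u_def right_diff_distrib tau_diff)
    moreover have "D \<le> cmod (\<tau> (adj (u n) * u n))" for n
      using D[OF a(1)[of n]] by (simp add: tau_adj_mult_self u_def del: of_real_power)
    ultimately have "D \<le> 0" by (intro LIMSEQ_le_const) auto
    then show False using D0 by simp
  qed
  ultimately show ?thesis using \<psi>P by blast
qed

text \<open>It confines the generated W*-algebra to the L^2-closure, so that orthogonality to A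
  extends to everything A generates.\<close>

theorem wstar_subalgebra_l2_closure:
  assumes "subalgebra A" "\<And>a. a \<in> A \<Longrightarrow> adj a \<in> A"
  shows "wstar_subalgebra P (l2_closure A)"
  unfolding wstar_subalgebra_def
  using l2_closure_subalgebra[OF assms(1)] l2_closure_adj[OF assms(2)]
    closedin_weak_star_if_separated[OF l2_closure_separated[OF assms(1)]] by blast

end

section \<open>The subordination map\<close>

text \<open>Used for both expectations: onto B, and onto the W*-algebra generated by B and
  U.\<close>

locale trace_expectation = trace_state \<tau>
  for \<tau> :: "'a::cstar_algebra \<Rightarrow> complex" +
  fixes B :: "'a set" and E :: "'a \<Rightarrow> 'a"
  assumes B: "closed_star_subalgebra B" and E: "trace_cond_exp \<tau> B E"
begin

lemma B_subalgebra: "subalgebra B" and B_adj: "b \<in> B \<Longrightarrow> adj b \<in> B" and B_closed: "closed B"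
  using B by (auto simp: closed_star_subalgebra_def)

lemma E_add: "E (x + y) = E x + E y"
  and E_scaleC: "E (c *\<^sub>C x) = c *\<^sub>C E x"
  and E_mem: "E x \<in> B"
  and E_id: "b \<in> B \<Longrightarrow> E b = b"
  and E_bimodule: "b \<in> B \<Longrightarrow> b' \<in> B \<Longrightarrow> E (b * x * b') = b * E x * b'"
  and tau_E: "\<tau> (E x) = \<tau> x"
  using E unfolding trace_cond_exp_def by blast+

lemma E_0 [simp]: "E 0 = 0"
  using E_scaleC[of 0 0] by simp

lemma E_diff: "E (x - y) = E x - E y"
  using E_add[of x "- y"] E_scaleC[of "-1" y] by simp

lemma E_E [simp]: "E (E x) = E x"
  by (rule E_id[OF E_mem])

lemma E_left: "b \<in> B \<Longrightarrow> E (b * x) = b * E x"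
  using E_bimodule[of b 1 x] subalgebra_one[OF B_subalgebra] by simp

lemma E_right: "b \<in> B \<Longrightarrow> E (x * b) = E x * b"
  using E_bimodule[of 1 b x] subalgebra_one[OF B_subalgebra] by simp

text \<open>E is the orthogonal projection in L^2: the module property and invariance of \<tau> make
  x - E x orthogonal to B.\<close>

lemma norm2_E_split: "(norm2 x)\<^sup>2 = (norm2 (E x))\<^sup>2 + (norm2 (x - E x))\<^sup>2"
proof -
  have "\<tau> (adj (E x) * (x - E x)) = \<tau> (E (adj (E x) * (x - E x)))" by (simp add: tau_E)
  also have "\<dots> = 0" by (simp add: E_left B_adj E_mem E_diff)
  finally show ?thesis using norm2_pythagoras[of "E x" "x - E x"] by simp
qed

lemma norm2_E_le: "norm2 (E x) \<le> norm2 x"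
  and norm2_diff_E_le: "norm2 (x - E x) \<le> norm2 x"
  by (rule power2_le_imp_le; simp add: norm2_E_split[of x])+

text \<open>Right multiplication by B commutes with E, and the norm of an element of B is seen on B
  alone. The bound c may be much smaller than \<open>norm x\<close>.\<close>

lemma norm_E_le_if_norm2_le:
  assumes "0 \<le> c" "\<And>y. y \<in> B \<Longrightarrow> norm2 (x * y) \<le> c * norm2 y"
  shows "norm (E x) \<le> c"
proof (rule norm_le_if_norm2_le[OF B E_mem assms(1)])
  show "norm2 (E x * y) \<le> c * norm2 y" if "y \<in> B" for y
    using norm2_E_le[of "x * y"] assms(2)[OF that] by (simp add: E_right[OF that])
qed

end

text \<open>Two formal derivatives of the geometric series have coefficients (n + 1)(n + 2). The
  quadratic weight is what second-order remainders of words require.\<close>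

lemma summable_square_times_power:
  assumes "0 \<le> r" "r < (1::real)" shows "summable (\<lambda>n. (real (Suc n))\<^sup>2 * r ^ n)"
proof -
  have 0: "summable (\<lambda>n. (\<lambda>n. 1) n * x ^ n)" if "norm x < 1" for x :: real
    using that by (simp add: summable_geometric)
  have 1: "summable (\<lambda>n. diffs (\<lambda>n. 1) n * x ^ n)" if "norm x < 1" for x :: real
    by (rule termdiff_converges[OF that 0])
  have "summable (\<lambda>n. diffs (diffs (\<lambda>n. 1)) n * r ^ n)"
    by (rule termdiff_converges[OF _ 1]) (use assms in auto)
  then show ?thesis
    by (rule summable_comparison_test'[where N = 0])
      (use assms in \<open>auto simp: diffs_def power2_eq_square intro!: mult_right_mono\<close>)
qed

locale unitary_pair = trace_expectation \<tau> B E
  for \<tau> :: "'a::cstar_algebra \<Rightarrow> complex" and B E +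
  fixes U V :: 'a
  assumes U: "unitary U" and V: "unitary V"
begin

text \<open>
  With \<open>Q = 1 - E\<close>, \<open>word b n\<close> is \<open>(U Q V b)\<^sup>n 1\<close>, and \<open>cumulant b n\<close> is the \<open>B\<close>-valued Boolean
  cumulant of the word \<open>V b, U, V b, \<dots>, U, V b\<close> with \<open>n + 1\<close> factors \<open>V b\<close>.
\<close>
fun word :: "'a \<Rightarrow> nat \<Rightarrow> 'a" where
  "word b 0 = 1"
| "word b (Suc n) = U * (V * b * word b n - E (V * b * word b n))"

definition cumulant :: "'a \<Rightarrow> nat \<Rightarrow> 'a" where
  "cumulant b n = E (V * b * word b n)"

fun word_deriv :: "'a \<Rightarrow> 'a \<Rightarrow> nat \<Rightarrow> 'a" where
  "word_deriv b h 0 = 0"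
| "word_deriv b h (Suc n) = U * (V * (h * word b n + b * word_deriv b h n) - E (V * (h * word b n + b * word_deriv b h n)))"

definition cumulant_deriv :: "'a \<Rightarrow> 'a \<Rightarrow> nat \<Rightarrow> 'a" where
  "cumulant_deriv b h n = E (V * (h * word b n + b * word_deriv b h n))"

definition subordination :: "'a \<Rightarrow> 'a" where
  "subordination b = (\<Sum>n. cumulant b n)"

definition subordination_deriv :: "'a \<Rightarrow> 'a \<Rightarrow> 'a" where
  "subordination_deriv b h = (\<Sum>n. cumulant_deriv b h n)"

lemma norm2_UQV_le:
  assumes "y \<in> B" shows "norm2 (U * (V * w - E (V * w)) * y) \<le> norm2 (w * y)"
proof -
  have "U * (V * w - E (V * w)) * y = U * (V * (w * y) - E (V * (w * y)))"
    using E_right[OF assms, of "V * w"] by (simp add: algebra_simps)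
  then show ?thesis
    using norm2_unitary_mult[OF U] norm2_unitary_mult[OF V] norm2_diff_E_le[of "V * (w * y)"] by simp
qed

lemma norm_EV_le:
  assumes "0 \<le> c" "\<And>y. y \<in> B \<Longrightarrow> norm2 (w * y) \<le> c * norm2 y"
  shows "norm (E (V * w)) \<le> c"
  using assms norm2_unitary_mult[OF V] by (intro norm_E_le_if_norm2_le) (auto simp: mult.assoc)

text \<open>The product-rule step common to the estimates of derivatives, differences and remainders
  of words.\<close>

lemma norm2_mult_add_le:
  assumes "norm a \<le> \<alpha>" "norm2 (x * y) \<le> s * norm2 y" "norm c \<le> \<gamma>" "norm2 (z * y) \<le> t * norm2 y"
    "0 \<le> s" "0 \<le> t"
  shows "norm2 ((a * x + c * z) * y) \<le> (\<alpha> * s + \<gamma> * t) * norm2 y"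
proof -
  have "norm2 ((a * x + c * z) * y) \<le> norm2 (a * (x * y)) + norm2 (c * (z * y))"
    using norm2_triangle[of "a * (x * y)" "c * (z * y)"] by (simp add: algebra_simps)
  also have "\<dots> \<le> norm a * norm2 (x * y) + norm c * norm2 (z * y)"
    by (intro add_mono norm2_mult_left)
  also have "\<dots> \<le> \<alpha> * (s * norm2 y) + \<gamma> * (t * norm2 y)"
    using assms order_trans[OF norm_ge_zero assms(1)] order_trans[OF norm_ge_zero assms(3)]
    by (intro add_mono mult_mono) auto
  finally show ?thesis by (simp add: algebra_simps)
qed

lemma norm2_word_le:
  assumes b: "norm b \<le> r" and y: "y \<in> B"
  shows "norm2 (word b n * y) \<le> r ^ n * norm2 y"
proof (induction n)
  case (Suc n)
  have r: "0 \<le> r" using b norm_ge_zero order_trans by blast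
  have "norm2 (word b (Suc n) * y) \<le> norm2 (b * word b n * y)"
    using norm2_UQV_le[OF y, of "b * word b n"] by (simp add: mult.assoc)
  also have "\<dots> \<le> norm b * norm2 (word b n * y)"
    using norm2_mult_left[of b "word b n * y"] by (simp add: mult.assoc)
  also have "\<dots> \<le> r * (r ^ n * norm2 y)" using b r Suc by (intro mult_mono) auto
  finally show ?case by (simp add: mult.assoc)
qed simp

lemma norm_cumulant_le:
  assumes b: "norm b \<le> r" shows "norm (cumulant b n) \<le> r ^ Suc n"
  unfolding cumulant_def mult.assoc
proof (rule norm_EV_le)
  have r: "0 \<le> r" using b norm_ge_zero order_trans by blast
  then show "0 \<le> r ^ Suc n" by simp
  fix y assume y: "y \<in> B"
  have "norm2 (b * word b n * y) \<le> norm b * norm2 (word b n * y)"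
    using norm2_mult_left[of b "word b n * y"] by (simp add: mult.assoc)
  also have "\<dots> \<le> r * (r ^ n * norm2 y)" using b r norm2_word_le[OF b y] by (intro mult_mono) auto
  finally show "norm2 (b * word b n * y) \<le> r ^ Suc n * norm2 y" by (simp add: mult.assoc)
qed

lemma summable_cumulant:
  assumes "norm b < 1" shows "summable (cumulant b)"
proof (rule summable_comparison_test'[where N = 0 and g = "\<lambda>n. norm b ^ Suc n"])
  show "summable (\<lambda>n. norm b ^ Suc n)" using assms by (simp add: summable_geometric summable_mult)
qed (rule norm_cumulant_le, simp)

lemma subordination_sums: "norm b < 1 \<Longrightarrow> cumulant b sums subordination b"
  unfolding subordination_def by (rule summable_sums[OF summable_cumulant])

lemma sum_cumulant_tendsto: "norm b < 1 \<Longrightarrow> (\<lambda>N. \<Sum>n<N. cumulant b n) \<longlonglongrightarrow> subordination b"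
  using subordination_sums by (simp add: sums_def)

lemma subordination_mem:
  assumes "norm b < 1" shows "subordination b \<in> B"
  by (rule closed_sums_mem[OF B_closed _ subordination_sums[OF assms]])
    (auto simp: cumulant_def intro!: subalgebra_sum[OF B_subalgebra] E_mem)

subsection \<open>The norm estimate\<close>

text \<open>
  Let \<open>\<xi> = \<Sum>n. word b n\<close>, a series that converges in \<open>L\<^sup>2\<close>. Then \<open>\<xi> - 1 = U Q V b \<xi>\<close> is orthogonal
  to \<open>B\<close> and \<open>F(b) = E (V b \<xi>)\<close>, so
  \<open>\<parallel>F(b) y\<parallel>\<^sub>2\<^sup>2 = \<parallel>V b \<xi> y\<parallel>\<^sub>2\<^sup>2 - \<parallel>Q V b \<xi> y\<parallel>\<^sub>2\<^sup>2 \<le> \<parallel>b\<parallel>\<^sup>2 \<parallel>\<xi> y\<parallel>\<^sub>2\<^sup>2 - (\<parallel>\<xi> y\<parallel>\<^sub>2\<^sup>2 - \<parallel>y\<parallel>\<^sub>2\<^sup>2)\<close>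
  for \<open>y\<close> in \<open>B\<close>.
\<close>
lemma norm_subordination_le:
  assumes b: "norm b < 1" and centred: "\<And>n. E (word b (Suc n)) = 0"
  shows "norm (subordination b) \<le> norm b"
proof (rule norm_le_if_norm2_le[OF B subordination_mem[OF b]])
  fix y assume y: "y \<in> B"
  let ?r = "norm b"
  define X where "X = (\<lambda>N. \<Sum>n<N. word b n * y)"
  define x where "x = (\<lambda>N. norm2 (X N))"
  define W where "W = (\<lambda>N. E (V * (b * X N)))"
  have X_Suc: "X (Suc N) = y + U * (V * (b * X N) - W N)" for N
  proof (induction N)
    case (Suc N)
    have X': "X (Suc N) = X N + word b N * y" for N by (simp add: X_def)
    have "X (Suc (Suc N)) = X (Suc N) + word b (Suc N) * y" by (rule X')
    also have "word b (Suc N) * y = U * (V * (b * (word b N * y)) - E (V * (b * (word b N * y))))"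
      using E_right[OF y, of "V * (b * word b N)"] by (simp add: algebra_simps)
    finally have eq: "X (Suc (Suc N)) = y + U * (V * (b * X N) - W N)
        + U * (V * (b * (word b N * y)) - E (V * (b * (word b N * y))))"
      using Suc by simp
    show ?case by (simp only: eq W_def X'[of N]) (simp add: algebra_simps E_add)
  qed (simp add: X_def W_def)
  have W: "W N = (\<Sum>n<N. cumulant b n) * y" for N
  proof (induction N)
    case (Suc N)
    have "X (Suc N) = X N + word b N * y" by (simp add: X_def)
    moreover have "E (V * (b * (word b N * y))) = cumulant b N * y"
      unfolding cumulant_def E_right[OF y, symmetric] by (simp add: mult.assoc)
    ultimately show ?case using Suc by (simp add: W_def distrib_left distrib_right E_add)
  qed (simp add: W_def X_def)
  have orth: "\<tau> (adj y * (X (Suc N) - y)) = 0" for N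
  proof -
    have "X (Suc N) - y = (\<Sum>n<N. word b (Suc n) * y)"
      unfolding X_def by (subst sum.lessThan_Suc_shift) simp
    moreover have "E (\<Sum>n<N. word b (Suc n) * y) = 0"
      by (induction N) (auto simp: E_add E_right[OF y] centred simp del: word.simps)
    ultimately have "E (adj y * (X (Suc N) - y)) = 0" using y by (simp add: E_left B_adj)
    then show ?thesis using tau_E[of "adj y * (X (Suc N) - y)"] by simp
  qed
  have xsq: "(x (Suc N))\<^sup>2 = (norm2 y)\<^sup>2 + (norm2 (X (Suc N) - y))\<^sup>2" for N
    using norm2_pythagoras[OF orth[of N]] by (simp add: x_def)
  \<comment> \<open>Pythagoras for E and for y, combined. For partial sums the indices N and N + 1
    do not match, so the estimate closes in the limit only.\<close>
  have main: "(norm2 (W N))\<^sup>2 \<le> ?r\<^sup>2 * (x N)\<^sup>2 - ((x (Suc N))\<^sup>2 - (norm2 y)\<^sup>2)" for N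
  proof -
    have "(norm2 (W N))\<^sup>2 = (norm2 (b * X N))\<^sup>2 - (norm2 (X (Suc N) - y))\<^sup>2"
      using norm2_E_split[of "V * (b * X N)"] norm2_unitary_mult[OF V, of "b * X N"]
      by (simp add: X_Suc norm2_unitary_mult[OF U] W_def)
    also have "(norm2 (b * X N))\<^sup>2 \<le> (?r * x N)\<^sup>2"
      unfolding x_def by (intro power_mono norm2_mult_left) simp
    finally show ?thesis using xsq[of N] by (simp add: power_mult_distrib)
  qed
  \<comment> \<open>No limit vector is needed, only a common limit s of the norms on both sides of
    \<open>main\<close>.\<close>
  have "summable (\<lambda>N. x (Suc N) - x N)"
  proof (rule summable_comparison_test'[where N = 0 and g = "\<lambda>N. ?r ^ N * norm2 y"])
    show "summable (\<lambda>N. ?r ^ N * norm2 y)" using b by (intro summable_mult2 summable_geometric) simp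
    show "norm (x (Suc N) - x N) \<le> ?r ^ N * norm2 y" for N
      using norm2_diff_abs[of "X (Suc N)" "X N"] norm2_word_le[OF order_refl y, of b N] by (simp add: x_def X_def)
  qed
  then have "convergent (\<lambda>N. \<Sum>n<N. x (Suc n) - x n)" by (simp add: summable_iff_convergent)
  then have "convergent (\<lambda>N. x N - x 0)" by (simp add: sum_lessThan_telescope)
  then obtain s where "(\<lambda>N. x N - x 0) \<longlonglongrightarrow> s" by (auto simp: convergent_def)
  then have s: "x \<longlonglongrightarrow> s" by (simp add: x_def X_def)
  have s': "(\<lambda>N. x (Suc N)) \<longlonglongrightarrow> s" using s by (rule LIMSEQ_Suc)
  have "(norm2 y)\<^sup>2 \<le> (x (Suc N))\<^sup>2" for N using xsq[of N] by simp
  then have ys: "(norm2 y)\<^sup>2 \<le> s\<^sup>2" by (intro LIMSEQ_le_const[OF tendsto_power[OF s']]) auto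
  have "(\<lambda>N. norm2 (W N - subordination b * y)) \<longlonglongrightarrow> 0"
  proof (rule Lim_null_comparison)
    show "eventually (\<lambda>N. norm (norm2 (W N - subordination b * y))
        \<le> norm ((\<Sum>n<N. cumulant b n) - subordination b) * norm2 y) sequentially"
      unfolding W left_diff_distrib[symmetric] by (simp add: norm2_mult_left)
    show "(\<lambda>N. norm ((\<Sum>n<N. cumulant b n) - subordination b) * norm2 y) \<longlonglongrightarrow> 0"
      using tendsto_mult_left_zero[OF tendsto_norm_zero[OF Lim_null[THEN iffD1, OF sum_cumulant_tendsto[OF b]]]] .
  qed
  then have "(\<lambda>N. norm2 (W N) - norm2 (subordination b * y)) \<longlonglongrightarrow> 0"
    by (rule Lim_null_comparison[rotated]) (simp add: norm2_diff_abs)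
  then have "(\<lambda>N. norm2 (W N)) \<longlonglongrightarrow> norm2 (subordination b * y)" by (simp add: Lim_null[symmetric])
  then have "(\<lambda>N. (norm2 (W N))\<^sup>2) \<longlonglongrightarrow> (norm2 (subordination b * y))\<^sup>2" by (rule tendsto_power)
  moreover have "(\<lambda>N. ?r\<^sup>2 * (x N)\<^sup>2 - ((x (Suc N))\<^sup>2 - (norm2 y)\<^sup>2)) \<longlonglongrightarrow> ?r\<^sup>2 * s\<^sup>2 - (s\<^sup>2 - (norm2 y)\<^sup>2)"
    by (intro tendsto_intros s s')
  ultimately have "(norm2 (subordination b * y))\<^sup>2 \<le> ?r\<^sup>2 * s\<^sup>2 - (s\<^sup>2 - (norm2 y)\<^sup>2)"
    using main by (intro LIMSEQ_le) auto
  also have "\<dots> \<le> ?r\<^sup>2 * (norm2 y)\<^sup>2"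
  proof -
    have "?r\<^sup>2 \<le> 1" using b by (simp add: power_le_one)
    then have "0 \<le> (1 - ?r\<^sup>2) * (s\<^sup>2 - (norm2 y)\<^sup>2)" using ys by (intro mult_nonneg_nonneg) auto
    then show ?thesis by (simp add: algebra_simps)
  qed
  finally have "(norm2 (subordination b * y))\<^sup>2 \<le> (?r * norm2 y)\<^sup>2" by (simp add: power_mult_distrib)
  then show "norm2 (subordination b * y) \<le> ?r * norm2 y" by (rule power2_le_imp_le) simp
qed simp

subsection \<open>Holomorphy\<close>

lemma word_deriv_add: "word_deriv b (h + k) n = word_deriv b h n + word_deriv b k n"
  by (induction n) (simp_all add: algebra_simps E_add)

lemma word_deriv_scaleC: "word_deriv b (c *\<^sub>C h) n = c *\<^sub>C word_deriv b h n"
proof (induction n)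
  case (Suc n)
  have "V * (c *\<^sub>C h * word b n + b * word_deriv b (c *\<^sub>C h) n) = c *\<^sub>C (V * (h * word b n + b * word_deriv b h n))"
    unfolding Suc by (simp add: mult_scaleC_left mult_scaleC_right flip: scaleC_add_right)
  then show ?case by (simp only: word_deriv.simps E_scaleC scaleC_diff_right[symmetric] mult_scaleC_right)
qed simp

lemma cumulant_deriv_add: "cumulant_deriv b (h + k) n = cumulant_deriv b h n + cumulant_deriv b k n"
  by (simp add: cumulant_deriv_def word_deriv_add algebra_simps E_add)

lemma cumulant_deriv_scaleC: "cumulant_deriv b (c *\<^sub>C h) n = c *\<^sub>C cumulant_deriv b h n"
  unfolding cumulant_deriv_def word_deriv_scaleC E_scaleC[symmetric]
  by (simp add: mult_scaleC_left mult_scaleC_right flip: scaleC_add_right)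

context
  fixes r :: real and b :: 'a
  assumes r: "0 < r" "r < 1" and b: "norm b \<le> r"
begin

text \<open>The factor is n r^(n-1), written with a division so that n = 0 needs no truncated
  exponent. The bound r is kept apart from \<open>norm b\<close>: it is positive even for b = 0 and
  will also bound the points near b.\<close>

lemma norm2_word_deriv_le:
  assumes y: "y \<in> B"
  shows "norm2 (word_deriv b h n * y) \<le> (real n * r ^ n / r * norm h) * norm2 y"
proof (induction n)
  case (Suc n)
  have "norm2 (word_deriv b h (Suc n) * y) \<le> norm2 ((h * word b n + b * word_deriv b h n) * y)"
    using norm2_UQV_le[OF y] by simp
  also have "\<dots> \<le> (norm h * r ^ n + r * (real n * r ^ n / r * norm h)) * norm2 y"
    by (rule norm2_mult_add_le[OF order_refl norm2_word_le[OF b y] b Suc]) (use r in auto)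
  also have "norm h * r ^ n + r * (real n * r ^ n / r * norm h) = real (Suc n) * r ^ Suc n / r * norm h"
    using r by (simp add: field_simps)
  finally show ?case .
qed simp

lemma norm_cumulant_deriv_le: "norm (cumulant_deriv b h n) \<le> real (Suc n) * r ^ n * norm h"
  unfolding cumulant_deriv_def
proof (rule norm_EV_le)
  fix y assume y: "y \<in> B"
  have "norm2 ((h * word b n + b * word_deriv b h n) * y) \<le> (norm h * r ^ n + r * (real n * r ^ n / r * norm h)) * norm2 y"
    by (rule norm2_mult_add_le[OF order_refl norm2_word_le[OF b y] b norm2_word_deriv_le[OF y]]) (use r in auto)
  also have "norm h * r ^ n + r * (real n * r ^ n / r * norm h) = real (Suc n) * r ^ n * norm h"
    using r by (simp add: field_simps)
  finally show "norm2 ((h * word b n + b * word_deriv b h n) * y) \<le> real (Suc n) * r ^ n * norm h * norm2 y" .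
qed (use r in simp)

lemma summable_Suc_power: "summable (\<lambda>n. real (Suc n) * r ^ n)"
proof (rule summable_comparison_test'[where N = 0 and g = "\<lambda>n. (real (Suc n))\<^sup>2 * r ^ n"])
  show "summable (\<lambda>n. (real (Suc n))\<^sup>2 * r ^ n)" using r by (intro summable_square_times_power) auto
  show "norm (real (Suc n) * r ^ n) \<le> (real (Suc n))\<^sup>2 * r ^ n" for n
    using r by (auto simp: power2_eq_square intro!: mult_right_mono)
qed

lemma summable_cumulant_deriv: "summable (cumulant_deriv b h)"
  by (rule summable_comparison_test'[where N = 0, OF summable_mult2[OF summable_Suc_power]])
    (rule norm_cumulant_deriv_le)

lemma subordination_deriv_add:
  "subordination_deriv b (h + k) = subordination_deriv b h + subordination_deriv b k"
  unfolding subordination_deriv_def cumulant_deriv_add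
  by (rule suminf_add[symmetric]) (rule summable_cumulant_deriv)+

lemma bounded_linear_scaleC: "bounded_linear (\<lambda>x::'a. c *\<^sub>C x)"
  by (rule bounded_linear_intro[where K = "cmod c"])
    (simp_all add: scaleC_add_right scaleR_eq_scaleC scaleC_scaleC mult.commute norm_scaleC)

lemma subordination_deriv_scaleC: "subordination_deriv b (c *\<^sub>C h) = c *\<^sub>C subordination_deriv b h"
  unfolding subordination_deriv_def cumulant_deriv_scaleC
  by (rule bounded_linear.suminf[OF bounded_linear_scaleC, symmetric]) (rule summable_cumulant_deriv)

lemma subordination_deriv_mem: "subordination_deriv b h \<in> B"
  by (rule closed_sums_mem[OF B_closed _ summable_sums[OF summable_cumulant_deriv, folded subordination_deriv_def]])
    (auto simp: cumulant_deriv_def intro!: subalgebra_sum[OF B_subalgebra] E_mem)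

lemma norm_subordination_deriv_le: "norm (subordination_deriv b h) \<le> (\<Sum>n. real (Suc n) * r ^ n) * norm h"
proof -
  have "norm (subordination_deriv b h) \<le> (\<Sum>n. real (Suc n) * r ^ n * norm h)"
    unfolding subordination_deriv_def
    by (rule norm_suminf_le[OF norm_cumulant_deriv_le summable_mult2[OF summable_Suc_power]])
  then show ?thesis using suminf_mult2[OF summable_Suc_power] by simp
qed

context
  fixes x h :: 'a
  assumes x: "norm x \<le> r" and h: "h = x - b"
begin

lemma norm2_word_diff_le:
  assumes y: "y \<in> B"
  shows "norm2 ((word x n - word b n) * y) \<le> (real n * r ^ n / r * norm h) * norm2 y"
proof (induction n)
  case (Suc n)
  \<comment> \<open>The difference of the products x \<open>word x n\<close> and b
    \<open>word b n\<close>, telescoped so that the induction hypothesis applies to the second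
    summand.\<close>
  let ?w = "h * word x n + b * (word x n - word b n)"
  have "?w = x * word x n - b * word b n" by (simp add: h algebra_simps)
  then have "word x (Suc n) - word b (Suc n) = U * (V * ?w - E (V * ?w))"
    by (simp add: algebra_simps E_diff)
  then have "norm2 ((word x (Suc n) - word b (Suc n)) * y) \<le> norm2 (?w * y)"
    using norm2_UQV_le[OF y] by metis
  also have "\<dots> \<le> (norm h * r ^ n + r * (real n * r ^ n / r * norm h)) * norm2 y"
    by (rule norm2_mult_add_le[OF order_refl norm2_word_le[OF x y] b Suc]) (use r in auto)
  also have "norm h * r ^ n + r * (real n * r ^ n / r * norm h) = real (Suc n) * r ^ Suc n / r * norm h"
    using r by (simp add: field_simps)
  finally show ?case .
qed simp

text \<open>The remainder obeys the recursion of the words with h times the first-order difference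
  as source, which is of second order in h. The induction closes because n + n^2 \<le> (n +
  1)^2.\<close>

lemma norm2_word_remainder_le:
  assumes y: "y \<in> B"
  shows "norm2 ((word x n - word b n - word_deriv b h n) * y) \<le> ((real n)\<^sup>2 * r ^ n / r\<^sup>2 * (norm h)\<^sup>2) * norm2 y"
proof (induction n)
  case (Suc n)
  let ?w = "h * (word x n - word b n) + b * (word x n - word b n - word_deriv b h n)"
  have "?w = x * word x n - b * word b n - (h * word b n + b * word_deriv b h n)" by (simp add: h algebra_simps)
  then have "word x (Suc n) - word b (Suc n) - word_deriv b h (Suc n) = U * (V * ?w - E (V * ?w))"
    by (simp add: algebra_simps E_diff E_add)
  then have "norm2 ((word x (Suc n) - word b (Suc n) - word_deriv b h (Suc n)) * y) \<le> norm2 (?w * y)"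
    using norm2_UQV_le[OF y] by metis
  also have "\<dots> \<le> (norm h * (real n * r ^ n / r * norm h) + r * ((real n)\<^sup>2 * r ^ n / r\<^sup>2 * (norm h)\<^sup>2)) * norm2 y"
    by (rule norm2_mult_add_le[OF order_refl norm2_word_diff_le[OF y] b Suc]) (use r in auto)
  also have "\<dots> \<le> ((real (Suc n))\<^sup>2 * r ^ Suc n / r\<^sup>2 * (norm h)\<^sup>2) * norm2 y"
  proof (rule mult_right_mono)
    have "norm h * (real n * r ^ n / r * norm h) + r * ((real n)\<^sup>2 * r ^ n / r\<^sup>2 * (norm h)\<^sup>2)
        = (real n + (real n)\<^sup>2) * (r ^ Suc n / r\<^sup>2 * (norm h)\<^sup>2)"
      using r by (simp add: field_simps power2_eq_square)
    also have "\<dots> \<le> (real (Suc n))\<^sup>2 * (r ^ Suc n / r\<^sup>2 * (norm h)\<^sup>2)"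
      using r by (intro mult_right_mono) (auto simp: power2_eq_square algebra_simps)
    finally show "norm h * (real n * r ^ n / r * norm h) + r * ((real n)\<^sup>2 * r ^ n / r\<^sup>2 * (norm h)\<^sup>2)
        \<le> (real (Suc n))\<^sup>2 * r ^ Suc n / r\<^sup>2 * (norm h)\<^sup>2" by simp
  qed simp
  finally show ?case .
qed simp

lemma norm_cumulant_remainder_le:
  "norm (cumulant x n - cumulant b n - cumulant_deriv b h n) \<le> (real (Suc n))\<^sup>2 * r ^ n * (1 / r * (norm h)\<^sup>2)"
proof -
  let ?w = "h * (word x n - word b n) + b * (word x n - word b n - word_deriv b h n)"
  have "?w = x * word x n - b * word b n - (h * word b n + b * word_deriv b h n)" by (simp add: h algebra_simps)
  then have eq: "cumulant x n - cumulant b n - cumulant_deriv b h n = E (V * ?w)"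
    unfolding cumulant_def cumulant_deriv_def by (simp add: algebra_simps E_diff E_add)
  show ?thesis unfolding eq
  proof (rule norm_EV_le)
    fix y assume y: "y \<in> B"
    have "norm2 (?w * y) \<le> (norm h * (real n * r ^ n / r * norm h) + r * ((real n)\<^sup>2 * r ^ n / r\<^sup>2 * (norm h)\<^sup>2)) * norm2 y"
      by (rule norm2_mult_add_le[OF order_refl norm2_word_diff_le[OF y] b norm2_word_remainder_le[OF y]]) (use r in auto)
    also have "\<dots> \<le> ((real (Suc n))\<^sup>2 * r ^ n * (1 / r * (norm h)\<^sup>2)) * norm2 y"
    proof (rule mult_right_mono)
      have "norm h * (real n * r ^ n / r * norm h) + r * ((real n)\<^sup>2 * r ^ n / r\<^sup>2 * (norm h)\<^sup>2)
          = (real n + (real n)\<^sup>2) * (r ^ n * (1 / r * (norm h)\<^sup>2))"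
        using r by (simp add: field_simps power2_eq_square)
      also have "\<dots> \<le> (real (Suc n))\<^sup>2 * (r ^ n * (1 / r * (norm h)\<^sup>2))"
        using r by (intro mult_right_mono) (auto simp: power2_eq_square algebra_simps)
      finally show "norm h * (real n * r ^ n / r * norm h) + r * ((real n)\<^sup>2 * r ^ n / r\<^sup>2 * (norm h)\<^sup>2)
          \<le> (real (Suc n))\<^sup>2 * r ^ n * (1 / r * (norm h)\<^sup>2)" by simp
    qed simp
    finally show "norm2 (?w * y) \<le> (real (Suc n))\<^sup>2 * r ^ n * (1 / r * (norm h)\<^sup>2) * norm2 y" .
  qed (use r in simp)
qed

lemma norm_subordination_remainder_le:
  "norm (subordination x - subordination b - subordination_deriv b h)
    \<le> (\<Sum>n. (real (Suc n))\<^sup>2 * r ^ n) * (1 / r * (norm h)\<^sup>2)"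
proof -
  have s: "summable (\<lambda>n. (real (Suc n))\<^sup>2 * r ^ n)" using r by (intro summable_square_times_power) auto
  have "norm x < 1" "norm b < 1" using x b r by auto
  then have "(\<lambda>n. cumulant x n - cumulant b n - cumulant_deriv b h n)
      sums (subordination x - subordination b - subordination_deriv b h)"
    unfolding subordination_deriv_def
    by (intro sums_diff subordination_sums summable_sums[OF summable_cumulant_deriv])
  then have "subordination x - subordination b - subordination_deriv b h
      = (\<Sum>n. cumulant x n - cumulant b n - cumulant_deriv b h n)" by (simp add: sums_iff)
  also have "norm \<dots> \<le> (\<Sum>n. (real (Suc n))\<^sup>2 * r ^ n * (1 / r * (norm h)\<^sup>2))"
    by (rule norm_suminf_le[OF norm_cumulant_remainder_le summable_mult2[OF s]])
  also have "\<dots> = (\<Sum>n. (real (Suc n))\<^sup>2 * r ^ n) * (1 / r * (norm h)\<^sup>2)" by (rule suminf_mult2[OF s, symmetric])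
  finally show ?thesis .
qed

end

end

lemma subordination_holomorphic: "holomorphic_map_on B (unit_ball_of B) subordination"
  unfolding holomorphic_map_on_def
proof (intro ballI conjI)
  fix b assume bB: "b \<in> unit_ball_of B"
  then have b1: "norm b < 1" by (simp add: unit_ball_of_def)
  then show "subordination b \<in> B" by (rule subordination_mem)
  \<comment> \<open>The midpoint between \<open>norm b\<close> and 1 leaves a neighbourhood of b on
    which the series have a common majorant.\<close>
  define r where "r = (1 + norm b) / 2"
  have r: "0 < r" "r < 1" and br: "norm b < r" using b1 norm_ge_zero[of b] by (auto simp: r_def add_pos_nonneg)
  then have b: "norm b \<le> r" by simp
  define C where "C = (\<Sum>n. (real (Suc n))\<^sup>2 * r ^ n) * (1 / r)"
  let ?D = "subordination_deriv b"
  have "((\<lambda>x. norm (subordination x - subordination b - ?D (x - b)) / norm (x - b)) \<longlongrightarrow> 0) (at b within unit_ball_of B)"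
  proof (rule Lim_null_comparison)
    have "((\<lambda>x. norm (x - b)) \<longlongrightarrow> 0) (at b within unit_ball_of B)"
      using tendsto_norm_zero[OF LIM_zero[OF tendsto_ident_at[of b "unit_ball_of B"]]] .
    then show "((\<lambda>x. C * norm (x - b)) \<longlongrightarrow> 0) (at b within unit_ball_of B)" by (rule tendsto_mult_right_zero)
    have "eventually (\<lambda>x. norm x < r) (at b within unit_ball_of B)"
      using order_tendstoD(2)[OF tendsto_norm[OF tendsto_ident_at] br] .
    then show "eventually (\<lambda>x. norm (norm (subordination x - subordination b - ?D (x - b)) / norm (x - b))
        \<le> C * norm (x - b)) (at b within unit_ball_of B)"
    proof eventually_elim
      case (elim x)
      have "norm (subordination x - subordination b - ?D (x - b)) \<le> C * (norm (x - b))\<^sup>2"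
        using norm_subordination_remainder_le[OF r b less_imp_le[OF elim] refl] by (simp add: C_def mult.assoc)
      \<comment> \<open>At x = b the quotient is a division by 0, which is 0.\<close>
      then show ?case by (cases "x = b") (simp_all add: divide_le_eq power2_eq_square mult.assoc)
    qed
  qed
  moreover have "\<forall>h\<in>B. norm (?D h) \<le> (\<Sum>n. real (Suc n) * r ^ n) * norm h"
    using norm_subordination_deriv_le[OF r b] by blast
  ultimately show "\<exists>D. (\<forall>h\<in>B. D h \<in> B) \<and> (\<forall>h\<in>B. \<forall>k\<in>B. D (h + k) = D h + D k) \<and>
            (\<forall>c. \<forall>h\<in>B. D (c *\<^sub>C h) = c *\<^sub>C D h) \<and> (\<exists>K. \<forall>h\<in>B. norm (D h) \<le> K * norm h) \<and>
            ((\<lambda>x. norm (subordination x - subordination b - D (x - b)) / norm (x - b)) \<longlongrightarrow> 0) (at b within unit_ball_of B)"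
    using subordination_deriv_mem[OF r b] subordination_deriv_add[OF r b] subordination_deriv_scaleC[OF r b]
    by (intro exI[of _ ?D]) blast
qed

end

section \<open>Freeness\<close>

lemma neumann_inverse:
  fixes w :: "'a::{real_normed_algebra_1,banach}"
  assumes "norm w < 1"
  obtains z where "(1 - w) * z = 1" "z * (1 - w) = 1"
proof -
  have s: "(\<lambda>n. w ^ n) sums (\<Sum>n. w ^ n)"
    by (rule summable_sums[OF complete_algebra_summable_geometric[OF assms]])
  define z where "z = (\<Sum>n. w ^ n)"
  have "(\<lambda>n. w ^ Suc n) sums (z - 1)"
    using s sums_Suc_iff[of "\<lambda>n. w ^ n" "z - 1"] by (simp add: z_def)
  moreover have "(\<lambda>n. w ^ Suc n) sums (w * z)" using sums_mult[OF s, of w] by (simp add: z_def)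
  moreover have "(\<lambda>n. w ^ Suc n) sums (z * w)" using sums_mult2[OF s, of w] by (simp add: z_def power_commutes)
  ultimately have "w * z = z - 1" "z * w = z - 1" by (simp_all add: sums_unique2)
  then show ?thesis by (intro that[of z]) (simp_all add: algebra_simps)
qed

lemma alg_inv_eqI: "x * y = 1 \<Longrightarrow> y * x = 1 \<Longrightarrow> alg_inv x = (y::'a::monoid_mult)"
  unfolding alg_inv_def by (rule the_equality) (auto, metis mult.assoc mult.left_neutral mult.right_neutral)

locale free_unitary_pair = unitary_pair \<tau> B E U V
  for \<tau> :: "'a::cstar_algebra \<Rightarrow> complex" and B E U V +
  fixes A1 A2 :: "'a set"
  assumes free: "free_with_amalgamation B E (\<lambda>i::bool. if i then A1 else A2)"
    and U_mem: "U \<in> A1" and V_mem: "V \<in> A2"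
begin

lemma A1: "subalgebra A1" "B \<subseteq> A1" and A2: "subalgebra A2" "B \<subseteq> A2"
proof -
  have "subalgebra (if i then A1 else A2) \<and> B \<subseteq> (if i then A1 else A2)" for i :: bool
    using free unfolding free_with_amalgamation_def by blast
  from this[of True] this[of False] show "subalgebra A1" "B \<subseteq> A1" "subalgebra A2" "B \<subseteq> A2" by auto
qed

text \<open>Freeness for lists; p says whether the first factor is taken from \<open>A2\<close> or
  from \<open>A1\<close>.\<close>

lemma E_alternating:
  assumes "L \<noteq> []"
    and mem: "\<And>j. j < length L \<Longrightarrow> L ! j \<in> (if even j = p then A2 else A1) \<and> E (L ! j) = 0"
  shows "E (prod_list L) = 0"
proof -
  have "1 \<le> n \<longrightarrow> (\<forall>j<n. x j \<in> (if \<iota> j then A1 else A2) \<and> E (x j) = 0) \<longrightarrow>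
      (\<forall>j. Suc j < n \<longrightarrow> \<iota> j \<noteq> \<iota> (Suc j)) \<longrightarrow> E (prod_list (map x [0..<n])) = 0"
    for n :: nat and \<iota> :: "nat \<Rightarrow> bool" and x
    using free unfolding free_with_amalgamation_def by blast
  from this[of "length L" "\<lambda>j. L ! j" "\<lambda>j. even j \<noteq> p"]
  have "E (prod_list (map ((!) L) [0..<length L])) = 0"
  proof (rule mp[OF mp[OF mp]], goal_cases)
    case 1
    show ?case using assms(1) by (simp add: Suc_le_eq)
  next
    case 2
    have eq: "(if even j \<noteq> p then A1 else A2) = (if even j = p then A2 else A1)" for j by simp
    show ?case unfolding eq using mem by blast
  next
    case 3
    show ?case by auto
  qed
  then show ?thesis by (simp add: map_nth)
qed

text \<open>Alternating products of centred factors that begin and end in \<open>A2\<close>. Two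
  factors are added at a time, so the leftmost one is always from \<open>A2\<close>.\<close>

inductive_set odd_words :: "'a set" where
  base: "c \<in> A2 \<Longrightarrow> E c = 0 \<Longrightarrow> c \<in> odd_words"
| step: "c \<in> A2 \<Longrightarrow> E c = 0 \<Longrightarrow> a \<in> A1 \<Longrightarrow> E a = 0 \<Longrightarrow> y \<in> odd_words \<Longrightarrow> c * a * y \<in> odd_words"

lemma odd_words_list:
  assumes "y \<in> odd_words"
  shows "\<exists>L. L \<noteq> [] \<and> y = prod_list L \<and>
    (\<forall>j<length L. L ! j \<in> (if even j then A2 else A1) \<and> E (L ! j) = 0)"
  using assms
proof induction
  case (base c)
  then show ?case by (intro exI[of _ "[c]"]) auto
next
  case (step c a y)
  then obtain L where L: "y = prod_list L" "\<forall>j<length L. L ! j \<in> (if even j then A2 else A1) \<and> E (L ! j) = 0"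
    by blast
  have "(c # a # L) ! j \<in> (if even j then A2 else A1) \<and> E ((c # a # L) ! j) = 0"
    if "j < length (c # a # L)" for j
  proof (cases j)
    case 0
    then show ?thesis using step.hyps by simp
  next
    case (Suc i)
    then show ?thesis using step.hyps L(2) that by (cases i) auto
  qed
  then show ?case using L(1) by (intro exI[of _ "c # a # L"]) (auto simp: mult.assoc)
qed

text \<open>Centring a gives a longer alternating product, beginning in \<open>A1\<close>, and the
  term E a y, from which E a can be pulled out.\<close>

lemma E_A1_odd_word:
  assumes y: "y \<in> odd_words" and a: "a \<in> A1" shows "E (a * y) = 0"
proof -
  obtain L where L: "L \<noteq> []" "y = prod_list L"
    "\<And>j. j < length L \<Longrightarrow> L ! j \<in> (if even j then A2 else A1) \<and> E (L ! j) = 0"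
    using odd_words_list[OF y] by blast
  have Ey: "E y = 0" unfolding L(2) by (rule E_alternating[of L True]) (use L in auto)
  define a0 where "a0 = a - E a"
  have a0: "a0 \<in> A1" "E a0 = 0" using a A1 E_mem by (auto simp: a0_def E_diff intro: subalgebra_diff)
  have "E (prod_list (a0 # L)) = 0"
  proof (rule E_alternating[of _ False])
    fix j assume "j < length (a0 # L)"
    then show "(a0 # L) ! j \<in> (if even j = False then A2 else A1) \<and> E ((a0 # L) ! j) = 0"
      using a0 L(3) by (cases j) auto
  qed simp
  moreover have "a * y = prod_list (a0 # L) + E a * y" by (simp add: a0_def L(2) algebra_simps)
  ultimately show ?thesis using Ey by (simp add: E_add E_left E_mem)
qed

text \<open>The left \<open>A1\<close>-module spanned by the odd words; the coefficients from
  \<open>A1\<close> already provide the scalars. It is the orthogonal part in which all words after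
  the first are shown to lie.\<close>

inductive_set word_span :: "'a set" where
  zero: "0 \<in> word_span"
| word: "a \<in> A1 \<Longrightarrow> y \<in> odd_words \<Longrightarrow> a * y \<in> word_span"
| add: "u \<in> word_span \<Longrightarrow> v \<in> word_span \<Longrightarrow> u + v \<in> word_span"

lemma E_word_span: "z \<in> word_span \<Longrightarrow> E z = 0"
  by (induction rule: word_span.induct) (auto simp: E_add E_A1_odd_word)

lemma odd_words_subset: "y \<in> odd_words \<Longrightarrow> y \<in> word_span"
  using word_span.word[of 1 y] subalgebra_one[OF A1(1)] by simp

lemma word_span_mult: "z \<in> word_span \<Longrightarrow> a \<in> A1 \<Longrightarrow> a * z \<in> word_span"
proof (induction rule: word_span.induct)
  case (word a' y)
  then show ?case using word_span.word[of "a * a'" y] subalgebra_mult[OF A1(1)] by (simp add: mult.assoc)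
qed (auto simp: distrib_left intro: word_span.intros)

text \<open>c merges with the leftmost factor, and the product is centred again. The part in B is
  absorbed by the next factor, from \<open>A1\<close>; it remains as a constant only if there is no
  next factor.\<close>

lemma A2_mult_odd_word:
  assumes "y \<in> odd_words" "c \<in> A2" shows "\<exists>\<beta>\<in>B. \<exists>z\<in>word_span. c * y = \<beta> + z"
  using assms(1)
proof cases
  case base
  have "c * y \<in> A2" using base assms(2) by (intro subalgebra_mult[OF A2(1)])
  then have "c * y - E (c * y) \<in> odd_words"
    using A2 E_mem by (intro odd_words.base) (auto simp: E_diff intro: subalgebra_diff)
  then show ?thesis using odd_words_subset E_mem
    by (intro bexI[of _ "E (c * y)"] bexI[of _ "c * y - E (c * y)"]) auto
next
  case (step c' a y')
  define d where "d = c * c' - E (c * c')"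
  have "c * c' \<in> A2" using step assms(2) by (intro subalgebra_mult[OF A2(1)])
  then have d: "d \<in> A2" "E d = 0"
    using A2 E_mem by (auto simp: d_def E_diff intro: subalgebra_diff)
  have "d * a * y' \<in> word_span" using d step by (intro odd_words_subset odd_words.step)
  moreover have "(E (c * c') * a) * y' \<in> word_span"
    using step A1 E_mem by (intro word_span.word subalgebra_mult[OF A1(1)]) auto
  ultimately have "d * a * y' + (E (c * c') * a) * y' \<in> word_span" by (rule word_span.add)
  moreover have "c * y = 0 + (d * a * y' + (E (c * c') * a) * y')"
    using step(1) by (simp add: d_def algebra_simps)
  ultimately show ?thesis using subalgebra_zero[OF B_subalgebra] by blast
qed

lemma A2_mult_word_span:
  assumes "z \<in> word_span" "c \<in> A2" shows "\<exists>\<beta>\<in>B. \<exists>z'\<in>word_span. c * z = \<beta> + z'"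
  using assms(1)
proof induction
  case zero
  then show ?case using subalgebra_zero[OF B_subalgebra] word_span.zero by force
next
  case (add u v)
  then obtain \<beta> z \<beta>' z' where "\<beta> \<in> B" "z \<in> word_span" "c * u = \<beta> + z" "\<beta>' \<in> B" "z' \<in> word_span" "c * v = \<beta>' + z'"
    by blast
  then show ?case
    by (intro bexI[of _ "\<beta> + \<beta>'"] bexI[of _ "z + z'"])
      (auto simp: algebra_simps intro: word_span.add subalgebra_add[OF B_subalgebra])
next
  case (word a y)
  define a0 where "a0 = a - E a"
  have a0: "a0 \<in> A1" "E a0 = 0" using word(1) A1 E_mem by (auto simp: a0_def E_diff intro: subalgebra_diff)
  define c0 where "c0 = c - E c"
  have c0: "c0 \<in> A2" "E c0 = 0" using assms(2) A2 E_mem by (auto simp: c0_def E_diff intro: subalgebra_diff)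
  \<comment> \<open>Of the three terms c0 a0 y, E c a0 y and c E a y of the expansion, only the last
    can have a component in B. As E a is in B, it is again a factor from \<open>A2\<close> times an
    odd word.\<close>
  have "c * E a \<in> A2" using assms(2) A2 E_mem by (intro subalgebra_mult[OF A2(1)]) auto
  then obtain \<beta> z where bz: "\<beta> \<in> B" "z \<in> word_span" "c * E a * y = \<beta> + z"
    using A2_mult_odd_word[OF word(2)] by blast
  have "c0 * a0 * y \<in> word_span" using c0 a0 word(2) by (intro odd_words_subset odd_words.step)
  moreover have "(E c * a0) * y \<in> word_span"
    using a0 A1 E_mem word(2) by (intro word_span.word subalgebra_mult[OF A1(1)]) auto
  ultimately have "c0 * a0 * y + (E c * a0) * y + z \<in> word_span" using bz(2) by (intro word_span.add)
  moreover have "c * (a * y) = \<beta> + (c0 * a0 * y + (E c * a0) * y + z)"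
  proof -
    have "c * (a * y) = c0 * a0 * y + (E c * a0) * y + c * E a * y"
      by (simp add: a0_def c0_def algebra_simps)
    also have "\<dots> = \<beta> + (c0 * a0 * y + (E c * a0) * y + z)" unfolding bz(3) by (simp only: add_ac)
    finally show ?thesis .
  qed
  ultimately show ?case using bz(1) by blast
qed

text \<open>Multiplication by V b leaves \<open>word_span\<close> by an element of B at most. Q
  subtracts exactly this element, because E vanishes on \<open>word_span\<close>; U, being in
  \<open>A1\<close>, preserves the span.\<close>

lemma word_mem:
  assumes b: "b \<in> B" shows "word b (Suc n) \<in> word_span"
proof (induction n)
  case 0
  have "V * b \<in> A2" using V_mem b A2 by (intro subalgebra_mult[OF A2(1)]) auto
  then have "V * b - E (V * b) \<in> odd_words"
    using A2 E_mem by (intro odd_words.base) (auto simp: E_diff intro: subalgebra_diff)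
  then show ?case using word_span.word[OF U_mem] by simp
next
  case (Suc n)
  let ?w = "word b (Suc n)"
  have "V * b \<in> A2" using V_mem b A2 by (intro subalgebra_mult[OF A2(1)]) auto
  then obtain \<beta> z where bz: "\<beta> \<in> B" "z \<in> word_span" "V * b * ?w = \<beta> + z"
    using A2_mult_word_span[OF Suc] by blast
  then have "V * b * ?w - E (V * b * ?w) = z" by (simp only: bz(3)) (simp add: E_add E_id E_word_span)
  then show ?case using word_span_mult[OF bz(2) U_mem] by (simp only: word.simps(2)[of b "Suc n"])
qed

lemma E_A1_mult_word: "b \<in> B \<Longrightarrow> a \<in> A1 \<Longrightarrow> E (a * word b (Suc n)) = 0"
  by (rule E_word_span[OF word_span_mult[OF word_mem]])

lemma tau_A1_mult_word: "b \<in> B \<Longrightarrow> a \<in> A1 \<Longrightarrow> \<tau> (a * word b (Suc n)) = 0"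
  using E_A1_mult_word[of b a n] tau_E[of "a * word b (Suc n)"] by simp

lemma subordination_norm:
  assumes "b \<in> B" "norm b < 1" shows "norm (subordination b) \<le> norm b"
  using E_A1_mult_word[OF assms(1) subalgebra_one[OF A1(1)]] assms(2)
  by (intro norm_subordination_le) simp_all

text \<open>The truncated form of the equation for \<open>\<xi>\<close>; the sum telescopes up to
  the last word, which is small in L^2.\<close>

lemma sum_word_resolvent:
  "(\<Sum>n<N. word b n) - U * V * b * (\<Sum>n<N. word b n) = 1 - U * (\<Sum>n<N. cumulant b n) - word b N"
  by (induction N) (simp_all add: cumulant_def algebra_simps)

text \<open>\<open>z (1 - U F(b))\<close> is the \<open>L\<^sup>2\<close>-sum of all \<open>word b n\<close>, and only \<open>n = 0\<close> is not orthogonal to \<open>a\<close>.\<close>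
lemma tau_resolvent:
  assumes b: "b \<in> B" "norm b < 1" and z: "z * (1 - U * V * b) = 1"
    and a: "\<And>n. \<tau> (a * word b (Suc n)) = 0"
  shows "\<tau> (a * (z * (1 - U * subordination b))) = \<tau> a"
proof -
  let ?F = "\<lambda>N. \<Sum>n<N. cumulant b n" and ?X = "\<lambda>N. \<Sum>n<N. word b n"
  have X: "?X N = z * (1 - U * ?F N - word b N)" for N
  proof -
    have "?X N = z * (1 - U * V * b) * ?X N" by (simp add: z)
    also have "\<dots> = z * (?X N - U * V * b * ?X N)" by (simp add: algebra_simps)
    finally show ?thesis unfolding sum_word_resolvent .
  qed
  have aX: "\<tau> (a * ?X (Suc N)) = \<tau> a" for N
  proof (induction N)
    case (Suc N)
    have "?X (Suc (Suc N)) = ?X (Suc N) + word b (Suc N)" by simp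
    then show ?case using Suc a[of N] by (simp only: distrib_left tau_add) simp
  qed simp
  let ?t = "\<tau> (a * (z * (1 - U * subordination b)))"
  have "(\<lambda>N. \<tau> (a * ?X N)) \<longlonglongrightarrow> ?t"
  proof (rule Lim_null[THEN iffD2], rule Lim_null_comparison)
    \<comment> \<open>The last word tends to 0 in L^2 with rate \<open>norm b ^ N\<close>, so a z is
      paired with it by Cauchy-Schwarz.\<close>
    let ?g = "\<lambda>N. norm2 (a * z) * (norm (?F N - subordination b) + norm b ^ N)"
    have "cmod (\<tau> (a * ?X N) - ?t) \<le> ?g N" for N
    proof -
      have "\<tau> (a * ?X N) - ?t = \<tau> ((a * z) * (- (U * (?F N - subordination b) + word b N)))"
        unfolding X tau_diff[symmetric] by (simp add: algebra_simps)
      also have "cmod \<dots> \<le> norm2 (a * z) * norm2 (U * (?F N - subordination b) + word b N)"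
        using tau_mult_le[of "a * z" "- (U * (?F N - subordination b) + word b N)"] by (simp only: norm2_minus)
      also have "norm2 (U * (?F N - subordination b) + word b N) \<le> norm (?F N - subordination b) + norm b ^ N"
      proof -
        have "norm2 (U * (?F N - subordination b)) \<le> norm (?F N - subordination b)"
          by (simp add: norm2_unitary_mult[OF U] norm2_le_norm)
        moreover have "norm2 (word b N) \<le> norm b ^ N"
          using norm2_word_le[OF order_refl subalgebra_one[OF B_subalgebra], of b N] by simp
        ultimately show ?thesis using norm2_triangle[of "U * (?F N - subordination b)" "word b N"] by linarith
      qed
      finally show ?thesis by (simp add: mult_left_mono)
    qed
    then show "eventually (\<lambda>N. norm (\<tau> (a * ?X N) - ?t) \<le> ?g N) sequentially" by simp
    have "(\<lambda>N. norm (?F N - subordination b)) \<longlonglongrightarrow> 0"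
      by (rule tendsto_norm_zero[OF Lim_null[THEN iffD1, OF sum_cumulant_tendsto[OF b(2)]]])
    moreover have "(\<lambda>N. norm b ^ N) \<longlonglongrightarrow> 0" using b(2) by (simp add: LIMSEQ_realpow_zero)
    ultimately show "?g \<longlonglongrightarrow> 0" using tendsto_mult_right_zero tendsto_add_zero by blast
  qed
  then have "(\<lambda>N. \<tau> (a * ?X (Suc N))) \<longlonglongrightarrow> ?t" by (rule LIMSEQ_Suc)
  then show ?thesis unfolding aX by (simp add: LIMSEQ_const_iff)
qed

end

lemma (in predual) generated_wstar_algebra_closed: "closed_star_subalgebra (generated_wstar_algebra P S)"
proof -
  have "closed (generated_wstar_algebra P S)"
    unfolding generated_wstar_algebra_def
    by (rule closed_Inter) (auto simp: closed_star_subalgebra_def dest: wstar_subalgebra_closed)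
  then show ?thesis
    using generated_wstar_algebra_subalgebra generated_wstar_algebra_adj
    by (auto simp: closed_star_subalgebra_def)
qed

theorem theorem5p12:
  fixes P :: "('a::cstar_algebra \<Rightarrow>\<^sub>L complex) set"
    and \<tau> :: "'a \<Rightarrow> complex"
    and B :: "'a set"
    and U V :: 'a
    and E\<^sub>B E\<^sub>U :: "'a \<Rightarrow> 'a"
  assumes "wstar_predual P"
    and "faithful_normal_trace_state P \<tau>"
    and "wstar_subalgebra P B"
    and "unitary U" and "unitary V"
    and "trace_cond_exp \<tau> (generated_wstar_algebra P B) E\<^sub>B"
    and "trace_cond_exp \<tau> (generated_wstar_algebra P (generated_algebra (B \<union> {U, adj U}))) E\<^sub>U"
    and "free_with_amalgamation B E\<^sub>B
           (\<lambda>i::bool. if i then generated_algebra (B \<union> {U, adj U})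
                      else generated_algebra (B \<union> {V, adj V}))"
  shows "\<exists>F. F \<in> unit_ball_of B \<rightarrow> unit_ball_of B \<and>
             holomorphic_map_on B (unit_ball_of B) F \<and>
             (\<forall>b\<in>unit_ball_of B.
                E\<^sub>U (U * V * b * alg_inv (1 - U * V * b)) = U * F b * alg_inv (1 - U * F b) \<and>
                norm (F b) \<le> norm b)"
proof -
  define A1 where "A1 = generated_algebra (B \<union> {U, adj U})"
  define A2 where "A2 = generated_algebra (B \<union> {V, adj V})"
  define N where "N = generated_wstar_algebra P A1"
  interpret predual P by unfold_locales (rule assms(1))
  interpret wstar_trace P \<tau>
    using assms(2) unfolding faithful_normal_trace_state_def by unfold_locales blast+
  have B_closed: "closed_star_subalgebra B" by (rule wstar_subalgebra_closed[OF assms(3)])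
  have E: "trace_cond_exp \<tau> B E\<^sub>B" using assms(6) by (simp add: generated_wstar_algebra_self[OF assms(3)])
  have sub1: "B \<subseteq> A1" "U \<in> A1" and V_mem: "V \<in> A2"
    using generated_algebra_superset[of "B \<union> {U, adj U}"] generated_algebra_superset[of "B \<union> {V, adj V}"]
    by (auto simp: A1_def A2_def)
  interpret free_unitary_pair \<tau> B E\<^sub>B U V A1 A2
    by unfold_locales (use B_closed E assms(4,5) assms(8)[folded A1_def A2_def] sub1 V_mem in auto)
  interpret N: trace_expectation \<tau> N E\<^sub>U
    by unfold_locales (use assms(7)[folded A1_def, folded N_def] generated_wstar_algebra_closed in \<open>auto simp: N_def\<close>)
  have A1_adj: "adj x \<in> A1" if "x \<in> A1" for x
    using that unfolding A1_def
    by (rule generated_algebra_adj[rotated]) (use B_adj in \<open>auto simp: adj_adj\<close>)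
  have NA: "A1 \<subseteq> N" unfolding N_def by (rule generated_wstar_algebra_superset)
  \<comment> \<open>Here normality of all functionals with densities enters: freeness speaks about
    the algebra \<open>A1\<close>, the expectation about the W*-algebra N.\<close>
  have N_l2: "N \<subseteq> l2_closure A1" unfolding N_def
    by (rule generated_wstar_algebra_least[OF wstar_subalgebra_l2_closure[OF A1(1) A1_adj] l2_closure_superset])
  have main: "E\<^sub>U (U * V * b * alg_inv (1 - U * V * b)) = U * subordination b * alg_inv (1 - U * subordination b)"
    if b: "b \<in> B" "norm b < 1" for b
  proof -
    let ?F = "subordination b"
    have nb: "norm (U * V * b) < 1"
      using norm_mult_ineq[of "U * V" b] norm_mult_ineq[of U V] norm_unitary[OF U] norm_unitary[OF V] b(2)
        mult_right_mono[of "norm (U * V)" 1 "norm b"] by simp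
    obtain z where z: "(1 - U * V * b) * z = 1" "z * (1 - U * V * b) = 1" using neumann_inverse[OF nb] .
    have nF: "norm (U * ?F) < 1"
      using norm_mult_ineq[of U ?F] norm_unitary[OF U] subordination_norm[OF b] b(2) by simp
    obtain w where w: "(1 - U * ?F) * w = 1" "w * (1 - U * ?F) = 1" using neumann_inverse[OF nF] .
    have tau0: "\<tau> (a * (z * (1 - U * ?F))) = \<tau> a" if "a \<in> N" for a
      by (rule tau_resolvent[OF b z(2)], rule tau_eq_0_on_l2_closure[OF tau_A1_mult_word[OF b(1)]])
        (use that N_l2 in auto)
    have FN: "1 - U * ?F \<in> N"
      using subordination_mem[OF b(2)] sub1 NA
      by (intro subalgebraD[OF N.B_subalgebra]) auto
    \<comment> \<open>The equation for the expectation of z is tested against its own defect: the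
      density \<open>adj g\<close> lies in N, so \<tau>(\<open>adj g * g\<close>) vanishes and
      faithfulness applies.\<close>
    define g where "g = E\<^sub>U z * (1 - U * ?F) - 1"
    have gN: "g \<in> N" unfolding g_def
    by (rule subalgebra_diff[OF N.B_subalgebra subalgebra_mult[OF N.B_subalgebra N.E_mem FN]
          subalgebra_one[OF N.B_subalgebra]])
    have "\<tau> (adj g * g) = \<tau> (E\<^sub>U (adj g * (z * (1 - U * ?F)))) - \<tau> (adj g)"
      unfolding N.E_left[OF N.B_adj[OF gN]] N.E_right[OF FN]
      by (subst (2) g_def) (simp add: right_diff_distrib tau_diff)
    also have "\<dots> = 0" using tau0[OF N.B_adj[OF gN]] by (simp add: N.tau_E)
    finally have "g = 0" by (rule faithful)
    then have "E\<^sub>U z * (1 - U * ?F) = 1" by (simp add: g_def)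
    then have Ez: "E\<^sub>U z = w" by (metis mult.assoc mult.left_neutral mult.right_neutral w(1))
    \<comment> \<open>The elements in the assertion are the resolvents z and w minus 1, so the
      equation between resolvents suffices.\<close>
    have "U * V * b * z = z - 1" using z(1) by (simp add: left_diff_distrib eq_diff_eq diff_eq_eq add.commute)
    then have "E\<^sub>U (U * V * b * z) = E\<^sub>U (z - 1)" by simp
    also have "\<dots> = w - 1" using Ez N.E_id[OF subalgebra_one[OF N.B_subalgebra]] by (simp add: N.E_diff)
    also have "\<dots> = U * ?F * w" using w(1) by (simp add: algebra_simps)
    finally show ?thesis using alg_inv_eqI[OF z] alg_inv_eqI[OF w] by simp
  qed
  have nF: "norm (subordination b) \<le> norm b" if "b \<in> unit_ball_of B" for b
    using that subordination_norm by (simp add: unit_ball_of_def)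
  have "subordination \<in> unit_ball_of B \<rightarrow> unit_ball_of B"
    using nF subordination_mem by (force simp: unit_ball_of_def)
  then show ?thesis
    using subordination_holomorphic main nF by (intro exI[of _ subordination]) (auto simp: unit_ball_of_def)
qed

end
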